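(* Let $G=\mathrm{SL}(2)$, viewed as a group definable in the structure $M=(\mathbb{R},+,\times)$, and let $r_0\in S_G(\mathbb{R})$ be the type $\mathrm{tp}(th/\mathbb{R})$, where $h\in H$ realizes $p_0$ and $t\in T$ realizes the unique coheir of $q_0$ over $\mathbb{R},h$. Then: (i) $I=\mathrm{cl}(G(\mathbb{R})r_0)$ is a minimal closed $G(\mathbb{R})$-invariant subset of $S_G(\mathbb{R})$. (ii) $r_0$ is an idempotent with respect to the Ellis semigroup structure $*$ on $S_G(\mathbb{R})$, i.e. $r_0*r_0=r_0$. (iii) The ideal group $(r_0*I,* )$ has two elements, where $r_0*I=\{r_0*p : p\in I\}$.
   Context: Let $M=(\mathbb{R},+,\times,0,1)$, and let $K$ be a saturated real closed field which is an elementary extension of $M$ (language of rings). All types over $\mathbb{R}$ are definable. Write $G=\mathrm{SL}(2,K)$ and $G(\mathbb{R})=\mathrm{SL}(2,\mathbb{R})$. $S_G(\mathbb{R})$ is the Stone space of complete types over $\mathbb{R}$ concentrating on $G$; $G(\mathbb{R})$ acts on it by homeomorphisms by $g\,\mathrm{tp}(a/\mathbb{R})=\mathrm{tp}(ga/\mathbb{R})$, and $\mathrm{cl}$ denotes closure in $S_G(\mathbb{R})$. A minimal closed $G(\mathbb{R})$-invariant subset means a nonempty one with no proper nonempty closed $G(\mathbb{R})$-invariant subset. A type $\mathrm{tp}(a/B)$ with $\mathbb{R}\subseteq B\subseteq K$ is finitely satisfiable in $\mathbb{R}$ if every formula in it is satisfied by a tuple from $\mathbb{R}$. Every complete type $p$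 over $\mathbb{R}$ has a unique coheir over any $B\supseteq\mathbb{R}$, i.e. a unique extension to a complete type over $B$ that is finitely satisfiable in $\mathbb{R}$. Ellis semigroup: for $p,q\in S_G(\mathbb{R})$, $p*q=\mathrm{tp}(ab/\mathbb{R})$ where $b$ realizes $q$ and $a$ realizes the unique coheir of $p$ over $\mathbb{R},b$. $H$ is the subgroup of $G$ of matrices $\begin{pmatrix} b & c \\ 0 & b^{-1}\end{pmatrix}$ with $b\in K_{>0}$, $c\in K$, such a matrix being identified with the pair $(b,c)$. $T=\mathrm{SO}(2,K)$ is the subgroup of matrices $\begin{pmatrix} x & -y \\ y & x\end{pmatrix}$ with $x,y\in K$, $x^2+y^2=1$, such a matrix being identified with $(x,y)$. An element $a\in K$ is infinite if $a>r$ for all $r\in\mathbb{R}$; it is infinite over a tuple $b$ if it is greater than every element of $\mathrm{dcl}(\mathbb{R},b)$; it is positive infinitesimal if $0<a<r$ for all positive $r\in\mathbb{R}$. $p_0$ is the complete type over $\mathbb{R}$ of an element $(b,c)\in H$ with $b$ infinite and $c$ infinite over $b$. $q_0$ is the complete type over $\mathbb{R}$ of an element $(x,y)\in T$ with $y$ positive infinitesimal and $x>0$. *)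

theory Defs
  imports "HOL-Analysis.Analysis" "HOL-Computational_Algebra.Polynomial" "HOL-Algebra.Group"
begin

unbundle cardinal_syntax

section \<open>First-order formulas in the language of rings\<close>

text \<open>
  Terms and formulas of the language (+, *, 0, 1) with parameters from \<open>'c\<close>. Variables are de Bruijn
  indices and are evaluated in a list, so an n-tuple is a list of length n and \<open>Exi\<close> binds index 0.
\<close>

datatype (tm_params: 'c) tm =
  Var nat | Param 'c | Zero | One | Plus "'c tm" "'c tm" | Times "'c tm" "'c tm"
  for map: map_tm

datatype (fm_params: 'c) fm =
  Eq "'c tm" "'c tm" | Neg "'c fm" | Conj "'c fm" "'c fm" | Exi "'c fm"
  for map: map_fm

primrec tm_val :: "'a::comm_ring_1 list \<Rightarrow> 'a tm \<Rightarrow> 'a" where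
  "tm_val as (Var i) = as ! i"
| "tm_val as (Param c) = c"
| "tm_val as Zero = 0"
| "tm_val as One = 1"
| "tm_val as (Plus s t) = tm_val as s + tm_val as t"
| "tm_val as (Times s t) = tm_val as s * tm_val as t"

primrec sat :: "'a::comm_ring_1 fm \<Rightarrow> 'a list \<Rightarrow> bool" where
  "sat (Eq s t) as \<longleftrightarrow> tm_val as s = tm_val as t"
| "sat (Neg \<phi>) as \<longleftrightarrow> \<not> sat \<phi> as"
| "sat (Conj \<phi> \<psi>) as \<longleftrightarrow> sat \<phi> as \<and> sat \<psi> as"
| "sat (Exi \<phi>) as \<longleftrightarrow> (\<exists>x. sat \<phi> (x # as))"

primrec tm_below :: "nat \<Rightarrow> 'c tm \<Rightarrow> bool" where
  "tm_below n (Var i) \<longleftrightarrow> i < n"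
| "tm_below n (Param c) \<longleftrightarrow> True"
| "tm_below n Zero \<longleftrightarrow> True"
| "tm_below n One \<longleftrightarrow> True"
| "tm_below n (Plus s t) \<longleftrightarrow> tm_below n s \<and> tm_below n t"
| "tm_below n (Times s t) \<longleftrightarrow> tm_below n s \<and> tm_below n t"

text \<open>All free variables of the formula are among the first \<open>n\<close>.\<close>

primrec fm_below :: "'c fm \<Rightarrow> nat \<Rightarrow> bool" where
  "fm_below (Eq s t) n \<longleftrightarrow> tm_below n s \<and> tm_below n t"
| "fm_below (Neg \<phi>) n \<longleftrightarrow> fm_below \<phi> n"
| "fm_below (Conj \<phi> \<psi>) n \<longleftrightarrow> fm_below \<phi> n \<and> fm_below \<psi> n"
| "fm_below (Exi \<phi>) n \<longleftrightarrow> fm_below \<phi> (Suc n)"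

definition formulas :: "'c set \<Rightarrow> nat \<Rightarrow> 'c fm set" where
  "formulas A n = {\<phi>. fm_below \<phi> n \<and> fm_params \<phi> \<subseteq> A}"


section \<open>Types and saturation\<close>

text \<open>The ambient structure is always the whole type \<open>'k\<close>; parameter sets are subsets of it.\<close>

definition elementary_embedding :: "('a::comm_ring_1 \<Rightarrow> 'b::comm_ring_1) \<Rightarrow> bool" where
  "elementary_embedding \<iota> \<longleftrightarrow>
     (\<forall>\<phi> as. fm_below \<phi> (length as) \<longrightarrow> (sat (map_fm \<iota> \<phi>) (map \<iota> as) \<longleftrightarrow> sat \<phi> as))"

definition tp :: "'k::comm_ring_1 set \<Rightarrow> 'k list \<Rightarrow> 'k fm set" where
  "tp A as = {\<phi> \<in> formulas A (length as). sat \<phi> as}"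

definition complete_type :: "'k::comm_ring_1 set \<Rightarrow> nat \<Rightarrow> 'k fm set \<Rightarrow> bool" where
  "complete_type A n p \<longleftrightarrow>
     p \<subseteq> formulas A n \<and>
     (\<forall>F. finite F \<and> F \<subseteq> p \<longrightarrow> (\<exists>as. length as = n \<and> (\<forall>\<phi>\<in>F. sat \<phi> as))) \<and>
     (\<forall>\<phi>\<in>formulas A n. \<phi> \<in> p \<or> Neg \<phi> \<in> p)"

text \<open>
  \<open>\<kappa>\<close>-saturation of the structure \<open>'k\<close>; it is saturated (in its own cardinality) if this holds for
  \<open>\<kappa> = |UNIV :: 'k set|\<close>.
\<close>

definition saturated :: "'c rel \<Rightarrow> 'k::comm_ring_1 itself \<Rightarrow> bool" where
  "saturated \<kappa> (_ :: 'k itself) \<longleftrightarrow>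
     (\<forall>(A :: 'k set) n p. |A| <o \<kappa> \<and> complete_type A n p \<longrightarrow>
        (\<exists>as. length as = n \<and> tp A as = p))"

definition real_closed :: "'k::linordered_field itself \<Rightarrow> bool" where
  "real_closed (_ :: 'k itself) \<longleftrightarrow>
     (\<forall>a::'k. 0 \<le> a \<longrightarrow> (\<exists>b. b\<^sup>2 = a)) \<and>
     (\<forall>f :: 'k poly. odd (degree f) \<longrightarrow> (\<exists>x. poly f x = 0))"

definition dcl :: "'k::comm_ring_1 set \<Rightarrow> 'k set" where
  "dcl A = {a. \<exists>\<phi>\<in>formulas A 1. \<forall>x. sat \<phi> [x] \<longleftrightarrow> x = a}"

definition finitely_satisfiable_in :: "'k::comm_ring_1 set \<Rightarrow> nat \<Rightarrow> 'k fm set \<Rightarrow> bool" where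
  "finitely_satisfiable_in R n p \<longleftrightarrow>
     (\<forall>\<phi>\<in>p. \<exists>as. length as = n \<and> set as \<subseteq> R \<and> sat \<phi> as)"


section \<open>The group SL(2), its type space and the Ellis semigroup\<close>

definition SL2 :: "('k::comm_ring_1 ^2^2) set" where
  "SL2 = {g. det g = 1}"

definition mat22 :: "'k \<Rightarrow> 'k \<Rightarrow> 'k \<Rightarrow> 'k \<Rightarrow> 'k::comm_ring_1 ^2^2" where
  "mat22 a b c d = vector [vector [a, b], vector [c, d]]"

text \<open>A matrix, viewed as a 4-tuple.\<close>

definition entries :: "'k^2^2 \<Rightarrow> 'k list" where
  "entries g = [g$1$1, g$1$2, g$2$1, g$2$2]"

definition SL2_over :: "'k set \<Rightarrow> ('k::comm_ring_1 ^2^2) set" where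
  "SL2_over R = {g \<in> SL2. set (entries g) \<subseteq> R}"

abbreviation mtp :: "'k::comm_ring_1 set \<Rightarrow> 'k^2^2 \<Rightarrow> 'k fm set" where
  "mtp A g \<equiv> tp A (entries g)"

text \<open>The formula \<open>x\<^sub>0 x\<^sub>3 = 1 + x\<^sub>1 x\<^sub>2\<close> defining SL(2).\<close>

definition SL2_fm :: "'k fm" where
  "SL2_fm = Eq (Times (Var 0) (Var 3)) (Plus One (Times (Var 1) (Var 2)))"

definition S_G :: "'k::comm_ring_1 set \<Rightarrow> 'k fm set set" where
  "S_G R = {p. complete_type R 4 p \<and> SL2_fm \<in> p}"

definition stone :: "'k::comm_ring_1 set \<Rightarrow> 'k fm set topology" where
  "stone R = topology_generated_by {{p \<in> S_G R. \<phi> \<in> p} | \<phi>. \<phi> \<in> formulas R 4}"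

definition act :: "'k::comm_ring_1 set \<Rightarrow> 'k^2^2 \<Rightarrow> 'k fm set \<Rightarrow> 'k fm set" where
  "act R g p = (THE q. \<exists>a\<in>SL2. mtp R a = p \<and> q = mtp R (g ** a))"

definition orbit :: "'k::comm_ring_1 set \<Rightarrow> 'k fm set \<Rightarrow> 'k fm set set" where
  "orbit R p = (\<lambda>g. act R g p) ` SL2_over R"

definition closed_invariant :: "'k::comm_ring_1 set \<Rightarrow> 'k fm set set \<Rightarrow> bool" where
  "closed_invariant R J \<longleftrightarrow>
     closedin (stone R) J \<and> (\<forall>g\<in>SL2_over R. \<forall>p\<in>J. act R g p \<in> J)"

definition minimal_closed_invariant :: "'k::comm_ring_1 set \<Rightarrow> 'k fm set set \<Rightarrow> bool" where
  "minimal_closed_invariant R J \<longleftrightarrow>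
     J \<noteq> {} \<and> closed_invariant R J \<and>
     (\<forall>J'. J' \<noteq> {} \<and> closed_invariant R J' \<and> J' \<subseteq> J \<longrightarrow> J' = J)"

definition is_coheir ::
  "'k::comm_ring_1 set \<Rightarrow> 'k set \<Rightarrow> 'k fm set \<Rightarrow> 'k fm set \<Rightarrow> bool" where
  "is_coheir R B p q \<longleftrightarrow> complete_type B 4 q \<and> p \<subseteq> q \<and> finitely_satisfiable_in R 4 q"

definition star :: "'k::comm_ring_1 set \<Rightarrow> 'k fm set \<Rightarrow> 'k fm set \<Rightarrow> 'k fm set" where
  "star R p q = (THE r. \<exists>a\<in>SL2. \<exists>b\<in>SL2.
     mtp R b = q \<and>
     (let B = R \<union> set (entries b) in is_coheir R B p (mtp B a)) \<and>
     r = mtp R (a ** b))"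


section \<open>The subgroups H and T and the types \<open>p\<^sub>0\<close>, \<open>q\<^sub>0\<close>, \<open>r\<^sub>0\<close>\<close>

text \<open>
  Types of elements of H and T are types of the matrices (4-tuples), also where the element is
  named by a pair: pair and matrix are interdefinable without parameters.
\<close>

definition H_elem :: "'k \<Rightarrow> 'k \<Rightarrow> 'k::linordered_field ^2^2" where
  "H_elem b c = mat22 b c 0 (inverse b)"

definition H :: "('k::linordered_field ^2^2) set" where
  "H = {H_elem b c | b c. 0 < b}"

definition T_elem :: "'k \<Rightarrow> 'k \<Rightarrow> 'k::comm_ring_1 ^2^2" where
  "T_elem x y = mat22 x (- y) y x"

definition T :: "('k::comm_ring_1 ^2^2) set" where
  "T = {T_elem x y | x y. x\<^sup>2 + y\<^sup>2 = 1}"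

definition infinite_elem :: "'k::linordered_field set \<Rightarrow> 'k \<Rightarrow> bool" where
  "infinite_elem R a \<longleftrightarrow> (\<forall>r\<in>R. r < a)"

definition infinite_over :: "'k::linordered_field set \<Rightarrow> 'k list \<Rightarrow> 'k \<Rightarrow> bool" where
  "infinite_over R bs a \<longleftrightarrow> (\<forall>d\<in>dcl (R \<union> set bs). d < a)"

definition positive_infinitesimal :: "'k::linordered_field set \<Rightarrow> 'k \<Rightarrow> bool" where
  "positive_infinitesimal R a \<longleftrightarrow> 0 < a \<and> (\<forall>r\<in>R. 0 < r \<longrightarrow> a < r)"

definition p0 :: "'k::linordered_field set \<Rightarrow> 'k fm set" where
  "p0 R = (THE p. \<exists>b c. H_elem b c \<in> H \<and> infinite_elem R b \<and> infinite_over R [b] c \<and>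
     p = mtp R (H_elem b c))"

definition q0 :: "'k::linordered_field set \<Rightarrow> 'k fm set" where
  "q0 R = (THE q. \<exists>x y. T_elem x y \<in> T \<and> positive_infinitesimal R y \<and> 0 < x \<and>
     q = mtp R (T_elem x y))"

definition r0 :: "'k::linordered_field set \<Rightarrow> 'k fm set" where
  "r0 R = (THE r. \<exists>h\<in>H. \<exists>t\<in>T.
     mtp R h = p0 R \<and>
     (let B = R \<union> set (entries h) in is_coheir R B (q0 R) (mtp B t)) \<and>
     r = mtp R (t ** h))"

end

theory Submission
  imports Defs
begin

text \<open>
  By quantifier elimination, a formula restricted to one variable changes its truth value at boundedly
  many points only, over the reals and by transfer over the extension. Hence iterated limits over the
  reals define complete types: \<open>p\<^sub>0\<close> is the limit of \<open>(b, c)\<close> for c and then b tending to infinity, and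
  writing rotations as lower unipotent matrices times elements of \<open>H\<close>, \<open>r\<^sub>0\<close> becomes the limit of
  \<open>(1 0; m 1) (b c; 0 1/b)\<close> for c to infinity, b to infinity, m to 0+.

  If b realizes a type in the orbit closure, every nonzero real combination of its rows realizes \<open>p\<^sub>0\<close> up
  to sign, because this closed condition passes from \<open>r\<^sub>0\<close> to the closure. The first column of b has a real
  standard direction, and a coheir a of \<open>r\<^sub>0\<close> moves it into the positive or negative first axis. If
  a formula of \<open>r\<^sub>0\<close> failed at \<open>\<plusminus>a b\<close>, finite satisfiability would give a real g at which it fails with
  \<open>g b\<close> of slope near a small positive real, and those slopes avoid the finitely many standard parts of
  boundary points. So \<open>r\<^sub>0 * p\<close> is \<open>r\<^sub>0\<close> or \<open>- r\<^sub>0\<close> for all p in the closure, which yields minimality (\<open>r\<^sub>0 * p\<close> lies in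
  the orbit closure of p) and the two-element group.
\<close>

section \<open>Quantifier elimination over the reals\<close>

text \<open>Coheirs enter only through finite satisfiability. A failure of \<phi> at
  \<open>a ** b\<close> is a formula about \<open>a\<close> with parameters from \<open>b\<close>;
  if \<open>a\<close> realizes a coheir, \<phi> also fails at \<open>emb g ** b\<close> for some
  real \<open>g\<close>, and any one formula of the type of \<open>a\<close> may be demanded of
  \<open>g\<close> at the same time. Products with coheirs thus reduce to real translates of
  \<open>b\<close>, whose types are known. The price is that the slope of \<open>emb g ** b\<close>
  is only infinitely close to the real number prescribed by \<open>g\<close>. A formula valid at
  real slopes has to be carried over to whole monads, and for this the number of boundary points
  must be bounded uniformly in the parameters, so that finiteness becomes a sentence. Since
  \<open>star\<close> is a definite description, its value must also be shown not to depend on the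
  realizations chosen for the two factors. Here this comes down to the constancy of one
  sign.\<close>

definition coeff_poly :: "'a::comm_ring_1 list \<Rightarrow> 'a tm list \<Rightarrow> 'a poly" where
  "coeff_poly as cs = Poly (map (tm_val as) cs)"

lemma coeff_poly_Nil [simp]: "coeff_poly as [] = 0"
  by (simp add: coeff_poly_def)

lemma coeff_poly_Cons [simp]: "coeff_poly as (c # cs) = pCons (tm_val as c) (coeff_poly as cs)"
  by (simp add: coeff_poly_def)

lemma coeff_coeff_poly:
  "coeff (coeff_poly as cs) i = (if i < length cs then tm_val as (cs ! i) else 0)"
  by (simp add: coeff_poly_def nth_default_def coeff_Poly_eq)

text \<open>The elimination recurses on the length of the list, not on the degree, because a last
  term may vanish at some tuples and not at others. Dropping a vanishing last term is the step that
  reconciles the two.\<close>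

lemma coeff_poly_butlast:
  assumes "cs \<noteq> []" "tm_val as (last cs) = 0"
  shows "coeff_poly as (butlast cs) = coeff_poly as cs"
proof -
  obtain bs c where "cs = bs @ [c]" using assms(1) by (metis append_butlast_last_id)
  then show ?thesis using assms(2) by (simp add: coeff_poly_def Poly_snoc)
qed

lemma degree_coeff_poly:
  assumes "cs \<noteq> []" "tm_val as (last cs) \<noteq> 0"
  shows "degree (coeff_poly as cs) = length cs - 1" "lead_coeff (coeff_poly as cs) = tm_val as (last cs)"
proof -
  show 1: "degree (coeff_poly as cs) = length cs - 1"
  proof (rule antisym)
    show "degree (coeff_poly as cs) \<le> length cs - 1"
      by (rule degree_le) (auto simp: coeff_coeff_poly)
    show "length cs - 1 \<le> degree (coeff_poly as cs)"
      by (rule le_degree) (use assms in \<open>auto simp: coeff_coeff_poly last_conv_nth\<close>)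
  qed
  show "lead_coeff (coeff_poly as cs) = tm_val as (last cs)"
    using assms by (simp add: 1 coeff_coeff_poly last_conv_nth)
qed

definition deriv_coeffs :: "real tm list \<Rightarrow> real tm list" where
  "deriv_coeffs cs = map (\<lambda>i. Times (Param (real (Suc i))) (cs ! Suc i)) [0..<length cs - 1]"

lemma length_deriv_coeffs [simp]: "length (deriv_coeffs cs) = length cs - 1"
  by (simp add: deriv_coeffs_def)

lemma coeff_poly_deriv: "coeff_poly as (deriv_coeffs cs) = pderiv (coeff_poly as cs)"
  by (rule poly_eqI) (auto simp: coeff_coeff_poly coeff_pderiv deriv_coeffs_def)

lemma coeff_poly_add:
  "\<exists>ds. \<forall>as::'a::comm_ring_1 list. coeff_poly as ds = coeff_poly as bs + coeff_poly as cs"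
proof (induction bs arbitrary: cs)
  case Nil
  then show ?case by (intro exI[of _ cs]) simp
next
  case (Cons b bs)
  show ?case
  proof (cases cs)
    case Nil
    then show ?thesis by (intro exI[of _ "b # bs"]) simp
  next
    case (Cons c cs')
    obtain ds where "\<forall>as::'a list. coeff_poly as ds = coeff_poly as bs + coeff_poly as cs'"
      using Cons.IH by blast
    then show ?thesis using Cons by (intro exI[of _ "Plus b c # ds"]) simp
  qed
qed

lemma coeff_poly_tm: "\<exists>cs. \<forall>as x. tm_val (x # as) t = poly (coeff_poly as cs) (x :: 'a :: comm_ring_1)"
proof (induction t)
  case (Var i)
  show ?case
  proof (cases i)
    case 0
    then show ?thesis by (intro exI[of _ "[Zero, One]"]) simp
  next
    case (Suc j)
    then show ?thesis by (intro exI[of _ "[Var j]"]) simp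
  qed
next
  case (Param c)
  show ?case by (intro exI[of _ "[Param c]"]) simp
next
  case Zero
  show ?case by (intro exI[of _ "[]"]) simp
next
  case One
  show ?case by (intro exI[of _ "[One]"]) simp
next
  case (Plus s t)
  then obtain bs cs where bs: "\<And>as x. tm_val (x # as) s = poly (coeff_poly as bs) x"
    and cs: "\<And>as x. tm_val (x # as) t = poly (coeff_poly as cs) x" by blast
  obtain ds where "\<forall>as::'a list. coeff_poly as ds = coeff_poly as bs + coeff_poly as cs"
    using coeff_poly_add by blast
  then show ?case using bs cs by (intro exI[of _ ds]) simp
next
  case (Times s t)
  then obtain bs cs where bs: "\<And>as x. tm_val (x # as) s = poly (coeff_poly as bs) x"
    and cs: "\<And>as x. tm_val (x # as) t = poly (coeff_poly as cs) x" by blast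
  have smult: "coeff_poly as (map (Times b) cs) = smult (tm_val as b) (coeff_poly as cs)" for b as cs
    by (induction cs) simp_all
  have "\<exists>ds. \<forall>as::'a list. coeff_poly as ds = coeff_poly as bs * coeff_poly as cs" for bs
  proof (induction bs)
    case Nil
    then show ?case by (intro exI[of _ "[]"]) simp
  next
    case (Cons b bs)
    then obtain ds where ds: "\<forall>as::'a list. coeff_poly as ds = coeff_poly as bs * coeff_poly as cs" by blast
    obtain es where "\<forall>as::'a list. coeff_poly as es
        = coeff_poly as (map (Times b) cs) + coeff_poly as (Zero # ds)"
      using coeff_poly_add by blast
    then show ?case using ds by (intro exI[of _ es]) (simp add: smult)
  qed
  then obtain ds where "\<forall>as::'a list. coeff_poly as ds = coeff_poly as bs * coeff_poly as cs" by blast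
  then show ?case using bs cs by (intro exI[of _ ds]) simp
qed

text \<open>One list serves all tuples, so its length bounds the number of roots in the first
  variable uniformly.\<close>

definition tm_coeffs :: "'a::comm_ring_1 tm \<Rightarrow> 'a tm list" where
  "tm_coeffs t = (SOME cs. \<forall>as x. tm_val (x # as) t = poly (coeff_poly as cs) x)"

lemma tm_val_Cons: "tm_val (x # as) t = poly (coeff_poly as (tm_coeffs t)) x"
  using someI_ex[OF coeff_poly_tm[of t], folded tm_coeffs_def] by blast

text \<open>Multiplying by squares of the leading coefficient keeps the sign at the roots of the divisor.\<close>

lemma pseudo_remainder:
  fixes fs hs :: "real tm list"
  assumes "hs \<noteq> []"
  shows "\<exists>rs. length rs < length hs \<and>
    (\<forall>as x. tm_val as (last hs) \<noteq> 0 \<and> poly (coeff_poly as hs) x = 0 \<longrightarrow>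
       sgn (poly (coeff_poly as rs) x) = sgn (poly (coeff_poly as fs) x))"
proof (induction "length fs" arbitrary: fs rule: less_induct)
  case less
  show ?case
  proof (cases "length fs < length hs")
    case False
    define c a k where "c = last hs" and "a = last fs" and "k = length fs - length hs"
    have fs: "fs \<noteq> []" using False assms by auto
    have k: "length fs = k + length hs" using False by (simp add: k_def)
    \<comment> \<open>This is \<open>c\<^sup>2 * f - a * c * x^k * h\<close>. The top coefficient
      cancels, which is why only the \<open>butlast\<close> lists are combined, and at a root of
      \<open>h\<close> the value is \<open>c\<^sup>2\<close> times that of \<open>f\<close>.\<close>
    define rs where "rs = map2 (\<lambda>u v. Plus (Times (Times c c) u) (Times (Param (-1)) (Times (Times a c) v)))
      (butlast fs) (replicate k Zero @ butlast hs)"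
    have len: "length rs = length fs - 1"
      using k assms by (cases hs) (auto simp: rs_def)
    have "coeff_poly as rs = smult ((tm_val as c)\<^sup>2) (coeff_poly as fs)
       - monom (tm_val as a * tm_val as c) k * coeff_poly as hs" for as
    proof (rule poly_eqI)
      fix i
      have l: "length hs \<ge> 1" using assms by (cases hs) auto
      consider "i < length fs - 1" | "i = length fs - 1" | "i \<ge> length fs" by linarith
      then show "coeff (coeff_poly as rs) i = coeff (smult ((tm_val as c)\<^sup>2) (coeff_poly as fs)
        - monom (tm_val as a * tm_val as c) k * coeff_poly as hs) i"
      proof cases
        case 1
        have 2: "(replicate k Zero @ butlast hs) ! i = (if i < k then Zero else hs ! (i - k))"
          using 1 k by (simp add: nth_append nth_butlast)
        have "rs ! i = Plus (Times (Times c c) (fs ! i))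
          (Times (Param (-1)) (Times (Times a c) (if i < k then Zero else hs ! (i - k))))"
          using 1 k l by (simp add: rs_def nth_butlast 2 del: if_split)
        moreover have "i - k < length hs" "i < length fs" using 1 k l by linarith+
        ultimately show ?thesis using 1
          by (simp add: coeff_coeff_poly len coeff_monom_mult power2_eq_square)
      next
        case 2
        then have "fs ! i = a" "hs ! (i - k) = c" using fs assms k l
          by (simp_all add: a_def c_def last_conv_nth)
        moreover have "i - k < length hs" "i < length fs" "\<not> i < k" "\<not> i < length rs" using 2 k l len by linarith+
        ultimately show ?thesis
          by (simp add: coeff_coeff_poly coeff_monom_mult power2_eq_square)
      next
        case 3
        then have "\<not> i - k < length hs" "\<not> i < length rs" "\<not> i < length fs" using k l len by linarith+
        then show ?thesis by (simp add: coeff_coeff_poly coeff_monom_mult)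
      qed
    qed
    then have sg: "sgn (poly (coeff_poly as rs) x) = sgn (poly (coeff_poly as fs) x)"
      if "tm_val as (last hs) \<noteq> 0" "poly (coeff_poly as hs) x = 0" for as x
      using that by (simp add: sgn_mult c_def) (simp add: sgn_if)
    have "length rs < length fs" using len fs by (cases fs) auto
    from less[OF this] obtain rs' where "length rs' < length hs"
      "\<forall>as x. tm_val as (last hs) \<noteq> 0 \<and> poly (coeff_poly as hs) x = 0 \<longrightarrow>
       sgn (poly (coeff_poly as rs') x) = sgn (poly (coeff_poly as rs) x)" by blast
    then show ?thesis using sg by (intro exI[of _ rs']) auto
  qed auto
qed

definition pseudo_rem :: "real tm list \<Rightarrow> real tm list \<Rightarrow> real tm list" where
  "pseudo_rem fs hs = (SOME rs. length rs < length hs \<and>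
    (\<forall>as x. tm_val as (last hs) \<noteq> 0 \<and> poly (coeff_poly as hs) x = 0 \<longrightarrow>
       sgn (poly (coeff_poly as rs) x) = sgn (poly (coeff_poly as fs) x)))"

lemma pseudo_rem:
  assumes "hs \<noteq> []"
  shows "length (pseudo_rem fs hs) < length hs"
    and "tm_val as (last hs) \<noteq> 0 \<Longrightarrow> poly (coeff_poly as hs) x = 0 \<Longrightarrow>
       sgn (poly (coeff_poly as (pseudo_rem fs hs)) x) = sgn (poly (coeff_poly as fs) x)"
  using someI_ex[OF pseudo_remainder[OF assms, of fs], folded pseudo_rem_def] by blast+

section \<open>Families closed under truncation, differentiation and pseudo-division\<close>

text \<open>The closure conditions of Cohen-Hormander elimination, demanded only of lists longer
  than \<open>j\<close> so that they can be established from long lists down to short ones.\<close>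

definition ops_closed :: "nat \<Rightarrow> real tm list set \<Rightarrow> bool" where
  "ops_closed j C \<longleftrightarrow> (\<forall>hs\<in>C. length hs > j \<longrightarrow> butlast hs \<in> C \<and> deriv_coeffs hs \<in> C \<and>
     (\<forall>fs\<in>C. length hs \<le> length fs \<longrightarrow> pseudo_rem fs hs \<in> C))"

text \<open>Every operation on a list of length \<open>Suc j\<close> yields a list of length at most
  \<open>j\<close>. Additions made at one level therefore create no obligation at that level or
  above, and the downward induction keeps the set finite.\<close>

lemma closure_exists:
  fixes L :: "real tm list set"
  assumes "finite L"
  shows "\<exists>C. finite C \<and> L \<subseteq> C \<and>
    ops_closed 0 C"
proof -
  define N where "N = Max (length ` L)"
  have N: "\<forall>fs\<in>L. length fs \<le> N"
    using assms by (simp add: N_def)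
  have "\<exists>C. finite C \<and> L \<subseteq> C \<and> (\<forall>fs\<in>C. length fs \<le> N) \<and>
    ops_closed j C" if "j \<le> N" for j
    using that
  proof (induction rule: inc_induct)
    case base
    show ?case using assms N by (intro exI[of _ L]) (auto simp: ops_closed_def)
  next
    case (step j)
    then obtain C where C: "finite C" "L \<subseteq> C" "\<forall>fs\<in>C. length fs \<le> N"
      and cl: "ops_closed (Suc j) C" by blast
    define B where "B = {hs\<in>C. length hs = Suc j}"
    define D where "D = butlast ` B \<union> deriv_coeffs ` B \<union> (\<Union>hs\<in>B. (\<lambda>fs. pseudo_rem fs hs) ` C)"
    have D: "length fs \<le> j" if "fs \<in> D" for fs
    proof -
      from that consider hs where "hs \<in> B" "fs = butlast hs" | hs where "hs \<in> B" "fs = deriv_coeffs hs"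
        | hs gs where "hs \<in> B" "fs = pseudo_rem gs hs" by (auto simp: D_def)
      then show ?thesis
      proof cases
        case 3
        then have "hs \<noteq> []" "length hs = Suc j" by (auto simp: B_def)
        then show ?thesis using pseudo_rem(1)[of hs gs] 3 by simp
      qed (auto simp: B_def)
    qed
    have "ops_closed j (C \<union> D)"
      unfolding ops_closed_def
    proof (intro conjI ballI impI)
      fix hs assume hs: "hs \<in> C \<union> D" "j < length hs"
      with D have hsC: "hs \<in> C" using leD by blast
      show "butlast hs \<in> C \<union> D" "deriv_coeffs hs \<in> C \<union> D"
        using hs hsC cl by (cases "length hs = Suc j"; simp add: D_def B_def ops_closed_def)+
      fix fs assume fs: "fs \<in> C \<union> D" "length hs \<le> length fs"
      then have fsC: "fs \<in> C" using D[of fs] hs by auto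
      show "pseudo_rem fs hs \<in> C \<union> D"
      proof (cases "length hs = Suc j")
        case True
        then show ?thesis using hsC fsC unfolding D_def B_def by blast
      next
        case False
        then show ?thesis using hsC fsC hs fs cl by (simp add: ops_closed_def)
      qed
    qed
    moreover have "finite (C \<union> D)" using C(1) by (simp add: D_def B_def)
    moreover have "\<forall>fs\<in>C \<union> D. length fs \<le> N"
      using D C(3) step.hyps by (meson UnE le_trans less_imp_le)
    ultimately show ?case using C(2) by blast
  qed
  from this[of 0] show ?thesis by blast
qed

section \<open>Comparing sign patterns along two intervals\<close>

text \<open>
  A finite combinatorial certificate that the sign patterns \<open>E\<close> compares are the same along
  the interval (l, u) and along (l', u'): both are cut at corresponding points satisfying \<open>Z\<close>,
  and any two points of corresponding gaps are related.
\<close>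

inductive matched :: "(real \<Rightarrow> real \<Rightarrow> bool) \<Rightarrow> (real \<Rightarrow> bool) \<Rightarrow> real \<Rightarrow> real \<Rightarrow> real \<Rightarrow> real \<Rightarrow> bool"
  for E Z where
  gap: "l < u \<Longrightarrow> l' < u' \<Longrightarrow> (\<And>x y. l < x \<Longrightarrow> x < u \<Longrightarrow> l' < y \<Longrightarrow> y < u' \<Longrightarrow> E x y) \<Longrightarrow> matched E Z l u l' u'"
| cut: "matched E Z l a l' a' \<Longrightarrow> matched E Z a u a' u' \<Longrightarrow> E a a' \<Longrightarrow> Z a \<Longrightarrow> matched E Z l u l' u'"

lemma matched_less: "matched E Z l u l' u' \<Longrightarrow> l < u \<and> l' < u'"
  by (induction rule: matched.induct) auto

lemma matched_mono:
  assumes "matched E Z l u l' u'" "\<And>x y. E x y \<Longrightarrow> E' x y" "\<And>x. Z x \<Longrightarrow> Z' x"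
  shows "matched E' Z' l u l' u'"
  using assms(1) by induction (auto intro: matched.intros assms)

text \<open>This turns a certificate into a witness for an existential quantifier over the second
  tuple.\<close>

lemma matched_partner:
  assumes "matched E Z l u l' u'" "l < x" "x < u"
  shows "\<exists>y. l' < y \<and> y < u' \<and> E x y"
  using assms
proof (induction arbitrary: x)
  case (gap l u l' u')
  then show ?case using dense[of l' u'] by blast
next
  case (cut l a l' a' u u')
  then have "l' < a'" "a' < u'" using matched_less by blast+
  consider "x < a" | "x = a" | "a < x" by linarith
  then show ?case
  proof cases
    case 1
    then show ?thesis using cut.IH(1)[of x] cut.prems \<open>a' < u'\<close> less_trans by blast
  next
    case 2
    then show ?thesis using cut.hyps \<open>l' < a'\<close> \<open>a' < u'\<close> by blast
  next
    case 3
    then show ?thesis using cut.IH(2)[of x] cut.prems \<open>l' < a'\<close> less_trans by blast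
  qed
qed

text \<open>Monotonicity extends to the closed interval although the derivative is controlled only
  inside; hence the signs at the end points determine what happens in the gap.\<close>

lemma poly_strict_mono_gap:
  fixes g :: "real poly"
  assumes "\<And>x. l < x \<Longrightarrow> x < u \<Longrightarrow> poly (pderiv g) x > 0" "l \<le> x" "x < y" "y \<le> u"
  shows "poly g x < poly g y"
proof (rule DERIV_pos_imp_increasing_open[OF assms(3)])
  fix z assume "x < z" "z < y"
  then show "\<exists>y. (poly g has_real_derivative y) (at z) \<and> 0 < y"
    using assms by (intro exI[of _ "poly (pderiv g) z"]) (auto intro: poly_DERIV)
qed (auto intro: continuous_intros)

text \<open>
  On a gap a monotone polynomial changes sign at most once, and the signs at the two ends tell
  whether it does.
\<close>

lemma matched_gap_increasing:
  fixes g g' :: "real poly"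
  assumes "l < u" "l' < u'"
    and E: "\<And>x y. l < x \<Longrightarrow> x < u \<Longrightarrow> l' < y \<Longrightarrow> y < u' \<Longrightarrow> E x y"
    and d: "\<And>x. l < x \<Longrightarrow> x < u \<Longrightarrow> poly (pderiv g) x > 0"
    and d': "\<And>x. l' < x \<Longrightarrow> x < u' \<Longrightarrow> poly (pderiv g') x > 0"
    and l: "sgn (poly g l) = sgn (poly g' l')" and u: "sgn (poly g u) = sgn (poly g' u')"
  shows "matched (\<lambda>x y. E x y \<and> sgn (poly g x) = sgn (poly g' y)) (\<lambda>x. Z x \<or> poly g x = 0) l u l' u'"
proof -
  note mono = poly_strict_mono_gap[of l u g, OF d] and mono' = poly_strict_mono_gap[of l' u' g', OF d']
  consider "poly g l \<ge> 0" | "poly g u \<le> 0" | "poly g l < 0" "poly g u > 0" by linarith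
  then show ?thesis
  proof cases
    case 1
    then have "poly g' l' \<ge> 0" using l by (metis sgn_zero_iff linorder_not_less sgn_less)
    then have "poly g x > 0" "poly g' y > 0" if "l < x" "x < u" "l' < y" "y < u'" for x y
      using mono[of l x] mono'[of l' y] 1 that by auto
    then show ?thesis using assms(1,2) E by (intro matched.gap) auto
  next
    case 2
    then have "poly g' u' \<le> 0" using u by (metis sgn_zero_iff linorder_not_less sgn_greater)
    then have "poly g x < 0" "poly g' y < 0" if "l < x" "x < u" "l' < y" "y < u'" for x y
      using mono[of x u] mono'[of y u'] 2 that by auto
    then show ?thesis using assms(1,2) E by (intro matched.gap) auto
  next
    case 3
    then have neg': "poly g' l' < 0" "poly g' u' > 0" using l u by (metis sgn_less, metis sgn_greater)
    obtain z where z: "l < z" "z < u" "poly g z = 0" using poly_IVT_pos[OF assms(1) 3] by blast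
    obtain z' where z': "l' < z'" "z' < u'" "poly g' z' = 0" using poly_IVT_pos[OF assms(2) neg'] by blast
    show ?thesis
    proof (rule matched.cut[of _ _ l z l' z' u u'])
      show "matched (\<lambda>x y. E x y \<and> sgn (poly g x) = sgn (poly g' y)) (\<lambda>x. Z x \<or> poly g x = 0) l z l' z'"
      proof (rule matched.gap)
        fix x y assume "l < x" "x < z" "l' < y" "y < z'"
        then show "E x y \<and> sgn (poly g x) = sgn (poly g' y)"
          using E[of x y] mono[of x z] mono'[of y z'] z z' by auto
      qed (use z z' in auto)
      show "matched (\<lambda>x y. E x y \<and> sgn (poly g x) = sgn (poly g' y)) (\<lambda>x. Z x \<or> poly g x = 0) z u z' u'"
      proof (rule matched.gap)
        fix x y assume "z < x" "x < u" "z' < y" "y < u'"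
        then show "E x y \<and> sgn (poly g x) = sgn (poly g' y)"
          using E[of x y] mono[of z x] mono'[of z' y] z z' by auto
      qed (use z z' in auto)
    qed (use E[of z z'] z z' in auto)
  qed
qed

text \<open>All points of one gap are related to the same partners, so both derivatives have one
  common sign there. It is not zero, as a nonzero polynomial cannot vanish on an interval. The
  decreasing case is the increasing one for \<open>- g\<close> and \<open>- g'\<close>.\<close>

lemma matched_gap:
  fixes g g' :: "real poly"
  assumes "l < u" "l' < u'"
    and E: "\<And>x y. l < x \<Longrightarrow> x < u \<Longrightarrow> l' < y \<Longrightarrow> y < u' \<Longrightarrow> E x y"
    and d: "\<And>x y. E x y \<Longrightarrow> sgn (poly (pderiv g) x) = sgn (poly (pderiv g') y)" "pderiv g \<noteq> 0"
    and l: "sgn (poly g l) = sgn (poly g' l')" and u: "sgn (poly g u) = sgn (poly g' u')"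
  shows "matched (\<lambda>x y. E x y \<and> sgn (poly g x) = sgn (poly g' y)) (\<lambda>x. Z x \<or> poly g x = 0) l u l' u'"
proof -
  define m m' where "m = (l + u) / 2" and "m' = (l' + u') / 2"
  have m: "l < m" "m < u" "l' < m'" "m' < u'" using assms by (auto simp: m_def m'_def)
  have x: "sgn (poly (pderiv g) x) = sgn (poly (pderiv g) m)" if "l < x" "x < u" for x
    using d(1)[OF E, of x m'] d(1)[OF E, of m m'] that m by simp
  have y: "sgn (poly (pderiv g') y) = sgn (poly (pderiv g) m)" if "l' < y" "y < u'" for y
    using d(1)[OF E, of m y] that m by simp
  have "poly (pderiv g) m \<noteq> 0"
  proof
    assume "poly (pderiv g) m = 0"
    then have "{l<..<u} \<subseteq> {x. poly (pderiv g) x = 0}" using x by (auto simp: sgn_zero_iff)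
    then show False using poly_roots_finite[OF d(2)] assms(1)
      by (meson finite_subset infinite_Ioo)
  qed
  then consider "poly (pderiv g) m > 0" | "poly (pderiv g) m < 0" by linarith
  then show ?thesis
  proof cases
    case 1
    then show ?thesis using x y assms
      by (intro matched_gap_increasing) (auto simp: sgn_1_pos)
  next
    case 2
    have "matched (\<lambda>x y. E x y \<and> sgn (poly (- g) x) = sgn (poly (- g') y)) (\<lambda>x. Z x \<or> poly (- g) x = 0) l u l' u'"
      using x y assms 2
      by (intro matched_gap_increasing) (auto simp: sgn_1_neg pderiv_minus sgn_minus)
    then show ?thesis by (simp add: sgn_minus)
  qed
qed

text \<open>Each gap can be refined once the signs of \<open>g\<close> and \<open>g'\<close> agree
  at its end points. At interior cut points this agreement is the assumption on \<open>Z\<close>, at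
  the two outer ends it is given.\<close>

lemma matched_insert:
  fixes g g' :: "real poly"
  assumes "matched E Z l u l' u'"
    and d: "\<And>x y. E x y \<Longrightarrow> sgn (poly (pderiv g) x) = sgn (poly (pderiv g') y)" "pderiv g \<noteq> 0"
    and Z: "\<And>x y. E x y \<Longrightarrow> Z x \<Longrightarrow> sgn (poly g x) = sgn (poly g' y)"
    and "sgn (poly g l) = sgn (poly g' l')" "sgn (poly g u) = sgn (poly g' u')"
  shows "matched (\<lambda>x y. E x y \<and> sgn (poly g x) = sgn (poly g' y)) (\<lambda>x. Z x \<or> poly g x = 0) l u l' u'"
  using assms(1,5,6)
proof induction
  case (gap l u l' u')
  show ?case by (rule matched_gap[OF gap.hyps d gap.prems])
next
  case (cut l a l' a' u u')
  have a: "sgn (poly g a) = sgn (poly g' a')" using Z cut.hyps by blast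
  show ?case
    by (rule matched.cut[OF cut.IH(1)[OF cut.prems(1) a] cut.IH(2)[OF a cut.prems(2)]])
       (use a cut.hyps in auto)
qed

section \<open>Sign tables of lists of terms\<close>

definition same_signs :: "real list \<Rightarrow> real list \<Rightarrow> real tm list set \<Rightarrow> real \<Rightarrow> real \<Rightarrow> bool" where
  "same_signs as as' D x y \<longleftrightarrow>
     (\<forall>fs\<in>D. sgn (poly (coeff_poly as fs) x) = sgn (poly (coeff_poly as' fs) y))"

text \<open>The last term must not vanish at \<open>as\<close>: only then does pseudo-division by
  \<open>hs\<close> keep signs at its roots.\<close>

definition proper_root :: "real list \<Rightarrow> real tm list set \<Rightarrow> real \<Rightarrow> bool" where
  "proper_root as D x \<longleftrightarrow>
     (\<exists>hs\<in>D. hs \<noteq> [] \<and> tm_val as (last hs) \<noteq> 0 \<and> poly (coeff_poly as hs) x = 0)"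

text \<open>A list enters the table after all shorter lists of \<open>C\<close>. If its last term
  vanishes, its truncation already has the same sign. Otherwise its derivative governs the gaps, and
  its pseudo-remainder by the list that caused a cut gives its sign at that cut.\<close>

lemma matched_insert_coeffs:
  assumes C: "ops_closed 0 C"
    and lead: "\<And>cs. cs \<in> C \<Longrightarrow> cs \<noteq> [] \<Longrightarrow> sgn (tm_val as (last cs)) = sgn (tm_val as' (last cs))"
    and ends: "same_signs as as' C l l'" "same_signs as as' C u u'"
    and m: "matched (same_signs as as' D) (proper_root as D) l u l' u'"
    and D: "D \<subseteq> C" "\<And>hs. hs \<in> D \<Longrightarrow> length hs \<le> length fs"
    and fs: "fs \<in> C" "\<And>hs. hs \<in> C \<Longrightarrow> length hs < length fs \<Longrightarrow> hs \<in> D"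
  shows "matched (same_signs as as' (insert fs D)) (proper_root as (insert fs D)) l u l' u'"
proof -
  have simple: ?thesis
    if "\<And>x y. same_signs as as' D x y \<Longrightarrow>
      sgn (poly (coeff_poly as fs) x) = sgn (poly (coeff_poly as' fs) y)"
    by (rule matched_mono[OF m]) (use that in \<open>auto simp: same_signs_def proper_root_def\<close>)
  consider "fs = []" | "fs \<noteq> []" "tm_val as (last fs) = 0" | c where "fs = [c]"
    | "fs \<noteq> []" "tm_val as (last fs) \<noteq> 0" "length fs > 1"
    by (cases fs; cases "tl fs") auto
  then show ?thesis
  proof cases
    case 1
    then show ?thesis by (intro simple) simp
  next
    case 2
    then have z: "tm_val as' (last fs) = 0" using lead[OF fs(1)] by (simp add: sgn_zero_iff)
    have "butlast fs \<in> C" using C fs(1) 2(1) by (simp add: ops_closed_def)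
    then have "butlast fs \<in> D" using 2(1) by (intro fs(2)) auto
    then show ?thesis
      using coeff_poly_butlast[OF 2] coeff_poly_butlast[OF 2(1) z]
      by (intro simple) (metis same_signs_def)
  next
    case 3
    then show ?thesis using lead[OF fs(1)] by (intro simple) simp
  next
    case 4
    have "deriv_coeffs fs \<in> C" using C fs(1) 4(1) by (simp add: ops_closed_def)
    then have der: "deriv_coeffs fs \<in> D" using 4 by (intro fs(2)) auto
    have "pderiv (coeff_poly as fs) \<noteq> 0"
      using degree_coeff_poly(1)[OF 4(1,2)] 4(3) by (simp add: pderiv_eq_0_iff)
    moreover have "sgn (poly (pderiv (coeff_poly as fs)) x) = sgn (poly (pderiv (coeff_poly as' fs)) y)"
      if "same_signs as as' D x y" for x y
      using that der unfolding same_signs_def coeff_poly_deriv[symmetric] by blast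
    moreover have "sgn (poly (coeff_poly as fs) x) = sgn (poly (coeff_poly as' fs) y)"
      if E: "same_signs as as' D x y" and Z: "proper_root as D x" for x y
    proof -
      obtain hs where hs: "hs \<in> D" "hs \<noteq> []" "tm_val as (last hs) \<noteq> 0" "poly (coeff_poly as hs) x = 0"
        using Z by (auto simp: proper_root_def)
      have lead': "tm_val as' (last hs) \<noteq> 0"
        using lead[of hs] hs D(1) by (metis sgn_zero_iff subsetD)
      have root': "poly (coeff_poly as' hs) y = 0"
        using E hs(1,4) by (metis same_signs_def sgn_zero_iff)
      \<comment> \<open>The remainder is shorter than \<open>hs\<close>, hence shorter than
        \<open>fs\<close>, hence already in the table.\<close>
      have "length hs \<le> length fs" by (rule D(2)[OF hs(1)])
      then have "pseudo_rem fs hs \<in> C"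
        using C fs(1) hs(1,2) D(1) by (auto simp: ops_closed_def)
      then have "pseudo_rem fs hs \<in> D"
        using pseudo_rem(1)[OF hs(2), of fs] \<open>length hs \<le> length fs\<close> by (intro fs(2)) auto
      then have "sgn (poly (coeff_poly as (pseudo_rem fs hs)) x) = sgn (poly (coeff_poly as' (pseudo_rem fs hs)) y)"
        using E by (simp add: same_signs_def)
      then show ?thesis
        by (simp add: pseudo_rem(2)[OF hs(2,3,4)] pseudo_rem(2)[OF hs(2) lead' root'])
    qed
    moreover have "sgn (poly (coeff_poly as fs) l) = sgn (poly (coeff_poly as' fs) l')"
      "sgn (poly (coeff_poly as fs) u) = sgn (poly (coeff_poly as' fs) u')"
      using ends fs(1) by (auto simp: same_signs_def)
    ultimately have "matched (\<lambda>x y. same_signs as as' D x y \<and>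
        sgn (poly (coeff_poly as fs) x) = sgn (poly (coeff_poly as' fs) y))
      (\<lambda>x. proper_root as D x \<or> poly (coeff_poly as fs) x = 0) l u l' u'"
      by (intro matched_insert[OF m])
    then show ?thesis
      by (rule matched_mono) (use 4 in \<open>auto simp: same_signs_def proper_root_def\<close>)
  qed
qed

text \<open>Induction on length. Lists of equal length may enter in any order, because truncations,
  derivatives and remainders are strictly shorter than the list that gave rise to them.\<close>

lemma matched_closed:
  assumes C: "ops_closed 0 C" "finite C"
    and lead: "\<And>cs. cs \<in> C \<Longrightarrow> cs \<noteq> [] \<Longrightarrow> sgn (tm_val as (last cs)) = sgn (tm_val as' (last cs))"
    and ends: "same_signs as as' C l l'" "same_signs as as' C u u'" "l < u" "l' < u'"
  shows "matched (same_signs as as' C) (proper_root as C) l u l' u'"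
proof -
  let ?m = "\<lambda>D. matched (same_signs as as' D) (proper_root as D) l u l' u'"
  have step: "?m ({hs\<in>C. length hs < n} \<union> D)"
    if "?m {hs\<in>C. length hs < n}" "D \<subseteq> {hs\<in>C. length hs = n}" for n D
  proof -
    have "finite D" using that(2) C(2) by (rule_tac finite_subset[of _ C]) auto
    then show ?thesis using that(2)
    proof induction
      case empty
      then show ?case using that(1) by simp
    next
      case (insert fs D)
      then have fs: "fs \<in> C" "length fs = n" and D: "D \<subseteq> {hs\<in>C. length hs = n}" by auto
      have "?m (insert fs ({hs\<in>C. length hs < n} \<union> D))"
      proof (rule matched_insert_coeffs[OF C(1) _ ends(1,2) insert.IH[OF D]])
        show "sgn (tm_val as (last cs)) = sgn (tm_val as' (last cs))" if "cs \<in> C" "cs \<noteq> []" for cs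
          using lead that .
        show "{hs\<in>C. length hs < n} \<union> D \<subseteq> C" using D by blast
        show "length hs \<le> length fs" if "hs \<in> {hs\<in>C. length hs < n} \<union> D" for hs
          using that D fs(2) by auto
        show "hs \<in> {hs\<in>C. length hs < n} \<union> D" if "hs \<in> C" "length hs < length fs" for hs
          using that fs(2) by blast
      qed (rule fs(1))
      then show ?case by simp
    qed
  qed
  have all: "?m {hs\<in>C. length hs < n}" for n
  proof (induction n)
    case 0
    show ?case using ends(3,4) by (intro matched.gap) (auto simp: same_signs_def)
  next
    case (Suc n)
    have "{hs\<in>C. length hs < Suc n} = {hs\<in>C. length hs < n} \<union> {hs\<in>C. length hs = n}" by auto
    then show ?case using step[OF Suc subset_refl] by simp
  qed
  have "{hs\<in>C. length hs < Suc (Max (length ` C))} = C"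
    using C(2) by (auto simp: less_Suc_eq_le)
  then show ?thesis using all[of "Suc (Max (length ` C))"] by simp
qed

section \<open>Signs near plus and minus infinity\<close>

lemma eventually_sgn_poly_at_top:
  fixes p :: "real poly"
  shows "eventually (\<lambda>x. sgn (poly p x) = sgn (lead_coeff p)) at_top"
proof -
  have pos: "eventually (\<lambda>x. poly q x > 0) at_top" if q: "lead_coeff q > 0" for q :: "real poly"
  proof -
    obtain n where "\<forall>x\<ge>n. lead_coeff q \<le> poly q x" using poly_pinfty_gt_lc[OF q] by blast
    then show ?thesis using q unfolding eventually_at_top_linorder by (metis less_le_trans)
  qed
  consider "p = 0" | "lead_coeff p > 0" | "lead_coeff (- p) > 0"
    by (cases "lead_coeff p" "0 :: real" rule: linorder_cases) (auto simp: lead_coeff_minus)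
  then show ?thesis
  proof cases
    case 2
    then show ?thesis using pos[of p] by (auto elim!: eventually_mono)
  next
    case 3
    then show ?thesis using pos[of "-p"] by (auto elim!: eventually_mono simp: lead_coeff_minus)
  qed simp
qed

text \<open>Lists with vanishing last term are left out, since for them \<open>length cs - 1\<close>
  need not be the degree; for the others it is, and its parity gives the sign at
  \<open>- M\<close>.\<close>

definition sign_stable :: "real list \<Rightarrow> real tm list set \<Rightarrow> real \<Rightarrow> bool" where
  "sign_stable as C M \<longleftrightarrow> (\<forall>cs\<in>C. cs \<noteq> [] \<and> tm_val as (last cs) \<noteq> 0 \<longrightarrow>
     sgn (poly (coeff_poly as cs) M) = sgn (tm_val as (last cs)) \<and>
     sgn (poly (coeff_poly as cs) (- M)) = (-1) ^ (length cs - 1) * sgn (tm_val as (last cs)))"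

lemma eventually_sign_stable:
  assumes "finite C"
  shows "eventually (sign_stable as C) at_top"
  unfolding sign_stable_def
proof (rule eventually_ball_finite[OF assms], rule ballI)
  fix cs assume "cs \<in> C"
  show "eventually (\<lambda>M. cs \<noteq> [] \<and> tm_val as (last cs) \<noteq> 0 \<longrightarrow>
     sgn (poly (coeff_poly as cs) M) = sgn (tm_val as (last cs)) \<and>
     sgn (poly (coeff_poly as cs) (- M)) = (-1) ^ (length cs - 1) * sgn (tm_val as (last cs))) at_top"
  proof (cases "cs \<noteq> [] \<and> tm_val as (last cs) \<noteq> 0")
    case True
    define p q where "p = coeff_poly as cs" and "q = p \<circ>\<^sub>p [:0, -1:]"
    have p: "degree p = length cs - 1" "lead_coeff p = tm_val as (last cs)"
      using degree_coeff_poly True by (auto simp: p_def)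
    have "lead_coeff q = lead_coeff p * (-1) ^ (length cs - 1)"
      unfolding q_def by (subst lead_coeff_comp) (simp_all add: p)
    then have q: "sgn (lead_coeff q) = (-1) ^ (length cs - 1) * sgn (lead_coeff p)"
      by (simp add: sgn_mult)
    have "eventually (\<lambda>x. sgn (poly p x) = sgn (lead_coeff p) \<and> sgn (poly q x) = sgn (lead_coeff q)) at_top"
      by (intro eventually_conj eventually_sgn_poly_at_top)
    then show ?thesis
      unfolding q by (rule eventually_mono) (use True in \<open>simp add: q_def poly_pcompose p(2) flip: p_def\<close>)
  next
    case False
    then show ?thesis by auto
  qed
qed

text \<open>Vanishing last terms are dropped until a nonvanishing one appears; agreement of their
  signs makes this happen at the same place for both tuples.\<close>

lemma same_signs_from_leads:
  assumes C: "ops_closed 0 C"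
    and lead: "\<And>cs. cs \<in> C \<Longrightarrow> cs \<noteq> [] \<Longrightarrow> sgn (tm_val as (last cs)) = sgn (tm_val as' (last cs))"
    and nz: "\<And>cs. cs \<in> C \<Longrightarrow> cs \<noteq> [] \<Longrightarrow> tm_val as (last cs) \<noteq> 0 \<Longrightarrow>
       sgn (poly (coeff_poly as cs) x) = sgn (poly (coeff_poly as' cs) y)"
  shows "same_signs as as' C x y"
proof -
  have "cs \<in> C \<longrightarrow> sgn (poly (coeff_poly as cs) x) = sgn (poly (coeff_poly as' cs) y)" for cs
  proof (induction "length cs" arbitrary: cs rule: less_induct)
    case less
    show ?case
    proof (cases "cs \<in> C \<and> cs \<noteq> [] \<and> tm_val as (last cs) = 0")
      case True
      then have z: "tm_val as' (last cs) = 0" using lead[of cs] by (simp add: sgn_zero_iff)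
      have "butlast cs \<in> C" using C True by (simp add: ops_closed_def)
      moreover have "length (butlast cs) < length cs" using True by (cases cs) auto
      ultimately have "sgn (poly (coeff_poly as (butlast cs)) x) = sgn (poly (coeff_poly as' (butlast cs)) y)"
        using less by blast
      then show ?thesis using True z by (simp add: coeff_poly_butlast)
    next
      case False
      then show ?thesis using nz[of cs] by (cases "cs = []") auto
    qed
  qed
  then show ?thesis by (simp add: same_signs_def)
qed

text \<open>The test terms are the last terms of a closed family. Their signs determine all signs
  far out on both sides, and the certificate compares everything in between.\<close>

lemma sign_partner:
  fixes L :: "real tm list set"
  assumes "finite L"
  shows "\<exists>T. finite T \<and> (\<forall>as as' x. (\<forall>t\<in>T. sgn (tm_val as t) = sgn (tm_val as' t)) \<longrightarrow>
    (\<exists>y. same_signs as as' L x y))"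
proof -
  obtain C where C: "finite C" "L \<subseteq> C" "ops_closed 0 C" using closure_exists[OF assms] by blast
  show ?thesis
  proof (intro exI[of _ "last ` C"] conjI allI impI)
    show "finite (last ` C)" using C by simp
    fix as as' :: "real list" and x :: real
    assume "\<forall>t\<in>last ` C. sgn (tm_val as t) = sgn (tm_val as' t)"
    then have lead: "\<And>cs. cs \<in> C \<Longrightarrow> sgn (tm_val as (last cs)) = sgn (tm_val as' (last cs))" by blast
    have lead0: "tm_val as' (last cs) \<noteq> 0" if "cs \<in> C" "tm_val as (last cs) \<noteq> 0" for cs
      using lead[OF that(1)] that(2) by (metis sgn_zero_iff)
    have "\<exists>M > m. sign_stable bs C M" for m and bs :: "real list"
      using eventually_conj[OF eventually_gt_at_top[of m] eventually_sign_stable[OF C(1), of bs]]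
      by (rule eventually_happens'[OF trivial_limit_at_top_linorder])
    \<comment> \<open>\<open>M\<close> has to exceed the absolute value of \<open>x\<close>, so that
      \<open>x\<close> lies in the compared interval; on the other side any positive stable
      \<open>M'\<close> will do.\<close>
    then obtain M M' where M: "M > \<bar>x\<bar>" "sign_stable as C M" "M' > 0" "sign_stable as' C M'"
      by meson
    have "same_signs as as' C M M'"
    proof (rule same_signs_from_leads[OF C(3) lead])
      fix cs assume "cs \<in> C" "cs \<noteq> []" "tm_val as (last cs) \<noteq> 0"
      then show "sgn (poly (coeff_poly as cs) M) = sgn (poly (coeff_poly as' cs) M')"
        using M(2,4) lead0[of cs] lead[of cs] by (simp add: sign_stable_def)
    qed
    moreover have "same_signs as as' C (- M) (- M')"
    proof (rule same_signs_from_leads[OF C(3) lead])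
      fix cs assume "cs \<in> C" "cs \<noteq> []" "tm_val as (last cs) \<noteq> 0"
      then show "sgn (poly (coeff_poly as cs) (- M)) = sgn (poly (coeff_poly as' cs) (- M'))"
        using M(2,4) lead0[of cs] lead[of cs] by (simp add: sign_stable_def)
    qed
    ultimately have "matched (same_signs as as' C) (proper_root as C) (- M) M (- M') M'"
      using M(1,3) by (intro matched_closed[OF C(3,1) lead]) simp_all
    from matched_partner[OF this, of x] obtain y where "same_signs as as' C x y"
      using M(1) by (auto simp: abs_less_iff)
    then show "\<exists>y. same_signs as as' L x y"
      using C(2) by (auto simp: same_signs_def)
  qed
qed

text \<open>Elimination is phrased as dependence on the signs of finitely many terms. Connectives
  then merely unite test sets, and the quantifier case is \<open>sign_partner\<close> applied to the
  coefficients of the test terms in the bound variable.\<close>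

theorem quantifier_elimination:
  fixes \<phi> :: "real fm"
  shows "\<exists>T. finite T \<and> (\<forall>as as'. (\<forall>t\<in>T. sgn (tm_val as t) = sgn (tm_val as' t)) \<longrightarrow> sat \<phi> as = sat \<phi> as')"
proof (induction \<phi>)
  case (Eq s t)
  show ?case
    by (intro exI[of _ "{Plus s (Times (Param (-1)) t)}"]) (auto simp: sgn_if split: if_splits)
next
  case (Neg \<phi>)
  then show ?case by simp
next
  case (Conj \<phi> \<psi>)
  obtain T where T: "finite T"
    "\<And>as as'. \<forall>t\<in>T. sgn (tm_val as t) = sgn (tm_val as' t) \<Longrightarrow> sat \<phi> as = sat \<phi> as'"
    using Conj.IH(1) by blast
  obtain T' where T': "finite T'"
    "\<And>as as'. \<forall>t\<in>T'. sgn (tm_val as t) = sgn (tm_val as' t) \<Longrightarrow> sat \<psi> as = sat \<psi> as'"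
    using Conj.IH(2) by blast
  show ?case
  proof (intro exI[of _ "T \<union> T'"] conjI allI impI)
    fix as as' assume "\<forall>t\<in>T \<union> T'. sgn (tm_val as t) = sgn (tm_val as' t)"
    then show "sat (Conj \<phi> \<psi>) as = sat (Conj \<phi> \<psi>) as'"
      using T(2)[of as as'] T'(2)[of as as'] by simp
  qed (use T(1) T'(1) in simp)
next
  case (Exi \<phi>)
  from Exi.IH obtain T where T: "finite T"
    "\<And>as as'. (\<forall>t\<in>T. sgn (tm_val as t) = sgn (tm_val as' t)) \<Longrightarrow> sat \<phi> as = sat \<phi> as'" by blast
  obtain T' where T': "finite T'" "\<And>as as' x. (\<forall>t\<in>T'. sgn (tm_val as t) = sgn (tm_val as' t)) \<Longrightarrow>
    \<exists>y. same_signs as as' (tm_coeffs ` T) x y"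
    using sign_partner[of "tm_coeffs ` T"] T(1) by blast
  have dir: "sat (Exi \<phi>) as'" if s: "\<forall>t\<in>T'. sgn (tm_val as t) = sgn (tm_val as' t)" "sat (Exi \<phi>) as" for as as'
  proof -
    obtain x where "sat \<phi> (x # as)" using \<open>sat (Exi \<phi>) as\<close> by auto
    moreover obtain y where "same_signs as as' (tm_coeffs ` T) x y" using T'(2)[OF s(1)] by blast
    ultimately have "sat \<phi> (y # as')"
      using T(2)[of "x # as" "y # as'"] by (simp add: tm_val_Cons same_signs_def)
    then show ?thesis by auto
  qed
  show ?case
  proof (intro exI[of _ T'] conjI allI impI)
    fix as as' :: "real list" assume *: "\<forall>t\<in>T'. sgn (tm_val as t) = sgn (tm_val as' t)"
    show "sat (Exi \<phi>) as = sat (Exi \<phi>) as'"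
      using dir[OF *] dir[of as' as] * by metis
  qed (rule T')
qed

text \<open>The boundary consists of the roots of those test polynomials that do not vanish
  identically; away from them all signs are constant by the intermediate value theorem. The lengths
  of the coefficient lists bound the count for every tuple at once.\<close>

lemma uniform_boundary:
  fixes \<phi> :: "real fm"
  shows "\<exists>N. \<forall>as. \<exists>Z. finite Z \<and> card Z \<le> N \<and>
    (\<forall>u v. u < v \<and> Z \<inter> {u..v} = {} \<longrightarrow> sat \<phi> (u # as) = sat \<phi> (v # as))"
proof -
  obtain T where T: "finite T"
    "\<And>as as'. (\<forall>t\<in>T. sgn (tm_val as t) = sgn (tm_val as' t)) \<Longrightarrow> sat \<phi> as = sat \<phi> as'"
    using quantifier_elimination by blast
  show ?thesis
  proof (intro exI[of _ "\<Sum>t\<in>T. length (tm_coeffs t)"] allI)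
    fix as
    define T' where "T' = {t\<in>T. coeff_poly as (tm_coeffs t) \<noteq> 0}"
    define Z where "Z = (\<Union>t\<in>T'. {x. poly (coeff_poly as (tm_coeffs t)) x = 0})"
    have "finite T'" using T(1) by (simp add: T'_def)
    then have fin: "finite Z" unfolding Z_def by (auto simp: T'_def poly_roots_finite)
    have "card Z \<le> (\<Sum>t\<in>T'. card {x. poly (coeff_poly as (tm_coeffs t)) x = 0})"
      unfolding Z_def by (rule card_UN_le[OF \<open>finite T'\<close>])
    also have "\<dots> \<le> (\<Sum>t\<in>T'. length (tm_coeffs t))"
    proof (rule sum_mono)
      fix t assume "t \<in> T'"
      then have "card {x. poly (coeff_poly as (tm_coeffs t)) x = 0} \<le> degree (coeff_poly as (tm_coeffs t))"
        by (intro card_poly_roots_bound) (simp add: T'_def)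
      also have "\<dots> \<le> length (tm_coeffs t)" by (rule degree_le) (simp add: coeff_coeff_poly)
      finally show "card {x. poly (coeff_poly as (tm_coeffs t)) x = 0} \<le> length (tm_coeffs t)" .
    qed
    also have "\<dots> \<le> (\<Sum>t\<in>T. length (tm_coeffs t))"
      by (rule sum_mono2) (use T(1) in \<open>auto simp: T'_def\<close>)
    finally have card: "card Z \<le> (\<Sum>t\<in>T. length (tm_coeffs t))" .
    have "sat \<phi> (u # as) = sat \<phi> (v # as)" if uv: "u < v" "Z \<inter> {u..v} = {}" for u v
    proof (rule T(2), rule ballI)
      fix t assume t: "t \<in> T"
      define p where "p = coeff_poly as (tm_coeffs t)"
      show "sgn (tm_val (u # as) t) = sgn (tm_val (v # as) t)"
      proof (cases "p = 0")
        case False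
        then have nz: "poly p x \<noteq> 0" if "u \<le> x" "x \<le> v" for x
          using t uv that by (force simp: Z_def T'_def p_def)
        have "\<not> poly p u * poly p v < 0"
          using poly_IVT[OF uv(1), of p] nz by (meson less_imp_le)
        then show ?thesis using nz[of u] nz[of v] uv(1)
          by (auto simp: tm_val_Cons p_def[symmetric] sgn_if mult_less_0_iff)
      qed (simp add: tm_val_Cons p_def)
    qed
    then show "\<exists>Z. finite Z \<and> card Z \<le> (\<Sum>t\<in>T. length (tm_coeffs t)) \<and>
      (\<forall>u v. u < v \<and> Z \<inter> {u..v} = {} \<longrightarrow> sat \<phi> (u # as) = sat \<phi> (v # as))"
      using fin card by blast
  qed
qed

section \<open>Substitution and transfer\<close>

primrec lift_tm :: "'c tm \<Rightarrow> 'c tm" where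
  "lift_tm (Var i) = Var (Suc i)"
| "lift_tm (Param c) = Param c"
| "lift_tm Zero = Zero"
| "lift_tm One = One"
| "lift_tm (Plus s t) = Plus (lift_tm s) (lift_tm t)"
| "lift_tm (Times s t) = Times (lift_tm s) (lift_tm t)"

text \<open>The default \<open>Zero\<close> for indices beyond the list makes the variable bound of
  the result hold for every term.\<close>

primrec subst_tm :: "'c tm list \<Rightarrow> 'c tm \<Rightarrow> 'c tm" where
  "subst_tm ts (Var i) = (if i < length ts then ts ! i else Zero)"
| "subst_tm ts (Param c) = Param c"
| "subst_tm ts Zero = Zero"
| "subst_tm ts One = One"
| "subst_tm ts (Plus s t) = Plus (subst_tm ts s) (subst_tm ts t)"
| "subst_tm ts (Times s t) = Times (subst_tm ts s) (subst_tm ts t)"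

primrec subst_fm :: "'c fm \<Rightarrow> 'c tm list \<Rightarrow> 'c fm" where
  "subst_fm (Eq s t) ts = Eq (subst_tm ts s) (subst_tm ts t)"
| "subst_fm (Neg \<phi>) ts = Neg (subst_fm \<phi> ts)"
| "subst_fm (Conj \<phi> \<psi>) ts = Conj (subst_fm \<phi> ts) (subst_fm \<psi> ts)"
| "subst_fm (Exi \<phi>) ts = Exi (subst_fm \<phi> (Var 0 # map lift_tm ts))"

lemma tm_val_lift [simp]: "tm_val (x # as) (lift_tm t) = tm_val as t"
  by (induction t) simp_all

lemma tm_below_lift [simp]: "tm_below (Suc n) (lift_tm t) = tm_below n t"
  by (induction t) simp_all

lemma map_tm_lift [simp]: "map_tm f (lift_tm t) = lift_tm (map_tm f t)"
  by (induction t) simp_all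

lemma tm_params_lift [simp]: "tm_params (lift_tm t) = tm_params t"
  by (induction t) simp_all

lemma tm_val_subst:
  "tm_below (length ts) t \<Longrightarrow> tm_val as (subst_tm ts t) = tm_val (map (tm_val as) ts) t"
  by (induction t) simp_all

lemma sat_subst [simp]:
  "fm_below \<phi> (length ts) \<Longrightarrow> sat (subst_fm \<phi> ts) as = sat \<phi> (map (tm_val as) ts)"
proof (induction \<phi> arbitrary: ts as)
  case (Exi \<phi>)
  then show ?case using Exi.IH[of "Var 0 # map lift_tm ts"] by (simp add: comp_def)
qed (simp_all add: tm_val_subst)

lemma fm_below_numeral [simp]:
  "fm_below \<phi> (Suc (Suc 0)) = fm_below \<phi> 2"
  "fm_below \<phi> (Suc (Suc (Suc 0))) = fm_below \<phi> 3"
  "fm_below \<phi> (Suc (Suc (Suc (Suc 0)))) = fm_below \<phi> 4"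
  by (simp_all add: eval_nat_numeral)

lemma tm_below_subst: "list_all (tm_below n) ts \<Longrightarrow> tm_below n (subst_tm ts t)"
  by (induction t) (simp_all add: list_all_length)

lemma fm_below_subst [simp]: "list_all (tm_below n) ts \<Longrightarrow> fm_below (subst_fm \<phi> ts) n"
proof (induction \<phi> arbitrary: ts n)
  case (Exi \<phi>)
  then have "list_all (tm_below (Suc n)) (Var 0 # map lift_tm ts)" by (simp add: list_all_iff)
  then show ?case using Exi.IH by simp
qed (simp_all add: tm_below_subst)

lemma map_tm_subst: "map_tm f (subst_tm ts t) = subst_tm (map (map_tm f) ts) (map_tm f t)"
  by (induction t) simp_all

lemma map_fm_subst [simp]: "map_fm f (subst_fm \<phi> ts) = subst_fm (map_fm f \<phi>) (map (map_tm f) ts)"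
proof (induction \<phi> arbitrary: ts)
  case (Exi \<phi>)
  then show ?case by (simp add: comp_def)
qed (simp_all add: map_tm_subst)

lemma tm_params_subst: "tm_params (subst_tm ts t) \<subseteq> tm_params t \<union> \<Union> (tm_params ` set ts)"
  by (induction t) (auto, metis nth_mem)

lemma fm_params_subst: "fm_params (subst_fm \<phi> ts) \<subseteq> fm_params \<phi> \<union> \<Union> (tm_params ` set ts)"
proof (induction \<phi> arbitrary: ts)
  case (Eq s t)
  then show ?case using tm_params_subst[of ts s] tm_params_subst[of ts t] by auto
next
  case (Exi \<phi>)
  have "fm_params (subst_fm \<phi> (Var 0 # map lift_tm ts)) \<subseteq>
    fm_params \<phi> \<union> \<Union> (tm_params ` set (Var 0 # map lift_tm ts))" by (rule Exi.IH)
  also have "\<Union> (tm_params ` set (Var 0 # map lift_tm ts)) = \<Union> (tm_params ` set ts)"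
    by (simp add: image_image)
  finally show ?case by simp
qed auto

lemma tm_below_map [simp]: "tm_below n (map_tm f t) = tm_below n t"
  by (induction t) simp_all

lemma fm_below_map [simp]: "fm_below (map_fm f \<phi>) n = fm_below \<phi> n"
  by (induction \<phi> arbitrary: n) simp_all

section \<open>Order and derived connectives\<close>

text \<open>The language has no order, so \<open>s \<le> t\<close> is expressed by
  \<open>t - s\<close> being a square. This has the intended meaning where every nonnegative element
  is a square, as in the reals and in a real closed field.\<close>

definition Leq :: "'c tm \<Rightarrow> 'c tm \<Rightarrow> 'c fm" where
  "Leq s t = Exi (Eq (Plus (lift_tm s) (Times (Var 0) (Var 0))) (lift_tm t))"

definition Less :: "'c tm \<Rightarrow> 'c tm \<Rightarrow> 'c fm" where
  "Less s t = Neg (Leq t s)"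

definition Disj :: "'c fm \<Rightarrow> 'c fm \<Rightarrow> 'c fm" where
  "Disj \<phi> \<psi> = Neg (Conj (Neg \<phi>) (Neg \<psi>))"

definition Imp :: "'c fm \<Rightarrow> 'c fm \<Rightarrow> 'c fm" where
  "Imp \<phi> \<psi> = Neg (Conj \<phi> (Neg \<psi>))"

definition Forall :: "'c fm \<Rightarrow> 'c fm" where
  "Forall \<phi> = Neg (Exi (Neg \<phi>))"

primrec Exis :: "nat \<Rightarrow> 'c fm \<Rightarrow> 'c fm" where
  "Exis 0 \<phi> = \<phi>"
| "Exis (Suc n) \<phi> = Exis n (Exi \<phi>)"

definition Conjs :: "'c fm list \<Rightarrow> 'c fm" where
  "Conjs \<phi>s = foldr Conj \<phi>s (Eq Zero Zero)"

lemma sat_connectives [simp]: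
  "sat (Disj \<phi> \<psi>) as \<longleftrightarrow> sat \<phi> as \<or> sat \<psi> as"
  "sat (Imp \<phi> \<psi>) as \<longleftrightarrow> (sat \<phi> as \<longrightarrow> sat \<psi> as)"
  "sat (Forall \<phi>) as \<longleftrightarrow> (\<forall>x. sat \<phi> (x # as))"
  "sat (Less s t) as \<longleftrightarrow> \<not> sat (Leq t s) as"
  by (auto simp: Disj_def Imp_def Forall_def Less_def)

lemma fm_below_connectives [simp]:
  "fm_below (Disj \<phi> \<psi>) n \<longleftrightarrow> fm_below \<phi> n \<and> fm_below \<psi> n"
  "fm_below (Imp \<phi> \<psi>) n \<longleftrightarrow> fm_below \<phi> n \<and> fm_below \<psi> n"
  "fm_below (Forall \<phi>) n \<longleftrightarrow> fm_below \<phi> (Suc n)"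
  "fm_below (Leq s t) n \<longleftrightarrow> tm_below n s \<and> tm_below n t"
  "fm_below (Less s t) n \<longleftrightarrow> tm_below n s \<and> tm_below n t"
  by (auto simp: Disj_def Imp_def Forall_def Less_def Leq_def)

lemma map_fm_connectives [simp]:
  "map_fm f (Disj \<phi> \<psi>) = Disj (map_fm f \<phi>) (map_fm f \<psi>)"
  "map_fm f (Imp \<phi> \<psi>) = Imp (map_fm f \<phi>) (map_fm f \<psi>)"
  "map_fm f (Forall \<phi>) = Forall (map_fm f \<phi>)"
  "map_fm f (Leq s t) = Leq (map_tm f s) (map_tm f t)"
  "map_fm f (Less s t) = Less (map_tm f s) (map_tm f t)"
  by (simp_all add: Disj_def Imp_def Forall_def Less_def Leq_def)

lemma fm_params_connectives [simp]:
  "fm_params (Disj \<phi> \<psi>) = fm_params \<phi> \<union> fm_params \<psi>"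
  "fm_params (Imp \<phi> \<psi>) = fm_params \<phi> \<union> fm_params \<psi>"
  "fm_params (Forall \<phi>) = fm_params \<phi>"
  "fm_params (Leq s t) = tm_params s \<union> tm_params t"
  "fm_params (Less s t) = tm_params s \<union> tm_params t"
  by (auto simp: Disj_def Imp_def Forall_def Less_def Leq_def)

lemma sat_Exis [simp]: "sat (Exis n \<phi>) as \<longleftrightarrow> (\<exists>zs. length zs = n \<and> sat \<phi> (zs @ as))"
proof (induction n arbitrary: \<phi>)
  case (Suc n)
  have "sat (Exis (Suc n) \<phi>) as \<longleftrightarrow> (\<exists>zs x. length zs = n \<and> sat \<phi> ((x # zs) @ as))"
    using Suc by auto
  also have "\<dots> \<longleftrightarrow> (\<exists>zs. length zs = Suc n \<and> sat \<phi> (zs @ as))"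
    by (metis length_Suc_conv)
  finally show ?case .
qed simp

lemma fm_below_Exis [simp]: "fm_below (Exis m \<phi>) n = fm_below \<phi> (m + n)"
  by (induction m arbitrary: \<phi>) simp_all

lemma map_fm_Exis [simp]: "map_fm f (Exis m \<phi>) = Exis m (map_fm f \<phi>)"
  by (induction m arbitrary: \<phi>) simp_all

lemma Conjs [simp]:
  "sat (Conjs \<phi>s) as \<longleftrightarrow> (\<forall>\<phi>\<in>set \<phi>s. sat \<phi> as)"
  "fm_below (Conjs \<phi>s) n \<longleftrightarrow> (\<forall>\<phi>\<in>set \<phi>s. fm_below \<phi> n)"
  "map_fm f (Conjs \<phi>s) = Conjs (map (map_fm f) \<phi>s)"
  "fm_params (Conjs \<phi>s) = \<Union> (fm_params ` set \<phi>s)"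
  by (induction \<phi>s) (simp_all add: Conjs_def)

lemma sat_Leq_real [simp]: "sat (Leq s t) as \<longleftrightarrow> tm_val as s \<le> tm_val as (t :: real tm)"
proof
  assume "tm_val as s \<le> tm_val as t"
  then have "tm_val as s + sqrt (tm_val as t - tm_val as s) * sqrt (tm_val as t - tm_val as s) = tm_val as t"
    by simp
  then show "sat (Leq s t) as" unfolding Leq_def by (simp del: real_sqrt_mult_self) blast
next
  assume "sat (Leq s t) as"
  then obtain z where "tm_val as s + z * z = tm_val as t" by (auto simp: Leq_def)
  then show "tm_val as s \<le> tm_val as t" by (metis le_add_same_cancel1 zero_le_square)
qed

section \<open>Elementary extensions of the reals\<close>

locale real_extension =
  fixes \<iota> :: "real \<Rightarrow> 'k::linordered_field"
  assumes real_closed: "real_closed TYPE('k)"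
    and elementary: "elementary_embedding \<iota>"
begin

abbreviation R :: "'k set" where
  "R \<equiv> range \<iota>"

lemma transfer: "fm_below \<phi> (length as) \<Longrightarrow> sat (map_fm \<iota> \<phi>) (map \<iota> as) = sat \<phi> as"
  using elementary by (simp add: elementary_embedding_def)

lemma transfer_sentence: "fm_below \<phi> 0 \<Longrightarrow> sat \<phi> [] \<Longrightarrow> sat (map_fm \<iota> \<phi>) []"
  using transfer[of \<phi> "[]"] by simp

lemma sat_Leq [simp]: "sat (Leq s t) as \<longleftrightarrow> tm_val as s \<le> tm_val as (t :: 'k tm)"
proof
  assume "tm_val as s \<le> tm_val as t"
  then obtain z where "z\<^sup>2 = tm_val as t - tm_val as s"
    using real_closed unfolding real_closed_def by (metis diff_ge_0_iff_ge)
  then have "tm_val as s + z * z = tm_val as t" by (simp add: power2_eq_square)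
  then show "sat (Leq s t) as" unfolding Leq_def by auto
next
  assume "sat (Leq s t) as"
  then obtain z where "tm_val as s + z * z = tm_val as t" by (auto simp: Leq_def)
  then show "tm_val as s \<le> tm_val as t" by (metis le_add_same_cancel1 zero_le_square)
qed

lemma \<iota>_add [simp]: "\<iota> (a + b) = \<iota> a + \<iota> b"
  using transfer[of "Eq (Var 0) (Plus (Var 1) (Var 2))" "[a + b, a, b]"] by simp

lemma \<iota>_mult [simp]: "\<iota> (a * b) = \<iota> a * \<iota> b"
  using transfer[of "Eq (Var 0) (Times (Var 1) (Var 2))" "[a * b, a, b]"] by simp

lemma \<iota>_0 [simp]: "\<iota> 0 = 0"
  using transfer[of "Eq (Var 0) Zero" "[0]"] by simp

lemma \<iota>_1 [simp]: "\<iota> 1 = 1"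
  using transfer[of "Eq (Var 0) One" "[1]"] by simp

lemma \<iota>_le [simp]: "\<iota> a \<le> \<iota> b \<longleftrightarrow> a \<le> b"
  using transfer[of "Leq (Var 0) (Var 1)" "[a, b]"] by simp

lemma \<iota>_less [simp]: "\<iota> a < \<iota> b \<longleftrightarrow> a < b"
  by (simp add: not_le[symmetric] del: not_le)

lemma \<iota>_eq [simp]: "\<iota> a = \<iota> b \<longleftrightarrow> a = b"
  by (simp add: order_eq_iff)

lemma inj_\<iota>: "inj \<iota>"
  by (simp add: inj_def)

lemma \<iota>_minus [simp]: "\<iota> (- a) = - \<iota> a"
  using \<iota>_add[of a "- a"] by (simp add: eq_neg_iff_add_eq_0 add.commute del: \<iota>_add)

lemma \<iota>_diff [simp]: "\<iota> (a - b) = \<iota> a - \<iota> b"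
  using \<iota>_add[of a "- b"] by simp

lemma \<iota>_0_iff [simp]: "\<iota> a = 0 \<longleftrightarrow> a = 0" "0 < \<iota> a \<longleftrightarrow> 0 < a" "0 \<le> \<iota> a \<longleftrightarrow> 0 \<le> a"
    "\<iota> a < 0 \<longleftrightarrow> a < 0" "\<iota> a \<le> 0 \<longleftrightarrow> a \<le> 0"
  using \<iota>_eq[of a 0] \<iota>_less[of 0 a] \<iota>_le[of 0 a] \<iota>_less[of a 0] \<iota>_le[of a 0] by simp_all

lemma \<iota>_inverse [simp]: "\<iota> (inverse a) = inverse (\<iota> a)"
proof (cases "a = 0")
  case False
  then have "\<iota> a * \<iota> (inverse a) = 1" by (simp flip: \<iota>_mult)
  then show ?thesis by (metis inverse_unique)
qed simp

lemma \<iota>_divide [simp]: "\<iota> (a / b) = \<iota> a / \<iota> b"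
  by (simp add: divide_inverse)

text \<open>Types over \<open>R\<close> can thus be described by formulas with real parameters, to
  which elimination and transfer apply.\<close>

lemma formulas_range:
  "formulas R n = map_fm \<iota> ` {\<phi>. fm_below \<phi> n}"
proof safe
  fix \<phi> assume \<phi>: "\<phi> \<in> formulas R n"
  have "map_fm \<iota> (map_fm (inv_into UNIV \<iota>) \<phi>) = map_fm id \<phi>"
    unfolding fm.map_comp
    by (rule fm.map_cong) (use \<phi> in \<open>auto simp: formulas_def f_inv_into_f\<close>)
  then have "\<phi> = map_fm \<iota> (map_fm (inv_into UNIV \<iota>) \<phi>)" by (simp add: fm.map_id)
  then show "\<phi> \<in> map_fm \<iota> ` {\<phi>. fm_below \<phi> n}"
    using \<phi> by (intro image_eqI[of _ _ "map_fm (inv_into UNIV \<iota>) \<phi>"]) (auto simp: formulas_def)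
qed (auto simp: formulas_def fm.set_map)

end

section \<open>Realizing types\<close>

text \<open>With \<open>X\<close> the set of all tuples this is consistency, with \<open>X\<close>
  the real tuples it is finite satisfiability. One extension argument then serves types and
  coheirs.\<close>

definition finitely_realized :: "'k::comm_ring_1 list set \<Rightarrow> 'k fm set \<Rightarrow> bool" where
  "finitely_realized X p \<longleftrightarrow> (\<forall>F. finite F \<and> F \<subseteq> p \<longrightarrow> (\<exists>as\<in>X. \<forall>\<phi>\<in>F. sat \<phi> as))"

lemma finitely_realized_insert:
  assumes "finitely_realized X p"
  shows "finitely_realized X (insert \<phi> p) \<or> finitely_realized X (insert (Neg \<phi>) p)"
proof (rule ccontr)
  assume "\<not> ?thesis"
  moreover have "\<exists>F. finite F \<and> F \<subseteq> q \<and> (\<forall>as\<in>X. \<exists>\<psi>\<in>F. \<not> sat \<psi> as)" if "\<not> finitely_realized X q" for q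
    using that by (simp add: finitely_realized_def)
  ultimately obtain F F' where F: "finite F" "F \<subseteq> insert \<phi> p" "\<forall>as\<in>X. \<exists>\<psi>\<in>F. \<not> sat \<psi> as"
    and F': "finite F'" "F' \<subseteq> insert (Neg \<phi>) p" "\<forall>as\<in>X. \<exists>\<psi>\<in>F'. \<not> sat \<psi> as"
    by meson
  have "finite (F - {\<phi>} \<union> (F' - {Neg \<phi>}))" "F - {\<phi>} \<union> (F' - {Neg \<phi>}) \<subseteq> p"
    using F(1,2) F'(1,2) by auto
  with assms[unfolded finitely_realized_def, rule_format]
  obtain as where as: "as \<in> X" "\<forall>\<psi>\<in>F - {\<phi>} \<union> (F' - {Neg \<phi>}). sat \<psi> as"
    by meson
  show False
  proof (cases "sat \<phi> as")
    case True
    obtain \<psi> where "\<psi> \<in> F" "\<not> sat \<psi> as" using F(3) as(1) by meson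
    then show False using as(2) True by auto
  next
    case False
    obtain \<psi> where "\<psi> \<in> F'" "\<not> sat \<psi> as" using F'(3) as(1) by meson
    then show False using as(2) False by auto
  qed
qed

text \<open>A maximal finitely realized extension of \<Sigma> is complete by the preceding lemma,
  and saturation realizes it. The last conclusion keeps the complete type satisfiable in
  \<open>X\<close>; this is the source of coheirs.\<close>

lemma realize_in:
  fixes \<Sigma> :: "'k::comm_ring_1 fm set" and \<kappa> :: "'c rel"
  assumes sat: "saturated \<kappa> TYPE('k)" "|A| <o \<kappa>"
    and X: "X \<subseteq> {as. length as = n}" and \<Sigma>: "\<Sigma> \<subseteq> formulas A n" "finitely_realized X \<Sigma>"
  obtains as where "length as = n" "\<And>\<phi>. \<phi> \<in> \<Sigma> \<Longrightarrow> sat \<phi> as"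
    "\<And>\<phi>. \<phi> \<in> formulas A n \<Longrightarrow> sat \<phi> as \<Longrightarrow> \<exists>xs\<in>X. sat \<phi> xs"
proof -
  define S where "S = {p. \<Sigma> \<subseteq> p \<and> p \<subseteq> formulas A n \<and> finitely_realized X p}"
  have "\<exists>M\<in>S. \<forall>p\<in>S. M \<subseteq> p \<longrightarrow> p = M"
  proof (rule subset_Zorn_nonempty)
    show "S \<noteq> {}" using \<Sigma> by (auto simp: S_def)
    fix C assume C: "C \<noteq> {}" "subset.chain S C"
    have "finitely_realized X (\<Union> C)"
      unfolding finitely_realized_def
    proof (intro allI impI, elim conjE)
      fix F assume F: "finite F" "F \<subseteq> \<Union> C"
      obtain p where "p \<in> C" "F \<subseteq> p"
        by (rule finite_subset_Union_chain[OF F C(1)]) (use C(2) in \<open>auto simp: subset_chain_def subset.chain_def\<close>)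
      then show "\<exists>as\<in>X. \<forall>\<phi>\<in>F. sat \<phi> as"
        using C(2) F(1) by (auto simp: subset_chain_def S_def finitely_realized_def)
    qed
    moreover have "\<Sigma> \<subseteq> q" "q \<subseteq> formulas A n" if "q \<in> C" for q
      using C(2) that by (auto simp: subset_chain_def S_def)
    ultimately show "\<Union> C \<in> S" using C(1) unfolding S_def by blast
  qed
  then obtain p where p: "p \<in> S" "\<And>q. q \<in> S \<Longrightarrow> p \<subseteq> q \<Longrightarrow> q = p" by blast
  have fr: "finitely_realized X p" and sub: "p \<subseteq> formulas A n" "\<Sigma> \<subseteq> p" using p(1) by (auto simp: S_def)
  have compl: "\<phi> \<in> p \<or> Neg \<phi> \<in> p" if "\<phi> \<in> formulas A n" for \<phi>
  proof -
    have "Neg \<phi> \<in> formulas A n" using that by (simp add: formulas_def)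
    then have "insert \<phi> p \<in> S \<or> insert (Neg \<phi>) p \<in> S"
      using finitely_realized_insert[OF fr, of \<phi>] that sub by (auto simp: S_def)
    then show ?thesis using p(2) by blast
  qed
  have "complete_type A n p"
    unfolding complete_type_def
  proof (intro conjI allI impI ballI)
    fix F assume "finite F \<and> F \<subseteq> p"
    then obtain as where "as \<in> X" "\<forall>\<phi>\<in>F. sat \<phi> as"
      using fr unfolding finitely_realized_def by blast
    then show "\<exists>as. length as = n \<and> (\<forall>\<phi>\<in>F. sat \<phi> as)" using X by blast
  qed (use sub compl in auto)
  then obtain as where as: "length as = n" "tp A as = p"
    using sat unfolding saturated_def by blast
  show ?thesis
  proof (rule that[OF as(1)])
    show "sat \<phi> as" if "\<phi> \<in> \<Sigma>" for \<phi>
      using that sub as(2) by (auto simp: tp_def)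
    show "\<exists>xs\<in>X. sat \<phi> xs" if "\<phi> \<in> formulas A n" "sat \<phi> as" for \<phi>
    proof -
      have "{\<phi>} \<subseteq> p" using that as by (auto simp: tp_def)
      then have "\<exists>as\<in>X. \<forall>\<psi>\<in>{\<phi>}. sat \<psi> as"
        using fr unfolding finitely_realized_def by blast
      then show ?thesis by simp
    qed
  qed
qed

lemma complete_type_tp: "complete_type A (length as) (tp A as)"
  unfolding complete_type_def
proof (intro conjI allI impI ballI)
  show "\<exists>xs. length xs = length as \<and> (\<forall>\<phi>\<in>F. sat \<phi> xs)" if "finite F \<and> F \<subseteq> tp A as" for F
    using that by (intro exI[of _ as]) (auto simp: tp_def)
  show "\<phi> \<in> tp A as \<or> Neg \<phi> \<in> tp A as" if "\<phi> \<in> formulas A (length as)" for \<phi>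
    using that by (auto simp: tp_def formulas_def)
qed (auto simp: tp_def)

section \<open>Iterated limits over the reals\<close>

text \<open>The real shadow of an infinite \<open>b\<close> and a \<open>c\<close> infinite over
  \<open>b\<close>: the bound for \<open>c\<close> may depend on \<open>b\<close>.\<close>

definition ev2 :: "(real \<Rightarrow> real \<Rightarrow> bool) \<Rightarrow> bool" where
  "ev2 P \<longleftrightarrow> (\<forall>\<^sub>F b in at_top. \<forall>\<^sub>F c in at_top. P b c)"

lemma ev2_mono: "ev2 P \<Longrightarrow> (\<And>b c. P b c \<Longrightarrow> Q b c) \<Longrightarrow> ev2 Q"
  unfolding ev2_def by (auto elim!: eventually_mono)

lemma ev2_conj: "ev2 (\<lambda>b c. P b c \<and> Q b c) \<longleftrightarrow> ev2 P \<and> ev2 Q"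
  unfolding ev2_def by (simp add: eventually_conj_iff)

lemma not_ev2_False: "\<not> ev2 (\<lambda>b c. False)"
  unfolding ev2_def by simp

lemma ev2_gt: "ev2 (\<lambda>b c. r < b)" "ev2 (\<lambda>b c. r < c)"
  unfolding ev2_def by (auto intro: eventually_gt_at_top eventually_mono[OF eventually_gt_at_top[of r]] always_eventually)

text \<open>For fixed \<open>b\<close> the shift \<open>f / b\<close> is a constant, which the inner
  limit absorbs. A real row combination of a matrix \<open>lower m b c\<close> is a substitution of
  this shape.\<close>

lemma ev2_affine:
  assumes "ev2 P" "e > 0"
  shows "ev2 (\<lambda>b c. P (e * b) (e * c + f / b))"
proof -
  have mult: "filterlim (\<lambda>x. e * x) at_top at_top"
    by (rule filterlim_tendsto_pos_mult_at_top[OF tendsto_const assms(2) filterlim_ident])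
  have affine: "filterlim (\<lambda>x. e * x + g) at_top at_top" for g
    using filterlim_tendsto_add_at_top[OF tendsto_const[of g] mult] by (simp add: add.commute)
  have "\<forall>\<^sub>F b in at_top. \<forall>\<^sub>F c in at_top. P (e * b) c"
    using assms(1) mult unfolding ev2_def filterlim_iff by blast
  then show ?thesis unfolding ev2_def
  proof (rule eventually_mono)
    fix b assume "\<forall>\<^sub>F c in at_top. P (e * b) c"
    then show "\<forall>\<^sub>F c in at_top. P (e * b) (e * c + f / b)"
      using affine[of "f / b"] unfolding filterlim_iff by blast
  qed
qed

text \<open>Past the last boundary point the truth value is constant. Dichotomies of this kind make
  the limits below complete types.\<close>

lemma eventually_dichotomy_at_top:
  fixes \<phi> :: "real fm"
  shows "(\<forall>\<^sub>F x in at_top. sat \<phi> (x # as)) \<or> (\<forall>\<^sub>F x in at_top. \<not> sat \<phi> (x # as))"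
proof -
  obtain Z where Z: "finite Z" "\<And>u v. u < v \<Longrightarrow> Z \<inter> {u..v} = {} \<Longrightarrow> sat \<phi> (u # as) = sat \<phi> (v # as)"
    using uniform_boundary[of \<phi>] by meson
  have "eventually (\<lambda>x. \<forall>z\<in>Z. z < x) at_top"
    by (intro eventually_ball_finite[OF Z(1)] ballI eventually_gt_at_top)
  then obtain M where M: "\<And>x. M \<le> x \<Longrightarrow> \<forall>z\<in>Z. z < x" unfolding eventually_at_top_linorder by blast
  have eq: "sat \<phi> (x # as) = sat \<phi> (M # as)" if "x > M" for x
    using Z(2)[OF that] M[of M] by fastforce
  show ?thesis
  proof (cases "sat \<phi> (M # as)")
    case True
    then show ?thesis using eq by (auto intro: eventually_mono[OF eventually_gt_at_top[of M]])
  next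
    case False
    then show ?thesis using eq by (auto intro: eventually_mono[OF eventually_gt_at_top[of M]])
  qed
qed

lemma eventually_dichotomy_at_right:
  fixes \<phi> :: "real fm"
  shows "(\<forall>\<^sub>F x in at_right 0. sat \<phi> (x # as)) \<or> (\<forall>\<^sub>F x in at_right 0. \<not> sat \<phi> (x # as))"
proof -
  obtain Z where Z: "finite Z" "\<And>u v. u < v \<Longrightarrow> Z \<inter> {u..v} = {} \<Longrightarrow> sat \<phi> (u # as) = sat \<phi> (v # as)"
    using uniform_boundary[of \<phi>] by meson
  have "eventually (\<lambda>x. z \<le> 0 \<or> x < z) (at_right 0)" for z :: real
  proof (cases "z \<le> 0")
    case False
    then show ?thesis using eventually_at_right_real[of 0 z] by (auto elim: eventually_mono)
  qed simp
  then have "eventually (\<lambda>x. \<forall>z\<in>Z. z \<le> 0 \<or> x < z) (at_right 0)"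
    by (intro eventually_ball_finite[OF Z(1)]) auto
  then obtain e where e: "e > 0" "\<And>x. 0 < x \<Longrightarrow> x < e \<Longrightarrow> \<forall>z\<in>Z. z \<le> 0 \<or> x < z"
    unfolding eventually_at_right_field by blast
  have eq: "sat \<phi> (x # as) = sat \<phi> (e / 2 # as)" if "0 < x" "x < e / 2" for x
    using Z(2)[OF that(2)] e(2)[of "e / 2"] e(1) that(1) by fastforce
  have ev: "\<forall>\<^sub>F x in at_right 0. sat \<phi> (x # as) = sat \<phi> (e / 2 # as)"
    using eventually_at_right_real[of 0 "e / 2"] e(1) eq by (auto elim: eventually_mono)
  show ?thesis
  proof (cases "sat \<phi> (e / 2 # as)")
    case True
    then show ?thesis using ev by simp
  next
    case False
    then show ?thesis using ev by simp
  qed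
qed

text \<open>Definability of the type at infinity: the inner limit is a formula in the remaining
  variables, so the next limit obeys a dichotomy too. Variables are ordered with the innermost limit
  first.\<close>

definition limit_fm :: "real fm \<Rightarrow> real fm" where
  "limit_fm \<phi> = Exi (Forall (Imp (Less (Var 1) (Var 0)) (subst_fm \<phi> [Var 0, Var 2, Var 3])))"

lemma sat_limit_fm:
  "fm_below \<phi> 3 \<Longrightarrow> sat (limit_fm \<phi>) [b, m] \<longleftrightarrow> (\<forall>\<^sub>F c in at_top. sat \<phi> [c, b, m])"
  by (simp add: limit_fm_def eventually_at_top_dense not_le)

lemma ev2_dichotomy3:
  assumes "fm_below \<phi> 3"
  shows "ev2 (\<lambda>b c. sat \<phi> [c, b, m]) \<or> ev2 (\<lambda>b c. \<not> sat \<phi> [c, b, m])"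
proof (cases "\<forall>\<^sub>F b in at_top. sat (limit_fm \<phi>) [b, m]")
  case True
  then show ?thesis by (simp add: ev2_def sat_limit_fm[OF assms])
next
  case False
  then have "\<forall>\<^sub>F b in at_top. \<not> sat (limit_fm \<phi>) [b, m]"
    using eventually_dichotomy_at_top[of "limit_fm \<phi>" "[m]"] by blast
  then have "ev2 (\<lambda>b c. \<not> sat \<phi> [c, b, m])" unfolding ev2_def
  proof (rule eventually_mono)
    fix b assume "\<not> sat (limit_fm \<phi>) [b, m]"
    then show "\<forall>\<^sub>F c in at_top. \<not> sat \<phi> [c, b, m]"
      using eventually_dichotomy_at_top[of \<phi> "[b, m]"] by (simp add: sat_limit_fm[OF assms])
  qed
  then show ?thesis ..
qed

lemma ev2_dichotomy:
  assumes "fm_below \<phi> 2"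
  shows "ev2 (\<lambda>b c. sat \<phi> [b, c]) \<or> ev2 (\<lambda>b c. \<not> sat \<phi> [b, c])"
  using ev2_dichotomy3[of "subst_fm \<phi> [Var 1, Var 0]" 0] assms by simp

text \<open>
  The matrix with entries \<open>lower m b c\<close> is the product of the lower unipotent matrix with
  entry \<open>m\<close> and \<open>H_elem b c\<close>. The type \<open>r\<^sub>0\<close> is the limit m to 0+, b to infinity, c to infinity, with c innermost.
\<close>

definition lower :: "'a::field \<Rightarrow> 'a \<Rightarrow> 'a \<Rightarrow> 'a list" where
  "lower m b c = [b, c, m * b, m * c + inverse b]"

definition ev_lower :: "real fm \<Rightarrow> bool" where
  "ev_lower \<phi> \<longleftrightarrow> (\<forall>\<^sub>F m in at_right 0. ev2 (\<lambda>b c. sat \<phi> (lower m b c)))"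

text \<open>The inverse of \<open>b\<close> is not a term of the ring language and enters as a
  witness \<open>z\<close> with \<open>z * b = 1\<close>. The tuple is \<open>[c, b, m]\<close>, as
  \<open>limit_fm\<close> expects.\<close>

definition lower_fm :: "real fm \<Rightarrow> real fm" where
  "lower_fm \<phi> = Exi (Conj (Eq (Times (Var 0) (Var 2)) One)
     (subst_fm \<phi> [Var 2, Var 1, Times (Var 3) (Var 2), Plus (Times (Var 3) (Var 1)) (Var 0)]))"

lemma fm_below_lower_fm [simp]: "fm_below (lower_fm \<phi>) 3"
  by (simp add: lower_fm_def)

lemma mult_eq_1_iff_inverse: "(b :: 'a :: field) \<noteq> 0 \<Longrightarrow> z * b = 1 \<longleftrightarrow> z = inverse b"
  by (metis inverse_unique left_inverse mult.commute)

lemma sat_lower_fm: "fm_below \<phi> 4 \<Longrightarrow> b \<noteq> 0 \<Longrightarrow> sat (lower_fm \<phi>) [c, b, m] \<longleftrightarrow> sat \<phi> (lower m b c)"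
  by (simp add: lower_fm_def lower_def mult_eq_1_iff_inverse)

lemma ev_lower_dichotomy:
  assumes "fm_below \<phi> 4"
  shows "ev_lower \<phi> \<or> ev_lower (Neg \<phi>)"
proof -
  have eq: "ev2 (\<lambda>b c. sat \<psi> (lower m b c)) \<longleftrightarrow> ev2 (\<lambda>b c. sat (lower_fm \<psi>) [c, b, m])"
    if "fm_below \<psi> 4" for \<psi> m
  proof
    assume "ev2 (\<lambda>b c. sat \<psi> (lower m b c))"
    with ev2_gt(1)[of 0] have "ev2 (\<lambda>b c. 0 < b \<and> sat \<psi> (lower m b c))" by (simp add: ev2_conj)
    then show "ev2 (\<lambda>b c. sat (lower_fm \<psi>) [c, b, m])"
      by (rule ev2_mono) (simp add: sat_lower_fm that)
  next
    assume "ev2 (\<lambda>b c. sat (lower_fm \<psi>) [c, b, m])"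
    with ev2_gt(1)[of 0] have "ev2 (\<lambda>b c. 0 < b \<and> sat (lower_fm \<psi>) [c, b, m])" by (simp add: ev2_conj)
    then show "ev2 (\<lambda>b c. sat \<psi> (lower m b c))"
      by (rule ev2_mono) (auto simp: sat_lower_fm that)
  qed
  \<comment> \<open>Both inner limits become one formula in \<open>m\<close>, to which the dichotomy
    at 0+ applies.\<close>
  define \<theta> where "\<theta> = Exi (Forall (Imp (Less (Var 1) (Var 0)) (subst_fm (limit_fm (lower_fm \<phi>)) [Var 0, Var 2])))"
  have "fm_below (limit_fm (lower_fm \<phi>)) 2"
    by (simp add: limit_fm_def)
  then have \<theta>: "sat \<theta> [m] \<longleftrightarrow> ev2 (\<lambda>b c. sat \<phi> (lower m b c))" for m
    unfolding eq[OF assms]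
    by (simp add: \<theta>_def ev2_def eventually_at_top_dense[of "\<lambda>b. eventually (P b) F" for P F]
         sat_limit_fm not_le)
  have n: "ev2 (\<lambda>b c. sat (Neg \<phi>) (lower m b c))" if "\<not> sat \<theta> [m]" for m
  proof -
    have "ev2 (\<lambda>b c. \<not> sat (lower_fm \<phi>) [c, b, m])"
      using that ev2_dichotomy3[of "lower_fm \<phi>" m] by (simp add: \<theta> eq[OF assms])
    with ev2_gt(1)[of 0] have "ev2 (\<lambda>b c. 0 < b \<and> \<not> sat (lower_fm \<phi>) [c, b, m])" by (simp add: ev2_conj)
    then show ?thesis by (rule ev2_mono) (auto simp: sat_lower_fm assms)
  qed
  show ?thesis
  proof (cases "\<forall>\<^sub>F m in at_right 0. sat \<theta> [m]")
    case True
    then show ?thesis by (simp add: ev_lower_def \<theta>)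
  next
    case False
    then have "\<forall>\<^sub>F m in at_right 0. \<not> sat \<theta> [m]"
      using eventually_dichotomy_at_right[of \<theta> "[]"] by blast
    then have "ev_lower (Neg \<phi>)" unfolding ev_lower_def by (rule eventually_mono) (rule n)
    then show ?thesis ..
  qed
qed

lemma ev_lower_Neg:
  assumes "fm_below \<phi> 4"
  shows "ev_lower (Neg \<phi>) \<longleftrightarrow> \<not> ev_lower \<phi>"
proof
  assume a: "ev_lower (Neg \<phi>)"
  show "\<not> ev_lower \<phi>"
  proof
    assume "ev_lower \<phi>"
    with a have "\<forall>\<^sub>F m in at_right (0::real). ev2 (\<lambda>b c. sat \<phi> (lower m b c) \<and> sat (Neg \<phi>) (lower m b c))"
      unfolding ev_lower_def ev2_conj by (simp add: eventually_conj_iff)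
    then show False using not_ev2_False by simp
  qed
qed (use ev_lower_dichotomy[OF assms] in blast)

section \<open>Generic pairs\<close>

context real_extension
begin

text \<open>Phrased by formulas over \<open>R\<close>, so that it depends on the type of the pair
  only and can be read off from any realization of \<open>p0\<close>.\<close>

definition generic :: "'k \<Rightarrow> 'k \<Rightarrow> bool" where
  "generic k l \<longleftrightarrow> (\<forall>\<phi>. fm_below \<phi> 2 \<longrightarrow> sat (map_fm \<iota> \<phi>) [k, l] = ev2 (\<lambda>b c. sat \<phi> [b, c]))"

lemma generic_sat: "generic k l \<Longrightarrow> fm_below \<phi> 2 \<Longrightarrow> sat (map_fm \<iota> \<phi>) [k, l] = ev2 (\<lambda>b c. sat \<phi> [b, c])"
  by (simp add: generic_def)

lemma generic_gt:
  assumes "generic k l"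
  shows "\<iota> r < k" "\<iota> r < l"
  using generic_sat[OF assms, of "Less (Param r) (Var 0)"] generic_sat[OF assms, of "Less (Param r) (Var 1)"]
    ev2_gt[of r] by (simp_all add: not_le)

lemma generic_pos: "generic k l \<Longrightarrow> 0 < k"
  using generic_gt(1)[of k l 0] by simp

text \<open>Both \<open>k\<close> and, in the limit, \<open>b\<close> are positive, so an
  existential quantifier can supply the inverse; terms may then mention it like a third
  variable.\<close>

lemma generic_terms:
  assumes g: "generic k l" and \<phi>: "fm_below \<phi> (length ts)" and ts: "list_all (tm_below 3) ts"
  shows "sat (map_fm \<iota> \<phi>) (map (\<lambda>t. tm_val [inverse k, k, l] (map_tm \<iota> t)) ts)
    = ev2 (\<lambda>b c. sat \<phi> (map (tm_val [inverse b, b, c]) ts))"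
proof -
  define \<psi> where "\<psi> = Exi (Conj (Eq (Times (Var 0) (Var 1)) One) (subst_fm \<phi> ts))"
  have real: "sat \<psi> [b, c] = sat \<phi> (map (tm_val [inverse b, b, c]) ts)" if "b \<noteq> 0" for b c
    using that \<phi> by (simp add: \<psi>_def mult_eq_1_iff_inverse)
  have "fm_below \<psi> 2" using ts by (simp add: \<psi>_def)
  have "sat (map_fm \<iota> \<phi>) (map (\<lambda>t. tm_val [inverse k, k, l] (map_tm \<iota> t)) ts) = sat (map_fm \<iota> \<psi>) [k, l]"
    using generic_pos[OF g] \<phi> by (simp add: \<psi>_def mult_eq_1_iff_inverse comp_def)
  also have "\<dots> = ev2 (\<lambda>b c. sat \<psi> [b, c])" by (rule generic_sat[OF g]) fact
  also have "\<dots> = ev2 (\<lambda>b c. 0 < b \<and> sat \<psi> [b, c])" using ev2_gt(1)[of 0] by (simp add: ev2_conj)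
  also have "\<dots> = ev2 (\<lambda>b c. 0 < b \<and> sat \<phi> (map (tm_val [inverse b, b, c]) ts))"
    by (rule arg_cong[of _ _ ev2]) (auto simp: fun_eq_iff real)
  also have "\<dots> = ev2 (\<lambda>b c. sat \<phi> (map (tm_val [inverse b, b, c]) ts))"
    using ev2_gt(1)[of 0] by (simp add: ev2_conj)
  finally show ?thesis .
qed

lemma generic_H_elem:
  assumes "generic k l" "fm_below \<phi> 4"
  shows "sat (map_fm \<iota> \<phi>) [k, l, 0, inverse k] = ev2 (\<lambda>b c. sat \<phi> [b, c, 0, inverse b])"
  using generic_terms[OF assms(1), of \<phi> "[Var 1, Var 2, Zero, Var 0]"] assms(2) by simp

lemma generic_lower:
  assumes "generic k l" "fm_below \<phi> 4"
  shows "sat (map_fm \<iota> \<phi>) (lower (\<iota> m) k l) = ev2 (\<lambda>b c. sat \<phi> (lower m b c))"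
  using generic_terms[OF assms(1), of \<phi> "[Var 1, Var 2, Times (Param m) (Var 1), Plus (Times (Param m) (Var 2)) (Var 0)]"]
    assms(2) by (simp add: lower_def)

lemma genericI:
  assumes "\<And>\<phi>. fm_below \<phi> 2 \<Longrightarrow> ev2 (\<lambda>b c. sat \<phi> [b, c]) \<Longrightarrow> sat (map_fm \<iota> \<phi>) [k, l]"
  shows "generic k l"
  unfolding generic_def
proof (intro allI impI iffI)
  fix \<phi> assume \<phi>: "fm_below \<phi> 2" "sat (map_fm \<iota> \<phi>) [k, l]"
  then show "ev2 (\<lambda>b c. sat \<phi> [b, c])"
    using ev2_dichotomy[OF \<phi>(1)] assms[of "Neg \<phi>"] by auto
qed (use assms in auto)

text \<open>
  Where \<open>\<phi> b c\<close> holds for all large \<open>c\<close>, it holds beyond the least such bound (or everywhere, then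
  0 is taken), and that bound is definable from \<open>b\<close>.
\<close>

definition holds_beyond :: "'c fm \<Rightarrow> 'c fm" where
  "holds_beyond \<phi> = Forall (Imp (Less (Var 1) (Var 0)) (subst_fm \<phi> [Var 2, Var 0]))"

definition least_bound :: "'c fm \<Rightarrow> 'c fm" where
  "least_bound \<phi> = Disj
     (Conj (holds_beyond \<phi>) (Forall (Imp (subst_fm (holds_beyond \<phi>) [Var 0, Var 2]) (Leq (Var 1) (Var 0)))))
     (Conj (Forall (subst_fm (holds_beyond \<phi>) [Var 0, Var 2])) (Eq (Var 0) Zero))"

text \<open>An eventually true formula holds beyond a bound in the definable closure of
  \<open>k\<close>, and \<open>l\<close> exceeds that bound. Its existence and uniqueness rest on
  infima, hence are proved over the reals and transferred as the sentence
  \<open>\<theta>\<close>.\<close>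

lemma infinite_over_generic:
  assumes k: "infinite_elem R k" and l: "infinite_over R [k] l"
  shows "generic k l"
proof (rule genericI)
  fix \<phi> :: "real fm"
  assume \<phi>: "fm_below \<phi> 2" and ev: "ev2 (\<lambda>b c. sat \<phi> [b, c])"
  have below: "fm_below (holds_beyond \<phi>) 2" "fm_below (least_bound \<phi>) 2"
    by (simp_all add: holds_beyond_def least_bound_def)
  obtain B where B: "\<And>b. b > B \<Longrightarrow> \<forall>\<^sub>F c in at_top. sat \<phi> [b, c]"
    using ev unfolding ev2_def eventually_at_top_dense[of "\<lambda>b. eventually (P b) F" for P F] by blast
  define \<theta> where "\<theta> = Forall (Imp (Less (Param B) (Var 0)) (Exi (Conj (least_bound \<phi>)
    (Forall (Imp (subst_fm (least_bound \<phi>) [Var 0, Var 2]) (Eq (Var 0) (Var 1)))))))"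
  have \<theta>0: "fm_below \<theta> 0" using below by (simp add: \<theta>_def flip: numeral_2_eq_2)
  have E: "sat (holds_beyond \<phi>) [d, b] \<longleftrightarrow> (\<forall>c>d. sat \<phi> [b, c])" for d b :: real
    using \<phi> by (simp add: holds_beyond_def not_le)
  have L: "sat (least_bound \<phi>) [d, b] \<longleftrightarrow>
     (\<forall>c>d. sat \<phi> [b, c]) \<and> (\<forall>e. (\<forall>c>e. sat \<phi> [b, c]) \<longrightarrow> d \<le> e) \<or> (\<forall>c. sat \<phi> [b, c]) \<and> d = 0" for d b
  proof -
    have "(\<forall>e. \<forall>c>e. sat \<phi> [b, c]) \<longleftrightarrow> (\<forall>c. sat \<phi> [b, c])" by (metis lt_ex)
    then show ?thesis using below by (simp add: least_bound_def E)
  qed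
  have "sat \<theta> []"
  proof -
    have "\<exists>d. sat (least_bound \<phi>) [d, b] \<and> (\<forall>e. sat (least_bound \<phi>) [e, b] \<longrightarrow> e = d)" if b: "B < b" for b
    proof (cases "\<forall>c. sat \<phi> [b, c]")
      case True
      have "\<not> (\<forall>e. d \<le> e)" for d :: real by (meson lt_ex not_le)
      then show ?thesis using True unfolding L by (intro exI[of _ 0]) blast
    next
      case False
      define D where "D = {d. \<forall>c>d. sat \<phi> [b, c]}"
      obtain d0 where d0: "d0 \<in> D"
        using B[OF b] by (auto simp: eventually_at_top_dense D_def)
      obtain c0 where c0: "\<not> sat \<phi> [b, c0]" using False by blast
      have bdd: "bdd_below D" by (rule bdd_belowI[of _ c0]) (use c0 in \<open>auto simp: D_def not_less[symmetric]\<close>)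
      have "Inf D \<in> D"
      proof -
        have "sat \<phi> [b, c]" if "c > Inf D" for c
          using that cInf_less_iff[of D c] bdd d0 by (auto simp: D_def)
        then show ?thesis by (simp add: D_def)
      qed
      then have "sat (least_bound \<phi>) [Inf D, b]"
        using cInf_lower[OF _ bdd] by (auto simp: L D_def)
      moreover have "e = Inf D" if "sat (least_bound \<phi>) [e, b]" for e
      proof -
        have e: "e \<in> D" "\<And>e'. e' \<in> D \<Longrightarrow> e \<le> e'" using that False by (auto simp: L D_def)
        then show ?thesis using \<open>Inf D \<in> D\<close> cInf_lower[OF e(1) bdd] by (intro antisym) auto
      qed
      ultimately show ?thesis by blast
    qed
    then show ?thesis using below by (simp add: \<theta>_def not_le)
  qed
  then have "sat (map_fm \<iota> \<theta>) []" by (rule transfer_sentence[OF \<theta>0])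
  then have "\<forall>b. \<iota> B < b \<longrightarrow> (\<exists>d. sat (map_fm \<iota> (least_bound \<phi>)) [d, b] \<and>
      (\<forall>e. sat (map_fm \<iota> (least_bound \<phi>)) [e, b] \<longrightarrow> e = d))"
    using below by (simp add: \<theta>_def not_le)
  moreover have "\<iota> B < k" using k by (simp add: infinite_elem_def)
  ultimately obtain d where d: "sat (map_fm \<iota> (least_bound \<phi>)) [d, k]"
    "\<And>e. sat (map_fm \<iota> (least_bound \<phi>)) [e, k] \<Longrightarrow> e = d"
    by blast
  have "d \<in> dcl (R \<union> set [k])"
    unfolding dcl_def
  proof (intro CollectI bexI[of _ "subst_fm (map_fm \<iota> (least_bound \<phi>)) [Var 0, Param k]"] allI)
    show "sat (subst_fm (map_fm \<iota> (least_bound \<phi>)) [Var 0, Param k]) [x] \<longleftrightarrow> x = d" for x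
    proof -
      have "sat (subst_fm (map_fm \<iota> (least_bound \<phi>)) [Var 0, Param k]) [x] =
        sat (map_fm \<iota> (least_bound \<phi>)) [x, k]" using below by simp
      then show ?thesis using d by metis
    qed
    show "subst_fm (map_fm \<iota> (least_bound \<phi>)) [Var 0, Param k] \<in> formulas (R \<union> set [k]) 1"
      using fm_params_subst[of "map_fm \<iota> (least_bound \<phi>)" "[Var 0, Param k]"]
      by (auto simp: formulas_def fm.set_map)
  qed
  then have "d < l" using l by (simp add: infinite_over_def)
  have "(\<forall>c>d. sat (map_fm \<iota> \<phi>) [k, c]) \<or> (\<forall>e. \<forall>c>e. sat (map_fm \<iota> \<phi>) [k, c])"
  proof -
    have E': "sat (map_fm \<iota> (holds_beyond \<phi>)) [e, k] \<longleftrightarrow> (\<forall>c>e. sat (map_fm \<iota> \<phi>) [k, c])" for e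
      using \<phi> by (simp add: holds_beyond_def not_le)
    have "sat (map_fm \<iota> (least_bound \<phi>)) [d, k] \<longrightarrow> sat (map_fm \<iota> (holds_beyond \<phi>)) [d, k]
       \<or> (\<forall>e. sat (map_fm \<iota> (holds_beyond \<phi>)) [e, k])"
      using below by (simp add: least_bound_def del: sat_Leq)
    then show ?thesis using d(1) unfolding E' by blast
  qed
  then show "sat (map_fm \<iota> \<phi>) [k, l]" using \<open>d < l\<close> by blast
qed

end

section \<open>Matrices\<close>

lemma mat22_nth [simp]:
  "mat22 a b c d $ 1 $ 1 = a" "mat22 a b c d $ 1 $ 2 = b"
  "mat22 a b c d $ 2 $ 1 = c" "mat22 a b c d $ 2 $ 2 = (d :: 'a :: comm_ring_1)"
  by (simp_all add: mat22_def)

lemma entries_mat22 [simp]: "entries (mat22 a b c d) = [a, b, c, d :: 'a :: comm_ring_1]"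
  by (simp add: entries_def)

lemma length_entries [simp]: "length (entries g) = 4"
  by (simp add: entries_def)

lemma entries_inject [simp]: "entries g = entries h \<longleftrightarrow> g = h"
  by (auto simp: entries_def vec_eq_iff forall_2)

lemma entries_surj:
  assumes "length as = 4"
  obtains g :: "'a::comm_ring_1^2^2" where "as = entries g"
proof -
  obtain a b c d where "as = [a, b, c, d]"
    using assms by (auto simp: eval_nat_numeral length_Suc_conv)
  then show ?thesis by (intro that[of "mat22 a b c d"]) simp
qed

lemma entries_mult:
  fixes g h :: "'a::comm_ring_1^2^2"
  shows "entries (g ** h) =
    [g$1$1 * h$1$1 + g$1$2 * h$2$1, g$1$1 * h$1$2 + g$1$2 * h$2$2,
     g$2$1 * h$1$1 + g$2$2 * h$2$1, g$2$1 * h$1$2 + g$2$2 * h$2$2]"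
  by (simp add: entries_def matrix_matrix_mult_def UNIV_2)

lemma SL2_iff: "g \<in> SL2 \<longleftrightarrow> g$1$1 * g$2$2 = 1 + g$1$2 * g$2$1"
  by (auto simp: SL2_def det_2 algebra_simps)

lemma sat_SL2_fm [simp]: "sat SL2_fm (entries g) \<longleftrightarrow> g \<in> SL2"
  by (simp add: SL2_fm_def SL2_iff entries_def)

lemma SL2_fm_simps [simp]: "fm_below SL2_fm 4" "map_fm f SL2_fm = SL2_fm" "fm_params SL2_fm = {}"
  by (simp_all add: SL2_fm_def)

lemma SL2_mult: "g \<in> SL2 \<Longrightarrow> h \<in> SL2 \<Longrightarrow> g ** h \<in> SL2"
  by (simp add: SL2_def det_mul)

lemma SL2_uminus: "- g \<in> SL2 \<longleftrightarrow> g \<in> SL2"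
  by (simp add: SL2_iff)

text \<open>The right factor becomes a tuple of parameters. A statement about \<open>a ** b\<close>
  is thereby one about the type of \<open>a\<close> over \<open>b\<close>.\<close>

definition right_mult_fm :: "'a^2^2 \<Rightarrow> 'a fm \<Rightarrow> 'a fm" where
  "right_mult_fm h \<phi> = subst_fm \<phi>
    [Plus (Times (Var 0) (Param (h$1$1))) (Times (Var 1) (Param (h$2$1))),
     Plus (Times (Var 0) (Param (h$1$2))) (Times (Var 1) (Param (h$2$2))),
     Plus (Times (Var 2) (Param (h$1$1))) (Times (Var 3) (Param (h$2$1))),
     Plus (Times (Var 2) (Param (h$1$2))) (Times (Var 3) (Param (h$2$2)))]"

definition left_mult_fm :: "'a^2^2 \<Rightarrow> 'a fm \<Rightarrow> 'a fm" where
  "left_mult_fm g \<phi> = subst_fm \<phi>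
    [Plus (Times (Param (g$1$1)) (Var 0)) (Times (Param (g$1$2)) (Var 2)),
     Plus (Times (Param (g$1$1)) (Var 1)) (Times (Param (g$1$2)) (Var 3)),
     Plus (Times (Param (g$2$1)) (Var 0)) (Times (Param (g$2$2)) (Var 2)),
     Plus (Times (Param (g$2$1)) (Var 1)) (Times (Param (g$2$2)) (Var 3))]"

lemma sat_right_mult_fm:
  "fm_below \<phi> 4 \<Longrightarrow> sat (right_mult_fm h \<phi>) (entries g) = sat \<phi> (entries (g ** h))"
  by (simp add: right_mult_fm_def entries_mult) (simp add: entries_def)

lemma sat_left_mult_fm:
  "fm_below \<phi> 4 \<Longrightarrow> sat (left_mult_fm g \<phi>) (entries h) = sat \<phi> (entries (g ** h))"
  by (simp add: left_mult_fm_def entries_mult) (simp add: entries_def)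

lemma fm_below_mult_fm [simp]: "fm_below (right_mult_fm h \<phi>) 4" "fm_below (left_mult_fm h \<phi>) 4"
  by (simp_all add: right_mult_fm_def left_mult_fm_def)

lemma fm_params_right_mult_fm: "fm_params (right_mult_fm h \<phi>) \<subseteq> fm_params \<phi> \<union> set (entries h)"
  unfolding right_mult_fm_def by (rule order_trans[OF fm_params_subst]) (auto simp: entries_def)

definition uminus_fm :: "'a::comm_ring_1 fm \<Rightarrow> 'a fm" where
  "uminus_fm \<phi> = subst_fm \<phi> (map (\<lambda>i. Times (Param (-1)) (Var i)) [0, 1, 2, 3])"

lemma sat_uminus_fm:
  "fm_below \<phi> 4 \<Longrightarrow> sat (uminus_fm \<phi>) (entries g) = sat \<phi> (entries (- g))"
  by (simp add: uminus_fm_def) (simp add: entries_def)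

lemma fm_below_uminus_fm [simp]: "fm_below (uminus_fm \<phi>) 4"
  by (simp add: uminus_fm_def)

lemma fm_params_uminus_fm: "fm_params (uminus_fm \<phi>) \<subseteq> fm_params \<phi> \<union> {-1}"
  unfolding uminus_fm_def by (rule order_trans[OF fm_params_subst]) auto

section \<open>Types over the reals\<close>

context real_extension
begin

definition emb :: "real^2^2 \<Rightarrow> 'k^2^2" where
  "emb g = mat22 (\<iota> (g$1$1)) (\<iota> (g$1$2)) (\<iota> (g$2$1)) (\<iota> (g$2$2))"

lemma entries_emb: "entries (emb g) = map \<iota> (entries g)"
  by (simp add: emb_def) (simp add: entries_def)

lemma emb_nth [simp]: "emb g $ i $ j = \<iota> (g $ i $ j)"
  using exhaust_2[of i] exhaust_2[of j] by (auto simp: emb_def)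

lemma emb_mult: "emb (g ** h) = emb g ** emb h"
  by (simp add: vec_eq_iff forall_2 matrix_matrix_mult_def UNIV_2)

lemma emb_uminus: "emb (- g) = - emb g"
  by (simp add: vec_eq_iff)

lemma emb_mat1: "emb (mat 1) = mat 1"
  by (simp add: vec_eq_iff mat_def)

lemma emb_SL2: "emb g \<in> SL2 \<longleftrightarrow> g \<in> SL2"
  by (simp add: SL2_iff flip: \<iota>_mult \<iota>_add \<iota>_1)

lemma SL2_over_range: "SL2_over R = emb ` SL2"
proof safe
  fix g assume g: "g \<in> SL2_over R"
  then obtain a b c d where "entries g = map \<iota> [a, b, c, d]"
    by (auto simp: SL2_over_def entries_def)
  then have "entries g = entries (emb (mat22 a b c d))" by (simp add: entries_emb)
  then have "g = emb (mat22 a b c d)" by simp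
  then show "g \<in> emb ` SL2" using g by (auto simp: SL2_over_def emb_SL2)
next
  fix g :: "real^2^2" assume "g \<in> SL2"
  then show "emb g \<in> SL2_over R" by (auto simp: SL2_over_def emb_SL2 entries_emb)
qed

lemma transfer_entries: "fm_below \<phi> 4 \<Longrightarrow> sat (map_fm \<iota> \<phi>) (entries (emb g)) = sat \<phi> (entries g)"
  by (simp add: entries_emb transfer)

lemma mtp_eq: "mtp R a = map_fm \<iota> ` {\<phi>. fm_below \<phi> 4 \<and> sat (map_fm \<iota> \<phi>) (entries a)}"
  by (auto simp: tp_def formulas_range)

lemma map_fm_mem: "map_fm \<iota> \<phi> \<in> map_fm \<iota> ` S \<longleftrightarrow> \<phi> \<in> S"
  by (rule inj_image_mem_iff[OF fm.inj_map[OF inj_\<iota>]])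

lemma mtp_eq_iff:
  "mtp R a = mtp R b \<longleftrightarrow>
     (\<forall>\<phi>. fm_below \<phi> 4 \<longrightarrow> sat (map_fm \<iota> \<phi>) (entries a) = sat (map_fm \<iota> \<phi>) (entries b))"
  unfolding mtp_eq inj_image_eq_iff[OF fm.inj_map[OF inj_\<iota>]] by auto

text \<open>The form in which \<open>p0\<close> and \<open>r0\<close> are computed: the predicate
  \<open>P\<close> is a limit over the reals.\<close>

lemma mtp_eq_image_iff:
  "mtp R a = map_fm \<iota> ` {\<phi>. fm_below \<phi> 4 \<and> P \<phi>} \<longleftrightarrow>
     (\<forall>\<phi>. fm_below \<phi> 4 \<longrightarrow> sat (map_fm \<iota> \<phi>) (entries a) = P \<phi>)"
  unfolding mtp_eq inj_image_eq_iff[OF fm.inj_map[OF inj_\<iota>]] by auto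

lemma mtp_left_mult:
  assumes "mtp R a = mtp R b"
  shows "mtp R (emb g ** a) = mtp R (emb g ** b)"
proof -
  have "map_fm \<iota> (left_mult_fm g \<phi>) = left_mult_fm (emb g) (map_fm \<iota> \<phi>)" for \<phi>
    by (simp add: left_mult_fm_def)
  then show ?thesis using assms unfolding mtp_eq_iff
    by (metis fm_below_map fm_below_mult_fm(2) sat_left_mult_fm)
qed

text \<open>The definite description in \<open>act\<close> is unambiguous because left
  multiplication by a real matrix respects equality of types.\<close>

lemma act_mtp:
  assumes "a \<in> SL2"
  shows "act R (emb g) (mtp R a) = mtp R (emb g ** a)"
  unfolding act_def by (rule the_equality) (use assms mtp_left_mult in blast)+

lemma SL2_fm_in_mtp: "SL2_fm \<in> mtp R a \<longleftrightarrow> a \<in> SL2"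
  by (simp add: tp_def formulas_def)

lemma mtp_in_S_G: "a \<in> SL2 \<Longrightarrow> mtp R a \<in> S_G R"
  using complete_type_tp[of "R" "entries a"] by (simp add: S_G_def SL2_fm_in_mtp)

text \<open>Inclusion between complete types over the same set is equality, and real 4-tuples are
  entries of real matrices. The matrix \<open>g\<close> ranges over all of them; where it must lie
  in the group, \<open>SL2_fm\<close> is added to the formula.\<close>

lemma is_coheir_mtp:
  assumes "R \<subseteq> B"
  shows "is_coheir R B (mtp R a) (mtp B b) \<longleftrightarrow>
     mtp R a = mtp R b \<and>
     (\<forall>\<phi>\<in>formulas B 4. sat \<phi> (entries b) \<longrightarrow> (\<exists>g. sat \<phi> (entries (emb g))))"
proof -
  have sub: "formulas R 4 \<subseteq> formulas B 4" using assms by (auto simp: formulas_def)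
  have 1: "mtp R a \<subseteq> mtp B b \<longleftrightarrow> mtp R a = mtp R b"
  proof
    assume s: "mtp R a \<subseteq> mtp B b"
    have "sat \<phi> (entries a) = sat \<phi> (entries b)" if "\<phi> \<in> formulas R 4" for \<phi>
    proof (cases "sat \<phi> (entries a)")
      case True
      then show ?thesis using s that by (auto simp: tp_def)
    next
      case False
      then have "Neg \<phi> \<in> mtp R a" using that by (simp add: tp_def formulas_def)
      then show ?thesis using s False by (auto simp: tp_def)
    qed
    then show "mtp R a = mtp R b" by (auto simp: tp_def)
  qed (use sub in \<open>auto simp: tp_def\<close>)
  have 2: "(\<exists>as. length as = 4 \<and> set as \<subseteq> R \<and> sat \<phi> as) \<longleftrightarrow> (\<exists>g. sat \<phi> (entries (emb g)))" for \<phi>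
  proof
    assume "\<exists>as. length as = 4 \<and> set as \<subseteq> R \<and> sat \<phi> as"
    then obtain as where as: "length as = 4" "set as \<subseteq> R" "sat \<phi> as" by blast
    then obtain bs where bs: "as = map \<iota> bs" by (metis ex_map_conv subsetD imageE)
    then obtain g where "bs = entries g" using as(1) entries_surj[of bs] by auto
    then show "\<exists>g. sat \<phi> (entries (emb g))" using as bs by (auto simp: entries_emb)
  next
    assume "\<exists>g. sat \<phi> (entries (emb g))"
    then obtain g where "sat \<phi> (entries (emb g))" ..
    then show "\<exists>as. length as = 4 \<and> set as \<subseteq> R \<and> sat \<phi> as"
      by (intro exI[of _ "entries (emb g)"]) (auto simp: entries_emb)
  qed
  have "complete_type B 4 (mtp B b)" using complete_type_tp[of B "entries b"] by simp
  then show ?thesis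
    unfolding is_coheir_def finitely_satisfiable_in_def 1 2 by (auto simp: tp_def)
qed

end

section \<open>Saturated extensions\<close>

locale saturated_extension = real_extension \<iota> for \<iota> :: "real \<Rightarrow> 'k::linordered_field" +
  fixes \<kappa> :: "'c rel"
  assumes card_order: "Card_order \<kappa>"
    and card_real: "|UNIV :: real set| <o \<kappa>"
    and saturated: "saturated \<kappa> TYPE('k)"
begin

text \<open>Parameter sets below are \<open>R\<close> enlarged by finitely many elements, so they
  stay smaller than \<kappa> and saturation applies.\<close>

lemma card_params:
  assumes "finite F"
  shows "|R \<union> F| <o \<kappa>"
proof -
  have inf: "infinite R"
    using infinite_UNIV_char_0 by (simp add: finite_image_iff inj_\<iota>)
  have "|R| <o \<kappa>" using card_real by (meson card_of_image ordLeq_ordLess_trans)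
  moreover have "|F| <o |R|"
    by (rule finite_ordLess_infinite[OF card_of_Well_order card_of_Well_order]) (simp_all add: Field_card_of assms inf)
  then have "|F| <o \<kappa>" using calculation ordLess_transitive by blast
  moreover have "infinite (Field \<kappa>)"
  proof
    assume fin: "finite (Field \<kappa>)"
    have "|R| <o |Field \<kappa>|"
      using calculation(1) card_of_Field_ordIso[OF card_order] ordIso_symmetric ordLess_ordIso_trans by blast
    then show False using card_of_ordLeq_finite[OF ordLess_imp_ordLeq fin] inf by blast
  qed
  ultimately show ?thesis using card_of_Un_ordLess_infinite_Field[OF _ card_order] by blast
qed

section \<open>The types p0, q0 and r0\<close>

lemma realize_S_G:
  assumes "p \<in> S_G R"
  obtains a where "a \<in> SL2" "mtp R a = p"
proof -
  have "complete_type R 4 p" "|R| <o \<kappa>"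
    using assms card_params[of "{}"] by (simp_all add: S_G_def)
  then obtain as where as: "length as = 4" "tp R as = p"
    using saturated unfolding saturated_def by blast
  obtain a where "as = entries a" using entries_surj[OF as(1)] .
  then show ?thesis using as assms SL2_fm_in_mtp by (intro that[of a]) (auto simp: S_G_def)
qed

text \<open>By elementarity, finitely many formulas true at \<open>a\<close> have a common real
  solution. Completing the type inside the real tuples gives the coheir.\<close>

lemma coheir_exists:
  assumes "finite F"
  obtains b where "is_coheir R (R \<union> F) (mtp R a) (mtp (R \<union> F) b)"
proof -
  define X where "X = range (\<lambda>g. entries (emb g))"
  have fr: "finitely_realized X (mtp R a)"
    unfolding finitely_realized_def
  proof (intro allI impI, elim conjE)
    fix \<Phi> assume \<Phi>: "finite \<Phi>" "\<Phi> \<subseteq> mtp R a"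
    then obtain \<Psi> where \<Psi>: "finite \<Psi>" "\<Phi> = map_fm \<iota> ` \<Psi>"
      "\<Psi> \<subseteq> {\<phi>. fm_below \<phi> 4 \<and> sat (map_fm \<iota> \<phi>) (entries a)}"
      unfolding mtp_eq by (meson finite_subset_image)
    obtain \<phi>s where \<phi>s: "set \<phi>s = \<Psi>" using finite_list[OF \<Psi>(1)] ..
    have "sat (map_fm \<iota> (Exis 4 (Conjs \<phi>s))) []"
      using \<Psi>(3) \<phi>s by (auto intro!: exI[of _ "entries a"])
    then have "sat (Exis 4 (Conjs \<phi>s)) []"
      using transfer[of "Exis 4 (Conjs \<phi>s)" "[]"] \<Psi>(3) \<phi>s by auto
    then obtain xs where xs: "length xs = 4" "\<forall>\<phi>\<in>\<Psi>. sat \<phi> xs" using \<phi>s by auto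
    obtain g where "xs = entries g" using entries_surj[OF xs(1)] .
    then have "sat (map_fm \<iota> \<phi>) (entries (emb g))" if "\<phi> \<in> \<Psi>" for \<phi>
      using that xs \<Psi>(3) by (auto simp: transfer_entries)
    then show "\<exists>as\<in>X. \<forall>\<phi>\<in>\<Phi>. sat \<phi> as" by (auto simp: X_def \<Psi>(2))
  qed
  have sub: "mtp R a \<subseteq> formulas (R \<union> F) 4"
    by (auto simp: tp_def formulas_def)
  have X: "X \<subseteq> {as. length as = 4}" by (auto simp: X_def)
  obtain as where as: "length as = 4" "\<And>\<phi>. \<phi> \<in> mtp R a \<Longrightarrow> sat \<phi> as"
    "\<And>\<phi>. \<phi> \<in> formulas (R \<union> F) 4 \<Longrightarrow> sat \<phi> as \<Longrightarrow> \<exists>xs\<in>X. sat \<phi> xs"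
    using realize_in[OF saturated card_params[OF assms] X sub fr] by blast
  obtain b where b: "as = entries b" using entries_surj[OF as(1)] .
  have "sat (map_fm \<iota> \<phi>) (entries a) = sat (map_fm \<iota> \<phi>) (entries b)" if "fm_below \<phi> 4" for \<phi>
  proof -
    have mem: "sat (map_fm \<iota> \<psi>) (entries a) \<Longrightarrow> sat (map_fm \<iota> \<psi>) (entries b)" if "fm_below \<psi> 4" for \<psi>
      using as(2)[of "map_fm \<iota> \<psi>"] that by (auto simp: b tp_def formulas_def fm.set_map)
    show ?thesis using mem[OF that] mem[of "Neg \<phi>"] that by auto
  qed
  then have "mtp R a = mtp R b" unfolding mtp_eq_iff by blast
  moreover have "\<exists>g. sat \<phi> (entries (emb g))"
    if "\<phi> \<in> formulas (R \<union> F) 4" "sat \<phi> (entries b)" for \<phi>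
    using as(3)[OF that(1)] that(2) by (auto simp: b X_def)
  ultimately show ?thesis using that is_coheir_mtp[of "R \<union> F" a b] by blast
qed

text \<open>The filter is that of the order of the extension itself. Finitely many eventually true
  formulas have a common solution, and saturation gives an element satisfying all of them.\<close>

lemma eventual_realization:
  assumes "finite F"
  obtains c where "\<And>\<phi>. \<phi> \<in> formulas (R \<union> F) 1 \<Longrightarrow> \<forall>\<^sub>F x in at_top. sat \<phi> [x] \<Longrightarrow> sat \<phi> [c]"
proof -
  let ?\<Sigma> = "{\<phi> \<in> formulas (R \<union> F) 1. \<forall>\<^sub>F x in at_top. sat \<phi> [x]}"
  have "finitely_realized {as. length as = 1} ?\<Sigma>"
    unfolding finitely_realized_def
  proof (intro allI impI, elim conjE)
    fix \<Phi> assume "finite \<Phi>" "\<Phi> \<subseteq> ?\<Sigma>"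
    then have "\<forall>\<^sub>F x in at_top. \<forall>\<phi>\<in>\<Phi>. sat \<phi> [x]" by (intro eventually_ball_finite) auto
    then obtain x where "\<forall>\<phi>\<in>\<Phi>. sat \<phi> [x]"
      using eventually_happens'[OF trivial_limit_at_top_linorder] by blast
    then show "\<exists>as\<in>{as. length as = 1}. \<forall>\<phi>\<in>\<Phi>. sat \<phi> as" by (intro bexI[of _ "[x]"]) auto
  qed
  with realize_in[OF saturated card_params[OF assms] subset_refl, of ?\<Sigma> 1]
  obtain as where as: "length as = 1" "\<And>\<phi>. \<phi> \<in> ?\<Sigma> \<Longrightarrow> sat \<phi> as"
    by (metis (no_types, lifting) mem_Collect_eq subsetI)
  obtain c where "as = [c]" using as(1) by (auto simp: length_Suc_conv)
  then show ?thesis using that[of c] as(2) by blast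
qed

lemma infinite_exists: obtains k where "infinite_elem R k"
proof -
  obtain c where c: "\<And>\<phi>. \<phi> \<in> formulas (R \<union> {}) 1 \<Longrightarrow> \<forall>\<^sub>F x in at_top. sat \<phi> [x] \<Longrightarrow> sat \<phi> [c]"
    using eventual_realization[of "{}"] by blast
  have "\<iota> r < c" for r
    using c[of "Less (Param (\<iota> r)) (Var 0)"] eventually_gt_at_top[of "\<iota> r"]
    by (simp add: formulas_def not_le)
  then show ?thesis by (intro that[of c]) (auto simp: infinite_elem_def)
qed

lemma infinite_over_exists: obtains l where "infinite_over R [k] l"
proof -
  obtain c where c: "\<And>\<phi>. \<phi> \<in> formulas (R \<union> {k}) 1 \<Longrightarrow> \<forall>\<^sub>F x in at_top. sat \<phi> [x] \<Longrightarrow> sat \<phi> [c]"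
    using eventual_realization[of "{k}"] by blast
  have "d < c" if d: "d \<in> dcl (R \<union> {k})" for d
  proof -
    obtain \<phi> where \<phi>: "\<phi> \<in> formulas (R \<union> {k}) 1" "\<And>x. sat \<phi> [x] \<longleftrightarrow> x = d"
      using d unfolding dcl_def by blast
    \<comment> \<open>The element \<open>d\<close> is definable but need not be a parameter, so
      \<open>d < x\<close> is written through its defining formula.\<close>
    let ?\<psi> = "Exi (Conj (subst_fm \<phi> [Var 0]) (Less (Var 0) (Var 1)))"
    have \<psi>: "sat ?\<psi> [x] \<longleftrightarrow> d < x" for x
      using \<phi> by (simp add: formulas_def not_le)
    have "?\<psi> \<in> formulas (R \<union> {k}) 1"
      using \<phi>(1) fm_params_subst[of \<phi> "[Var 0]"] by (auto simp: formulas_def)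
    then have "sat ?\<psi> [c]" by (rule c) (simp only: \<psi> eventually_gt_at_top)
    then show ?thesis by (simp only: \<psi>)
  qed
  then show ?thesis by (intro that[of c]) (auto simp: infinite_over_def)
qed

lemma generic_exists: obtains k l where "generic k l"
  using infinite_exists infinite_over_exists infinite_over_generic by metis

lemma H_elem_in_H: "H_elem b c \<in> H \<longleftrightarrow> 0 < (b :: 'k)"
  by (auto simp: H_def H_elem_def dest!: arg_cong[of _ _ entries])

lemma entries_H_elem: "entries (H_elem b c) = [b, c, 0, inverse b]"
  by (simp add: H_elem_def)

text \<open>All admissible pairs are generic and hence have the same type, which resolves the
  definite description.\<close>

lemma p0_eq: "p0 R = map_fm \<iota> ` {\<phi>. fm_below \<phi> 4 \<and> ev2 (\<lambda>b c. sat \<phi> [b, c, 0, inverse b])}"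
  (is "_ = ?P")
proof -
  have eq: "mtp R (H_elem b c) = ?P" if "infinite_elem R b" "infinite_over R [b] c" for b c
    unfolding mtp_eq_image_iff unfolding entries_H_elem
    using generic_H_elem[OF infinite_over_generic[OF that]] by blast
  obtain b where b: "infinite_elem R b" using infinite_exists .
  obtain c where c: "infinite_over R [b] c" using infinite_over_exists .
  have "\<iota> 0 < b" using b unfolding infinite_elem_def by blast
  then have H: "H_elem b c \<in> H" by (simp add: H_elem_in_H)
  show ?thesis
    unfolding p0_def
  proof (rule the_equality)
    show "\<exists>b c. H_elem b c \<in> H \<and> infinite_elem R b \<and> infinite_over R [b] c \<and>
        ?P = mtp R (H_elem b c)"
      using H b c eq[OF b c] by metis
  qed (use eq in blast)
qed

text \<open>The first row of the matrix is the pair itself, so formulas about the pair are among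
  those of \<open>p0\<close>.\<close>

lemma p0_generic:
  assumes "h \<in> H" "mtp R h = p0 R"
  obtains k l where "h = H_elem k l" "generic k l"
proof -
  obtain k l where h: "h = H_elem k l" using assms(1) by (auto simp: H_def)
  have *: "sat (map_fm \<iota> \<phi>) [k, l, 0, inverse k] = ev2 (\<lambda>b c. sat \<phi> [b, c, 0, inverse b])" if "fm_below \<phi> 4" for \<phi>
    using assms(2) that unfolding p0_eq mtp_eq_image_iff h unfolding entries_H_elem by blast
  have "generic k l"
    unfolding generic_def
  proof (intro allI impI)
    fix \<phi> :: "real fm" assume "fm_below \<phi> 2"
    then show "sat (map_fm \<iota> \<phi>) [k, l] = ev2 (\<lambda>b c. sat \<phi> [b, c])"
      using *[of "subst_fm \<phi> [Var 0, Var 1]"] by simp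
  qed
  then show ?thesis using that h by blast
qed

lemma generic_p0: "generic k l \<Longrightarrow> mtp R (H_elem k l) = p0 R"
  unfolding p0_eq mtp_eq_image_iff unfolding entries_H_elem using generic_H_elem by blast

text \<open>A formula true on a real interval (0, e) is true on the corresponding interval of the
  extension, which contains \<open>y\<close>; the negation is treated alike.\<close>

lemma infinitesimal_sat:
  assumes y: "positive_infinitesimal R y" and \<theta>: "fm_below \<theta> 1"
  shows "sat (map_fm \<iota> \<theta>) [y] \<longleftrightarrow> (\<forall>\<^sub>F x in at_right 0. sat \<theta> [x])"
proof -
  have one: "sat (map_fm \<iota> \<theta>) [y]" if "\<forall>\<^sub>F x in at_right 0. sat \<theta> [x]" "fm_below \<theta> 1" for \<theta>
  proof -
    obtain e where e: "e > 0" "\<And>x. 0 < x \<Longrightarrow> x < e \<Longrightarrow> sat \<theta> [x]"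
      using \<open>\<forall>\<^sub>F x in at_right 0. sat \<theta> [x]\<close> unfolding eventually_at_right_field by blast
    let ?s = "Forall (Imp (Conj (Less Zero (Var 0)) (Less (Var 0) (Param e))) (subst_fm \<theta> [Var 0]))"
    have "sat (map_fm \<iota> ?s) []"
      by (rule transfer_sentence) (use e that(2) in \<open>simp_all add: not_le\<close>)
    then have "0 < y \<and> y < \<iota> e \<longrightarrow> sat (map_fm \<iota> \<theta>) [y]" using that(2) by (simp add: not_le)
    then show ?thesis using y e(1) by (auto simp: positive_infinitesimal_def)
  qed
  show ?thesis
    using one[of \<theta>] one[of "Neg \<theta>"] \<theta> eventually_dichotomy_at_right[of \<theta> "[]"] by auto
qed

text \<open>The entry \<open>x\<close> is the positive solution of the circle equation, so the
  matrix is definable from \<open>y\<close> and its type is a limit at 0+.\<close>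

lemma q0_eq:
  assumes "positive_infinitesimal R y" "0 < x" "x\<^sup>2 + y\<^sup>2 = 1"
  shows "q0 R = mtp R (T_elem x y)"
  unfolding q0_def
proof (rule the_equality)
  show "\<exists>x' y'. T_elem x' y' \<in> T \<and> positive_infinitesimal R y' \<and> 0 < x' \<and>
      mtp R (T_elem x y) = mtp R (T_elem x' y')"
    using assms by (intro exI[of _ x] exI[of _ y]) (auto simp: T_def)
  fix q assume "\<exists>x y. T_elem x y \<in> T \<and> positive_infinitesimal R y \<and> 0 < x \<and> q = mtp R (T_elem x y)"
  then obtain x' y' where *: "T_elem x' y' \<in> T" "positive_infinitesimal R y'" "0 < x'"
    "q = mtp R (T_elem x' y')" by blast
  have circle: "x'\<^sup>2 + y'\<^sup>2 = 1"
    using *(1) by (auto simp: T_def T_elem_def dest!: arg_cong[of _ _ entries])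
  define \<theta> where "\<theta> \<phi> = Exi (Conj (Conj (Less Zero (Var 0)) (Eq (Plus (Times (Var 0) (Var 0)) (Times (Var 1) (Var 1))) One))
      (subst_fm \<phi> [Var 0, Times (Param (-1)) (Var 1), Var 1, Var 0]))" for \<phi> :: "real fm"
  have type: "sat (map_fm \<iota> \<phi>) (entries (T_elem u v)) = (\<forall>\<^sub>F r in at_right 0. sat (\<theta> \<phi>) [r])"
    if v: "positive_infinitesimal R v" and u: "0 < u" "u\<^sup>2 + v\<^sup>2 = 1" and \<phi>: "fm_below \<phi> 4" for u v \<phi>
  proof -
    have "0 < z \<and> z * z + v * v = 1 \<longleftrightarrow> z = u" for z
    proof
      assume z: "0 < z \<and> z * z + v * v = 1"
      then have "z\<^sup>2 = u\<^sup>2" using u(2) by (metis add_right_cancel power2_eq_square)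
      then show "z = u" using z u(1) by (simp add: power2_eq_iff_nonneg)
    qed (use u in \<open>simp add: power2_eq_square\<close>)
    then have "sat (map_fm \<iota> (\<theta> \<phi>)) [v] = sat (map_fm \<iota> \<phi>) [u, - v, v, u]"
      using \<phi> by (simp add: \<theta>_def not_le)
    moreover have "fm_below (\<theta> \<phi>) 1" by (simp add: \<theta>_def)
    ultimately show ?thesis using infinitesimal_sat[OF v] by (simp add: T_elem_def)
  qed
  show "q = mtp R (T_elem x y)"
    unfolding *(4) mtp_eq_iff using type[OF assms] type[OF *(2,3) circle] by blast
qed

lemma q0_exists: obtains x y where "positive_infinitesimal R y" "0 < x" "x\<^sup>2 + y\<^sup>2 = 1"
proof -
  obtain k where k: "infinite_elem R k" using infinite_exists .
  then have gt: "\<iota> r < k" for r unfolding infinite_elem_def by blast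
  have k0: "1 < k" using gt[of 1] by simp
  define y where "y = inverse k"
  have y: "0 < y" "y < 1" using k0 by (simp_all add: y_def inverse_less_1_iff)
  have "y < \<iota> r" if "0 < r" for r
  proof -
    have "inverse (\<iota> r) < k" using gt[of "inverse r"] by simp
    then have "inverse k < inverse (inverse (\<iota> r))" using that by (intro less_imp_inverse_less) simp_all
    then show ?thesis by (simp add: y_def)
  qed
  then have inf: "positive_infinitesimal R y" using y(1) by (auto simp: positive_infinitesimal_def)
  have "0 \<le> 1 - y\<^sup>2" using y by (simp add: power_le_one)
  then obtain z where z: "z\<^sup>2 = 1 - y\<^sup>2" using real_closed unfolding real_closed_def by blast
  have "y\<^sup>2 < 1" using y by (simp add: power_less_one_iff)
  then have "\<bar>z\<bar> \<noteq> 0" using z by auto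
  then show ?thesis using z by (intro that[OF inf, of "\<bar>z\<bar>"]) auto
qed

end

section \<open>Rotations times elements of H, and the limit description of \<open>r0\<close>\<close>

lemma entries_T_H:
  fixes x y b c :: "'a::linordered_field"
  shows "entries (T_elem x y ** H_elem b c) = [x * b, x * c - y * inverse b, y * b, y * c + x * inverse b]"
  by (simp add: entries_mult T_elem_def H_elem_def)

text \<open>Iwasawa versus LU decomposition: a rotation is a lower unipotent matrix times an element of H.\<close>

lemma rotation_lower:
  fixes x y b c :: "'a::linordered_field"
  assumes "x\<^sup>2 + y\<^sup>2 = 1" "x \<noteq> 0" "b \<noteq> 0"
  shows "entries (T_elem x y ** H_elem b c) = lower (y / x) (x * b) (x * c + (- y) / b)"
proof -
  have "y * (- y / b) / x + inverse (x * b) = (1 - y\<^sup>2) / (x * b)"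
    using assms by (simp add: field_simps power2_eq_square)
  also have "\<dots> = x * inverse b"
    using assms(2,3) by (simp flip: assms(1)) (simp add: field_simps power2_eq_square)
  finally show ?thesis
    using assms by (simp add: entries_T_H lower_def field_simps)
qed

text \<open>The rotation only rescales \<open>b\<close> and \<open>c\<close> and shifts
  \<open>c\<close> by a multiple of \<open>1 / b\<close>, which the limit does not see; what remains
  is the slope \<open>y / x\<close>.\<close>

lemma ev2_rotation:
  assumes "x\<^sup>2 + y\<^sup>2 = 1" "0 < x" "ev2 (\<lambda>b c. sat \<phi> (lower (y / x) b c))"
  shows "ev2 (\<lambda>b c. sat \<phi> (entries (T_elem x y ** H_elem b c)))"
proof -
  have "ev2 (\<lambda>b c. 0 < b \<and> sat \<phi> (lower (y / x) (x * b) (x * c + (- y) / b)))"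
    unfolding ev2_conj using ev2_gt(1)[of 0] ev2_affine[OF assms(3,2), of "- y"] by blast
  then show ?thesis
    by (rule ev2_mono) (use rotation_lower[OF assms(1)] assms(2) in auto)
qed

context saturated_extension
begin

lemma generic_mult:
  assumes "generic k l" "fm_below \<phi> 4"
  shows "sat (map_fm \<iota> \<phi>) (entries (emb g ** H_elem k l)) = ev2 (\<lambda>b c. sat \<phi> (entries (g ** H_elem b c)))"
proof -
  have "map_fm \<iota> (left_mult_fm g \<phi>) = left_mult_fm (emb g) (map_fm \<iota> \<phi>)"
    by (simp add: left_mult_fm_def)
  moreover have "sat (map_fm \<iota> (left_mult_fm g \<phi>)) (entries (H_elem k l)) =
     ev2 (\<lambda>b c. sat (left_mult_fm g \<phi>) (entries (H_elem b c)))"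
    using generic_H_elem[OF assms(1), of "left_mult_fm g \<phi>"] by (simp add: H_elem_def)
  ultimately show ?thesis using assms(2) by (simp add: sat_left_mult_fm)
qed

text \<open>Were \<phi> to fail at the product, it would fail at \<open>emb g ** H_elem k l\<close>
  for a real rotation \<open>g\<close> of small positive slope. Genericity turns that into failure
  of a limit over the reals, where \<phi> holds by the choice of \<open>e\<close>.\<close>

lemma q0_coheir_product:
  assumes g: "generic k l" and coh: "is_coheir R (R \<union> set (entries (H_elem k l))) (q0 R)
      (mtp (R \<union> set (entries (H_elem k l))) t)"
    and \<phi>: "fm_below \<phi> 4" "ev_lower \<phi>"
  shows "sat (map_fm \<iota> \<phi>) (entries (t ** H_elem k l))"
proof (rule ccontr)
  let ?h = "H_elem k l" and ?B = "R \<union> set (entries (H_elem k l))"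
  assume neg: "\<not> ?thesis"
  obtain x0 y0 where xy: "positive_infinitesimal R y0" "0 < x0" "x0\<^sup>2 + y0\<^sup>2 = 1"
    using q0_exists by blast
  have eq: "mtp R (T_elem x0 y0) = mtp R t"
    and fs: "\<And>\<psi>. \<psi> \<in> formulas ?B 4 \<Longrightarrow> sat \<psi> (entries t) \<Longrightarrow> \<exists>g. sat \<psi> (entries (emb g))"
    using coh unfolding q0_eq[OF xy] by (simp_all add: is_coheir_mtp)
  obtain e where e: "e > 0" "\<And>m. 0 < m \<Longrightarrow> m < e \<Longrightarrow> ev2 (\<lambda>b c. sat \<phi> (lower m b c))"
    using \<phi>(2) unfolding ev_lower_def eventually_at_right_field by blast
  \<comment> \<open>Rotations with slope strictly between 0 and \<open>e\<close>, expressed in the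
    four matrix entries.\<close>
  define \<rho> where "\<rho> = Conjs [Eq (Var 0) (Var 3), Eq (Plus (Var 1) (Var 2)) Zero,
    Eq (Plus (Times (Var 0) (Var 0)) (Times (Var 2) (Var 2))) One,
    Less Zero (Var 0), Less Zero (Var 2), Less (Var 2) (Times (Param e) (Var 0))]"
  have \<rho>4: "fm_below \<rho> 4" by (simp add: \<rho>_def)
  \<comment> \<open>The infinitesimal \<open>y0\<close> could reach \<open>e * x0\<close> only if
    \<open>x0\<close> were below 1/2; both squares would then be below 1/4, against the circle
    equation.\<close>
  have "y0 < \<iota> e * x0"
  proof (rule ccontr)
    assume "\<not> ?thesis"
    have two: "\<iota> 2 = 2" using \<iota>_add[of 1 1] by simp
    have small: "y0 < \<iota> d" if "0 < d" for d
      using xy(1) that unfolding positive_infinitesimal_def by simp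
    have y: "0 < y0" "y0 < 1 / 2" "2 * y0 < \<iota> e"
      using xy(1) small[of "1/2"] small[of "e/2"] e(1) by (simp_all add: positive_infinitesimal_def two)
    have "\<iota> e * (2 * x0) < \<iota> e * 1" using y(3) \<open>\<not> y0 < \<iota> e * x0\<close> by simp
    then have x: "x0 < 1 / 2" using e(1) by (simp only: mult_less_cancel_left_pos \<iota>_0_iff)
    have "x0\<^sup>2 < (1 / 2)\<^sup>2" "y0\<^sup>2 < (1 / 2)\<^sup>2" using x y xy(2) by (auto intro!: power_strict_mono)
    then show False using xy(3) by (simp add: power2_eq_square)
  qed
  then have "sat (map_fm \<iota> \<rho>) (entries (T_elem x0 y0))"
    using xy unfolding positive_infinitesimal_def by (simp add: \<rho>_def T_elem_def not_le power2_eq_square)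
  then have "sat (map_fm \<iota> \<rho>) (entries t)" using eq \<rho>4 unfolding mtp_eq_iff by blast
  then have "sat (Conj (Neg (right_mult_fm ?h (map_fm \<iota> \<phi>))) (map_fm \<iota> \<rho>)) (entries t)"
    using neg \<phi>(1) by (simp add: sat_right_mult_fm)
  moreover have "Conj (Neg (right_mult_fm ?h (map_fm \<iota> \<phi>))) (map_fm \<iota> \<rho>) \<in> formulas ?B 4"
    using fm_params_right_mult_fm[of ?h "map_fm \<iota> \<phi>"] \<rho>4 by (auto simp: formulas_def fm.set_map)
  ultimately obtain g where gs: "sat (Conj (Neg (right_mult_fm ?h (map_fm \<iota> \<phi>))) (map_fm \<iota> \<rho>)) (entries (emb g))"
    using fs by blast
  have "sat \<rho> (entries g)" using gs \<rho>4 by (simp add: transfer_entries)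
  moreover have "sat \<rho> (entries g) \<longleftrightarrow> g$1$1 = g$2$2 \<and> g$1$2 = - (g$2$1) \<and> (g$1$1)\<^sup>2 + (g$2$1)\<^sup>2 = 1 \<and>
     0 < g$1$1 \<and> 0 < g$2$1 \<and> g$2$1 < e * g$1$1"
    by (simp add: \<rho>_def entries_def not_le power2_eq_square add_eq_0_iff2)
  ultimately have r: "g$1$1 = g$2$2" "g$1$2 = - (g$2$1)" "(g$1$1)\<^sup>2 + (g$2$1)\<^sup>2 = 1"
    "0 < g$1$1" "0 < g$2$1" "g$2$1 < e * g$1$1"
    by blast+
  have gT: "g = T_elem (g$1$1) (g$2$1)"
    using r by (simp add: T_elem_def vec_eq_iff forall_2)
  have "ev2 (\<lambda>b c. sat \<phi> (lower (g$2$1 / g$1$1) b c))"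
    using r by (intro e(2)) (simp_all add: field_simps)
  then have "ev2 (\<lambda>b c. sat \<phi> (entries (g ** H_elem b c)))"
    using ev2_rotation[OF r(3,4)] gT by metis
  moreover have "\<not> sat (map_fm \<iota> \<phi>) (entries (emb g ** ?h))"
    using gs \<phi>(1) by (simp add: sat_right_mult_fm)
  ultimately show False using generic_mult[OF g \<phi>(1)] by blast
qed

lemma q0_coheir_type:
  assumes "generic k l" and "is_coheir R (R \<union> set (entries (H_elem k l))) (q0 R)
      (mtp (R \<union> set (entries (H_elem k l))) t)"
  shows "mtp R (t ** H_elem k l) = map_fm \<iota> ` {\<phi>. fm_below \<phi> 4 \<and> ev_lower \<phi>}"
  unfolding mtp_eq_image_iff
proof (intro allI impI)
  fix \<phi> :: "real fm" assume \<phi>: "fm_below \<phi> 4"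
  show "sat (map_fm \<iota> \<phi>) (entries (t ** H_elem k l)) = ev_lower \<phi>"
  proof (cases "ev_lower \<phi>")
    case True
    then show ?thesis using q0_coheir_product[OF assms \<phi>] by blast
  next
    case False
    then have "ev_lower (Neg \<phi>)" using ev_lower_Neg[OF \<phi>] by blast
    then show ?thesis using q0_coheir_product[OF assms, of "Neg \<phi>"] False \<phi> by simp
  qed
qed

text \<open>All admissible choices of \<open>h\<close> and \<open>t\<close> give the limit type.
  That some choice exists also requires the realized coheir to lie in T, which holds because the
  equations of T belong to \<open>q0\<close>.\<close>

lemma r0_eq: "r0 R = map_fm \<iota> ` {\<phi>. fm_below \<phi> 4 \<and> ev_lower \<phi>}" (is ?eq)
  and r0_realized: "\<exists>a\<in>SL2. mtp R a = r0 R" (is ?ex)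
proof -
  let ?R0 = "map_fm \<iota> ` {\<phi>. fm_below \<phi> 4 \<and> ev_lower \<phi>}"
  obtain k l where g: "generic k l" using generic_exists by blast
  let ?h = "H_elem k l"
  have h: "?h \<in> H" using generic_pos[OF g] by (simp add: H_elem_in_H)
  obtain x y where xy: "positive_infinitesimal R y" "0 < x" "x\<^sup>2 + y\<^sup>2 = 1"
    using q0_exists by blast
  obtain t where t: "is_coheir R (R \<union> set (entries ?h)) (q0 R) (mtp (R \<union> set (entries ?h)) t)"
    unfolding q0_eq[OF xy] using coheir_exists[of "set (entries ?h)" "T_elem x y"] by blast
  then have eq: "mtp R (T_elem x y) = mtp R t" unfolding q0_eq[OF xy] by (simp add: is_coheir_mtp)
  define \<rho> where "\<rho> = Conjs [Eq (Var 0) (Var 3), Eq (Plus (Var 1) (Var 2)) (Zero :: real tm),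
    Eq (Plus (Times (Var 0) (Var 0)) (Times (Var 2) (Var 2))) One]"
  have \<rho>: "sat (map_fm \<iota> \<rho>) (entries g) \<longleftrightarrow> g$1$1 = g$2$2 \<and> g$1$2 = - (g$2$1) \<and> (g$1$1)\<^sup>2 + (g$2$1)\<^sup>2 = 1" for g
    by (simp add: \<rho>_def entries_def power2_eq_square add_eq_0_iff2)
  have "sat (map_fm \<iota> \<rho>) (entries (T_elem x y))" using xy(3) unfolding \<rho> by (simp add: T_elem_def)
  moreover have "fm_below \<rho> 4" by (simp add: \<rho>_def)
  ultimately have "sat (map_fm \<iota> \<rho>) (entries t)" using eq unfolding mtp_eq_iff by blast
  then have r: "t$1$1 = t$2$2" "t$1$2 = - (t$2$1)" "(t$1$1)\<^sup>2 + (t$2$1)\<^sup>2 = 1"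
    unfolding \<rho> by blast+
  then have "t = T_elem (t$1$1) (t$2$1)" by (simp add: T_elem_def vec_eq_iff forall_2)
  then have tT: "t \<in> T" using r(3) unfolding T_def by blast
  have all: "r = ?R0" if r: "\<exists>h\<in>H. \<exists>t\<in>T. mtp R h = p0 R \<and>
     (let B = R \<union> set (entries h) in is_coheir R B (q0 R) (mtp B t)) \<and>
     r = mtp R (t ** h)" for r
  proof -
    obtain h t where *: "h \<in> H" "mtp R h = p0 R"
      "is_coheir R (R \<union> set (entries h)) (q0 R) (mtp (R \<union> set (entries h)) t)"
      "r = mtp R (t ** h)" using r unfolding Let_def by blast
    obtain k l where "h = H_elem k l" "generic k l" using p0_generic[OF *(1,2)] .
    then show ?thesis using q0_coheir_type * by blast
  qed
  show ?eq
    unfolding r0_def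
  proof (rule the_equality)
    show "\<exists>h\<in>H. \<exists>t\<in>T. mtp R h = p0 R \<and>
     (let B = R \<union> set (entries h) in is_coheir R B (q0 R) (mtp B t)) \<and>
     ?R0 = mtp R (t ** h)"
      unfolding Let_def
      by (intro bexI[OF _ h] bexI[OF _ tT] conjI generic_p0[OF g] t q0_coheir_type[OF g t, symmetric])
  qed (rule all)
  then have "mtp R (t ** ?h) = r0 R" using q0_coheir_type[OF g t] by simp
  moreover have "t ** ?h \<in> SL2"
    using r generic_pos[OF g] by (intro SL2_mult) (simp_all add: SL2_iff H_elem_def power2_eq_square)
  ultimately show ?ex by blast
qed

lemma r0_sat:
  assumes "mtp R a = r0 R" "fm_below \<phi> 4"
  shows "sat (map_fm \<iota> \<phi>) (entries a) \<longleftrightarrow> ev_lower \<phi>"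
  using assms unfolding r0_eq mtp_eq_image_iff by blast

end

section \<open>Finite boundaries and standard parts\<close>

text \<open>A fixed number \<open>N\<close> of points turns a finite boundary into a formula. Under
  the quantifiers \<open>Var 0\<close> and \<open>Var 1\<close> are the interval ends, the next
  \<open>N\<close> variables the points, and the last two the parameters.\<close>

definition boundary_fm :: "nat \<Rightarrow> 'c fm \<Rightarrow> 'c fm" where
  "boundary_fm N \<psi> = Exis N (Forall (Forall (Imp
     (Conj (Less (Var 0) (Var 1))
        (Conjs (map (\<lambda>i. Neg (Conj (Leq (Var 0) (Var (Suc (Suc i)))) (Leq (Var (Suc (Suc i))) (Var 1)))) [0..<N])))
     (Conj (Imp (subst_fm \<psi> [Var 0, Var (Suc (Suc N)), Var (Suc (Suc (Suc N)))])
             (subst_fm \<psi> [Var 1, Var (Suc (Suc N)), Var (Suc (Suc (Suc N)))]))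
           (Imp (subst_fm \<psi> [Var 1, Var (Suc (Suc N)), Var (Suc (Suc (Suc N)))])
             (subst_fm \<psi> [Var 0, Var (Suc (Suc N)), Var (Suc (Suc (Suc N)))]))))))"

text \<open>The meaning of \<open>Leq\<close> is an assumption, so that the same statement serves
  the reals and the extension.\<close>

lemma sat_boundary_fm:
  assumes "fm_below \<psi> 3" and Leq: "\<And>s t as. sat (Leq s t) as \<longleftrightarrow> tm_val as s \<le> tm_val as (t :: 'a tm)"
  shows "sat (boundary_fm N \<psi>) [k, l] \<longleftrightarrow> (\<exists>zs. length zs = N \<and> (\<forall>u v. u < v \<and> set zs \<inter> {u..v} = {} \<longrightarrow>
     sat \<psi> [u, k, l] = sat \<psi> [v, k, l :: 'a :: linordered_field]))"
proof -
  have nth: "(zs @ [k, l]) ! length zs = k" "(zs @ [k, l]) ! Suc (length zs) = l" for zs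
    by (simp_all add: nth_append)
  have "(\<forall>i\<in>{0..<length zs}. \<not> (u \<le> (zs @ [k, l]) ! i \<and> (zs @ [k, l]) ! i \<le> v)) \<longleftrightarrow> set zs \<inter> {u..v} = {}" for u v zs
  proof -
    have "(\<forall>i\<in>{0..<length zs}. \<not> (u \<le> (zs @ [k, l]) ! i \<and> (zs @ [k, l]) ! i \<le> v)) \<longleftrightarrow>
        (\<forall>z\<in>set zs. \<not> (u \<le> z \<and> z \<le> v))"
      by (auto simp: nth_append all_set_conv_all_nth)
    then show ?thesis by auto
  qed
  note set = this
  have eq: "(\<forall>x xa. xa < x \<and> set zs \<inter> {xa..x} = {} \<longrightarrow> (P xa \<longrightarrow> P x) \<and> (P x \<longrightarrow> P xa)) \<longleftrightarrow>
    (\<forall>u v. u < v \<and> set zs \<inter> {u..v} = {} \<longrightarrow> P u = P v)" for P zs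
    by blast
  have "sat (boundary_fm N \<psi>) [k, l] \<longleftrightarrow> (\<exists>zs. length zs = N \<and> (\<forall>v u. u < v \<and>
     (\<forall>i\<in>{0..<length zs}. \<not> (u \<le> (zs @ [k, l]) ! i \<and> (zs @ [k, l]) ! i \<le> v)) \<longrightarrow>
     (sat \<psi> [u, k, l] \<longrightarrow> sat \<psi> [v, k, l]) \<and> (sat \<psi> [v, k, l] \<longrightarrow> sat \<psi> [u, k, l])))"
    unfolding boundary_fm_def sat_Exis
    by (rule arg_cong[of _ _ Ex], rule ext) (use assms(1) nth in \<open>auto simp: Leq not_le\<close>)
  then show ?thesis unfolding set eq .
qed

context saturated_extension
begin

text \<open>The uniform bound over the reals makes finiteness of the boundary a sentence, and this
  sentence transfers.\<close>

lemma finite_boundary: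
  assumes "fm_below \<psi> 3"
  obtains Z where "finite Z" "\<And>u v. u < v \<Longrightarrow> Z \<inter> {u..v} = {} \<Longrightarrow>
    sat (map_fm \<iota> \<psi>) [u, k, l] = sat (map_fm \<iota> \<psi>) [v, k, l]"
proof -
  obtain N where N: "\<And>as. \<exists>Z. finite Z \<and> card Z \<le> N \<and>
    (\<forall>u v. u < v \<and> Z \<inter> {u..v} = {} \<longrightarrow> sat \<psi> (u # as) = sat \<psi> (v # as))"
    using uniform_boundary[of \<psi>] by blast
  have "sat (boundary_fm N \<psi>) [k, l]" for k l
  proof -
    obtain Z where Z: "finite Z" "card Z \<le> N"
      "\<And>u v. u < v \<Longrightarrow> Z \<inter> {u..v} = {} \<Longrightarrow> sat \<psi> [u, k, l] = sat \<psi> [v, k, l]"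
      using N[of "[k, l]"] by auto
    obtain xs where xs: "set xs = Z" "distinct xs" using finite_distinct_list[OF Z(1)] by blast
    then have "length xs \<le> N" using Z(2) distinct_card by metis
    then have "length (xs @ replicate (N - length xs) 0) = N" by simp
    moreover have "Z \<subseteq> set (xs @ replicate (N - length xs) 0)" using xs by auto
    ultimately show ?thesis
      unfolding sat_boundary_fm[OF assms sat_Leq_real]
      using Z(3) by (intro exI[of _ "xs @ replicate (N - length xs) 0"]) blast
  qed
  moreover have "fm_below (boundary_fm N \<psi>) 2"
    by (auto simp: boundary_fm_def)
  ultimately have "sat (map_fm \<iota> (Forall (Forall (boundary_fm N \<psi>)))) []"
    by (intro transfer_sentence) simp_all
  moreover have "map_fm \<iota> (boundary_fm N \<psi>) = boundary_fm N (map_fm \<iota> \<psi>)"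
    by (simp add: boundary_fm_def comp_def)
  ultimately have "sat (boundary_fm N (map_fm \<iota> \<psi>)) [k, l]" by simp
  then obtain zs where "\<forall>u v. u < v \<and> set zs \<inter> {u..v} = {} \<longrightarrow>
     sat (map_fm \<iota> \<psi>) [u, k, l] = sat (map_fm \<iota> \<psi>) [v, k, l]"
    using sat_boundary_fm[of "map_fm \<iota> \<psi>" N k l] assms sat_Leq by auto
  then show ?thesis by (intro that[of "set zs"]) auto
qed

section \<open>Standard parts\<close>

text \<open>The real \<open>r\<close> is the standard part of \<open>x\<close>; a relation, since
  unbounded elements have none.\<close>

definition near :: "'k \<Rightarrow> real \<Rightarrow> bool" where
  "near x r \<longleftrightarrow> (\<forall>d>0. \<bar>x - \<iota> r\<bar> < \<iota> d)"

text \<open>The standard part is the supremum of the reals below \<open>x\<close>; completeness of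
  the reals enters here.\<close>

lemma near_exists:
  assumes "\<bar>x\<bar> \<le> \<iota> M"
  obtains r where "near x r"
proof -
  define S where "S = {r. \<iota> r \<le> x}"
  have x: "- \<iota> M \<le> x" "x \<le> \<iota> M" using assms by (simp_all add: abs_le_iff)
  have ne: "- M \<in> S" using x by (simp add: S_def)
  have le: "s \<le> M" if "s \<in> S" for s
    using that x(2) by (metis S_def \<iota>_le mem_Collect_eq order_trans)
  have bdd: "bdd_above S" using le by (rule bdd_aboveI)
  have "\<bar>x - \<iota> (Sup S)\<bar> < \<iota> d" if "d > 0" for d
  proof -
    have "Sup S + d / 2 \<notin> S"
    proof
      assume "Sup S + d / 2 \<in> S"
      then have "Sup S + d / 2 \<le> Sup S" using bdd by (rule cSup_upper)
      then show False using that by simp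
    qed
    then have "x < \<iota> (Sup S + d / 2)" by (simp add: S_def not_le)
    also have "\<dots> < \<iota> (Sup S + d)" unfolding \<iota>_less using that by simp
    finally have 1: "x - \<iota> (Sup S) < \<iota> d" by (simp add: algebra_simps)
    obtain s where s: "s \<in> S" "Sup S - d < s"
      using less_cSupD[of S "Sup S - d"] ne \<open>d > 0\<close> by auto
    have "\<iota> (Sup S - d) < \<iota> s" using s(2) by (simp only: \<iota>_less)
    also have "\<dots> \<le> x" using s(1) by (simp add: S_def)
    finally have "\<iota> (Sup S) - x < \<iota> d" by (simp add: algebra_simps)
    with 1 show ?thesis by (simp add: abs_less_iff)
  qed
  then show ?thesis by (intro that[of "Sup S"]) (simp add: near_def)
qed

lemma near_add: "near x r \<Longrightarrow> near y s \<Longrightarrow> near (x + y) (r + s)"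
  unfolding near_def
proof (intro allI impI)
  fix d :: real assume *: "\<forall>d>0. \<bar>x - \<iota> r\<bar> < \<iota> d" "\<forall>d>0. \<bar>y - \<iota> s\<bar> < \<iota> d" "d > 0"
  have "\<bar>x - \<iota> r\<bar> < \<iota> (d / 2)" "\<bar>y - \<iota> s\<bar> < \<iota> (d / 2)" using * by (meson half_gt_zero)+
  then have "\<bar>x - \<iota> r\<bar> + \<bar>y - \<iota> s\<bar> < \<iota> (d / 2 + d / 2)" unfolding \<iota>_add by (rule add_strict_mono)
  moreover have "\<bar>x + y - \<iota> (r + s)\<bar> \<le> \<bar>x - \<iota> r\<bar> + \<bar>y - \<iota> s\<bar>"
    using abs_triangle_ineq[of "x - \<iota> r" "y - \<iota> s"] by (simp add: algebra_simps)
  ultimately show "\<bar>x + y - \<iota> (r + s)\<bar> < \<iota> d" by (simp only: field_sum_of_halves)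
qed

lemma near_scale:
  assumes "near x r"
  shows "near (\<iota> a * x) (a * r)"
  unfolding near_def
proof (intro allI impI)
  fix d :: real assume d: "d > 0"
  show "\<bar>\<iota> a * x - \<iota> (a * r)\<bar> < \<iota> d"
  proof (cases "a = 0")
    case True
    then show ?thesis using d by simp
  next
    case False
    have "\<iota> \<bar>a\<bar> = \<bar>\<iota> a\<bar>" by (simp add: abs_if)
    moreover have "\<bar>x - \<iota> r\<bar> < \<iota> (d / \<bar>a\<bar>)" using assms d False by (simp add: near_def del: \<iota>_divide)
    then have "\<iota> \<bar>a\<bar> * \<bar>x - \<iota> r\<bar> < \<iota> \<bar>a\<bar> * \<iota> (d / \<bar>a\<bar>)" using False by (intro mult_strict_left_mono) simp_all
    moreover have "\<iota> \<bar>a\<bar> * \<iota> (d / \<bar>a\<bar>) = \<iota> d" using False by (simp flip: \<iota>_mult del: \<iota>_divide)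
    ultimately show ?thesis by (simp add: abs_mult flip: right_diff_distrib)
  qed
qed

lemma near_gt: "near x r \<Longrightarrow> s < r \<Longrightarrow> \<iota> s < x"
  using allE[of "\<lambda>d. d > 0 \<longrightarrow> \<bar>x - \<iota> r\<bar> < \<iota> d" "r - s"] by (auto simp: near_def abs_less_iff)

lemma near_lt: "near x r \<Longrightarrow> r < s \<Longrightarrow> x < \<iota> s"
  using allE[of "\<lambda>d. d > 0 \<longrightarrow> \<bar>x - \<iota> r\<bar> < \<iota> d" "s - r"] by (auto simp: near_def abs_less_iff)

lemma near_unique: "near x r \<Longrightarrow> near x s \<Longrightarrow> r = s"
  using near_gt[of x] near_lt[of x] dense[of r s] dense[of s r] by (metis less_asym linorder_less_linear)

lemma sat_map_lower_fm:
  "fm_below \<phi> 4 \<Longrightarrow> b \<noteq> 0 \<Longrightarrow> sat (map_fm \<iota> (lower_fm \<phi>)) [c, b, m] \<longleftrightarrow> sat (map_fm \<iota> \<phi>) (lower m b c)"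
  by (simp add: lower_fm_def lower_def mult_eq_1_iff_inverse)

text \<open>
  The finitely many standard parts of boundary points are avoided by all small positive reals, so a
  formula of the type \<open>r\<^sub>0\<close> holds on whole monads, uniformly in the generic pair.
\<close>

lemma ev_lower_near:
  assumes \<phi>: "fm_below \<phi> 4" "ev_lower \<phi>"
  shows "\<forall>\<^sub>F r in at_right 0. \<forall>k l m. generic k l \<longrightarrow> near m r \<longrightarrow> sat (map_fm \<iota> \<phi>) (lower m k l)"
proof -
  \<comment> \<open>The boundary depends on the pair, so one generic pair is fixed first and its
    role is removed at the end.\<close>
  obtain k0 l0 where g0: "generic k0 l0" using generic_exists by blast
  define \<psi> where "\<psi> = subst_fm (lower_fm \<phi>) [Var 2, Var 1, Var 0]"
  have \<psi>3: "fm_below \<psi> 3" by (simp add: \<psi>_def)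
  have \<psi>: "sat (map_fm \<iota> \<psi>) [m, k, l] \<longleftrightarrow> sat (map_fm \<iota> \<phi>) (lower m k l)" if "generic k l" for m k l
    using generic_pos[OF that] \<phi>(1) by (simp add: \<psi>_def sat_map_lower_fm)
  obtain Z where Z: "finite Z" "\<And>u v. u < v \<Longrightarrow> Z \<inter> {u..v} = {} \<Longrightarrow>
    sat (map_fm \<iota> \<psi>) [u, k0, l0] = sat (map_fm \<iota> \<psi>) [v, k0, l0]"
    using finite_boundary[OF \<psi>3] by blast
  \<comment> \<open>A point has at most one standard part, so it excludes at most one real.\<close>
  have "\<forall>\<^sub>F r in at_right 0. \<not> near z r" for z
  proof (cases "\<exists>r>0. near z r")
    case True
    then obtain r0 where "r0 > 0" "near z r0" by blast
    have "\<not> near z r" if "r \<in> {0<..<r0}" for r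
      using near_unique[OF \<open>near z r0\<close>, of r] that by auto
    then show ?thesis by (rule eventually_mono[OF eventually_at_right_real[OF \<open>r0 > 0\<close>]])
  next
    case False
    then have "\<not> near z r" if "0 < r" for r using that by blast
    then show ?thesis by (rule eventually_mono[OF eventually_at_right_less])
  qed
  then have "\<forall>\<^sub>F r in at_right 0. \<forall>z\<in>Z. \<not> near z r" by (intro eventually_ball_finite[OF Z(1)]) auto
  then show ?thesis
    using \<phi>(2)[unfolded ev_lower_def]
  proof eventually_elim
    case (elim r)
    \<comment> \<open>Finitely many points, none infinitely close to \<open>r\<close>, stay at a
      common real distance \<open>d\<close> from it.\<close>
    have "\<forall>\<^sub>F d in at_right 0. \<not> \<bar>z - \<iota> r\<bar> < \<iota> d" if "z \<in> Z" for z
    proof -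
      have "\<not> near z r" using elim that by blast
      then obtain d0 where d0: "d0 > 0" "\<iota> d0 \<le> \<bar>z - \<iota> r\<bar>" by (auto simp: near_def not_less)
      have "\<not> \<bar>z - \<iota> r\<bar> < \<iota> d" if "d < d0" for d
      proof -
        have "\<iota> d < \<iota> d0" using that by simp
        then show ?thesis using d0(2) by linarith
      qed
      then show ?thesis
        by (intro eventually_mono[OF eventually_at_right_real[OF d0(1)]]) simp
    qed
    then have "\<forall>\<^sub>F d in at_right 0. \<forall>z\<in>Z. \<not> \<bar>z - \<iota> r\<bar> < \<iota> d"
      by (intro eventually_ball_finite[OF Z(1)]) blast
    with eventually_at_right_less[of "0::real"]
    have "\<forall>\<^sub>F d in at_right 0. 0 < d \<and> (\<forall>z\<in>Z. \<not> \<bar>z - \<iota> r\<bar> < \<iota> d)" by (rule eventually_conj)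
    then obtain d where d: "d > 0" "\<And>z. z \<in> Z \<Longrightarrow> \<not> \<bar>z - \<iota> r\<bar> < \<iota> d"
      using eventually_happens'[OF trivial_limit_at_right_real] by blast
    have r: "sat (map_fm \<iota> \<psi>) [\<iota> r, k0, l0]"
      using elim(2) by (simp add: \<psi>[OF g0] generic_lower[OF g0 \<phi>(1)])
    have m: "sat (map_fm \<iota> \<psi>) [m, k0, l0]" if "\<iota> (r - d) < m" "m < \<iota> (r + d)" for m
    proof -
      have ab: "\<bar>z - \<iota> r\<bar> < \<iota> d" if "\<iota> (r - d) < z" "z < \<iota> (r + d)" for z
        using that by (simp add: abs_less_iff algebra_simps)
      then have avoid: "z \<notin> Z" if "\<iota> (r - d) < z" "z < \<iota> (r + d)" for z
        using that d(2) by blast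
      have rr: "\<iota> (r - d) < \<iota> r" "\<iota> r < \<iota> (r + d)" unfolding \<iota>_less using d(1) by simp_all
      consider "m < \<iota> r" | "m = \<iota> r" | "\<iota> r < m" by linarith
      then show ?thesis
      proof cases
        case 1
        have "Z \<inter> {m..\<iota> r} = {}"
          using avoid less_le_trans[OF that(1)] le_less_trans[OF _ rr(2)] by (metis atLeastAtMost_iff disjoint_iff)
        then show ?thesis using Z(2)[OF 1] r by simp
      next
        case 3
        have "Z \<inter> {\<iota> r..m} = {}"
          using avoid less_le_trans[OF rr(1)] le_less_trans[OF _ that(2)] by (metis atLeastAtMost_iff disjoint_iff)
        then show ?thesis using Z(2)[OF 3] r by simp
      qed (use r in simp)
    qed
    \<comment> \<open>The interval has real end points, so this is a formula over \<open>R\<close>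
      about the pair alone and passes from \<open>(k0, l0)\<close> to every generic pair.\<close>
    define \<Theta> where "\<Theta> = Forall (Imp (Conj (Less (Param (r - d)) (Var 0)) (Less (Var 0) (Param (r + d)))) \<psi>)"
    have \<Theta>2: "fm_below \<Theta> 2" using \<psi>3 by (simp add: \<Theta>_def)
    have \<Theta>: "sat (map_fm \<iota> \<Theta>) [k, l] \<longleftrightarrow> (\<forall>m. \<iota> (r - d) < m \<and> m < \<iota> (r + d) \<longrightarrow> sat (map_fm \<iota> \<psi>) [m, k, l])" for k l
      unfolding \<Theta>_def by (simp add: not_le del: \<iota>_add \<iota>_diff)
    show ?case
    proof (intro allI impI)
      fix k l m assume g: "generic k l" and nr: "near m r"
      have "sat (map_fm \<iota> \<Theta>) [k0, l0]" using m unfolding \<Theta> by blast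
      then have "sat (map_fm \<iota> \<Theta>) [k, l]" using generic_sat[OF g0 \<Theta>2] generic_sat[OF g \<Theta>2] by simp
      moreover have "\<iota> (r - d) < m" "m < \<iota> (r + d)" using near_gt[OF nr, of "r - d"] near_lt[OF nr, of "r + d"] d(1) by simp_all
      ultimately show "sat (map_fm \<iota> \<phi>) (lower m k l)" unfolding \<Theta> \<psi>[OF g] by blast
    qed
  qed
qed

end

section \<open>Products with coheirs of r0\<close>

definition row_fm :: "'a::comm_ring_1 \<Rightarrow> 'a \<Rightarrow> 'a fm \<Rightarrow> 'a fm" where
  "row_fm \<alpha> \<beta> \<phi> = subst_fm \<phi> [Plus (Times (Param \<alpha>) (Var 0)) (Times (Param \<beta>) (Var 2)),
     Plus (Times (Param \<alpha>) (Var 1)) (Times (Param \<beta>) (Var 3))]"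

lemma sat_row_fm:
  "fm_below \<phi> 2 \<Longrightarrow> sat (row_fm \<alpha> \<beta> \<phi>) (entries g) =
     sat \<phi> [\<alpha> * g$1$1 + \<beta> * g$2$1, \<alpha> * g$1$2 + \<beta> * g$2$2]"
  by (simp add: row_fm_def) (simp add: entries_def)

lemma fm_below_row_fm [simp]: "fm_below (row_fm \<alpha> \<beta> \<phi>) 4"
  by (simp add: row_fm_def)

lemma lower_entries: "lower m b c = entries (mat22 b c (m * b) (m * c + inverse b :: 'a :: field))"
  by (simp add: lower_def)

text \<open>
  The direction \<open>(\<omega>\<^sub>1, \<omega>\<^sub>2)\<close> is mapped close to the positive first axis.
\<close>

definition direction_fm :: "real \<Rightarrow> real \<Rightarrow> real \<Rightarrow> real fm" where
  "direction_fm \<omega>1 \<omega>2 \<epsilon> =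
     (let X = Plus (Times (Param \<omega>1) (Var 0)) (Times (Param \<omega>2) (Var 1));
          Y = Plus (Times (Param \<omega>1) (Var 2)) (Times (Param \<omega>2) (Var 3))
      in Conjs [SL2_fm, Less Zero X, Less Zero Y, Less Y (Times (Param \<epsilon>) X)])"

lemma sat_direction_fm:
  "sat (direction_fm \<omega>1 \<omega>2 \<epsilon>) (entries g) \<longleftrightarrow> g \<in> SL2 \<and> 0 < \<omega>1 * g$1$1 + \<omega>2 * g$1$2 \<and>
     0 < \<omega>1 * g$2$1 + \<omega>2 * g$2$2 \<and> \<omega>1 * g$2$1 + \<omega>2 * g$2$2 < \<epsilon> * (\<omega>1 * g$1$1 + \<omega>2 * g$1$2)"
  by (simp add: direction_fm_def Let_def not_le) (simp add: entries_def)

lemma fm_below_direction_fm [simp]: "fm_below (direction_fm \<omega>1 \<omega>2 \<epsilon>) 4"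
  by (simp add: direction_fm_def Let_def)

text \<open>The linear form tends to plus infinity along \<open>ev2\<close> exactly for these
  coefficients: \<open>c\<close> dominates \<open>b\<close>, whence the lexicographic order with the
  second coordinate first.\<close>

definition positive_direction :: "real \<Rightarrow> real \<Rightarrow> bool" where
  "positive_direction \<omega>1 \<omega>2 \<longleftrightarrow> 0 < \<omega>2 \<or> \<omega>2 = 0 \<and> 0 < \<omega>1"

lemma ev2_linear_gt:
  assumes "positive_direction \<omega>1 \<omega>2"
  shows "ev2 (\<lambda>b c. M < \<omega>1 * b + \<omega>2 * c)"
  using assms unfolding positive_direction_def
proof (elim disjE conjE)
  assume "0 < \<omega>2"
  have "\<forall>\<^sub>F c in at_top. M < \<omega>1 * b + \<omega>2 * c" for b
    by (rule eventually_mono[OF eventually_gt_at_top[of "(M - \<omega>1 * b) / \<omega>2"]])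
       (use \<open>0 < \<omega>2\<close> in \<open>simp add: field_simps\<close>)
  then show ?thesis by (simp add: ev2_def)
next
  assume "\<omega>2 = 0" "0 < \<omega>1"
  then show ?thesis
    using ev2_gt(1)[of "M / \<omega>1"] by (simp add: field_simps)
qed

lemma ev_lower_direction:
  assumes pos: "positive_direction \<omega>1 \<omega>2" and "0 < \<epsilon>"
  shows "ev_lower (direction_fm \<omega>1 \<omega>2 \<epsilon>)"
proof -
  have "ev2 (\<lambda>b c. sat (direction_fm \<omega>1 \<omega>2 \<epsilon>) (lower m b c))" if m: "0 < m" "m < \<epsilon> / 2" for m
  proof -
    have "0 \<le> \<omega>2" using pos by (auto simp: positive_direction_def)
    \<comment> \<open>Writing \<open>X\<close> for the linear form, the image has second coordinate
      \<open>m * X + \<omega>2 / b\<close>. The bound on \<open>m\<close> keeps the first summand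
      below half of \<open>\<epsilon> * X\<close>, the threshold for \<open>X\<close> does so for
      the second; the added 1 ensures \<open>0 < X\<close>.\<close>
    have "ev2 (\<lambda>b c. 1 < b \<and> 2 * \<omega>2 / \<epsilon> + 1 < \<omega>1 * b + \<omega>2 * c)"
      unfolding ev2_conj using ev2_gt(1)[of 1] ev2_linear_gt[OF pos] by blast
    then show ?thesis
    proof (rule ev2_mono)
      fix b c :: real assume *: "1 < b \<and> 2 * \<omega>2 / \<epsilon> + 1 < \<omega>1 * b + \<omega>2 * c"
      define X where "X = \<omega>1 * b + \<omega>2 * c"
      have X: "0 < X" "2 * \<omega>2 < \<epsilon> * X"
      proof -
        have "0 \<le> 2 * \<omega>2 / \<epsilon>" using \<open>0 \<le> \<omega>2\<close> \<open>0 < \<epsilon>\<close> by simp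
        then show "0 < X" using * unfolding X_def by linarith
        have "2 * \<omega>2 / \<epsilon> < X" using * unfolding X_def by linarith
        then show "2 * \<omega>2 < \<epsilon> * X" using \<open>0 < \<epsilon>\<close> by (simp add: field_simps)
      qed
      have b: "0 \<le> \<omega>2 * inverse b" "\<omega>2 * inverse b \<le> \<omega>2"
        using \<open>0 \<le> \<omega>2\<close> * by (auto intro!: mult_left_le simp: inverse_le_1_iff)
      have Y: "\<omega>1 * (m * b) + \<omega>2 * (m * c + inverse b) = m * X + \<omega>2 * inverse b"
        by (simp add: X_def algebra_simps)
      have "0 < m * X" using m X by simp
      have "m * X < \<epsilon> * X / 2" using mult_strict_right_mono[OF m(2) X(1)] by (simp only: times_divide_eq_left)
      then have "m * X + \<omega>2 * inverse b < \<epsilon> * X" using b X by linarith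
      then show "sat (direction_fm \<omega>1 \<omega>2 \<epsilon>) (lower m b c)"
        using * X \<open>0 < m * X\<close> b
        unfolding lower_entries sat_direction_fm SL2_iff mat22_nth Y X_def[symmetric]
        by (simp add: algebra_simps)
    qed
  qed
  then show ?thesis
    unfolding ev_lower_def using \<open>0 < \<epsilon>\<close>
    by (intro eventually_mono[OF eventually_at_right_real[of 0 "\<epsilon> / 2"]]) auto
qed

context saturated_extension
begin

text \<open>
  The closed invariant set of types all of whose real row combinations are generic up to sign; it
  contains the orbit closure of \<open>r\<^sub>0\<close>.
\<close>

definition generic_rows :: "'k^2^2 \<Rightarrow> bool" where
  "generic_rows b \<longleftrightarrow> b \<in> SL2 \<and> (\<forall>\<alpha> \<beta>. (\<alpha>, \<beta>) \<noteq> (0, 0) \<longrightarrow>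
     (let k = \<iota> \<alpha> * b$1$1 + \<iota> \<beta> * b$2$1; l = \<iota> \<alpha> * b$1$2 + \<iota> \<beta> * b$2$2
      in generic k l \<or> generic (- k) (- l)))"

text \<open>If neither sign were generic, two formulas witness it at \<open>b\<close>, and a real
  translate of \<open>a0\<close> would fail both. There the row combination has the limit form
  \<open>(e * b, e * c + \<beta>' / b)\<close>, and the sign of \<open>e\<close> decides which of
  the two formulas holds after all.\<close>

lemma generic_rows_closure:
  assumes b: "b \<in> SL2" and a0: "mtp R a0 = r0 R"
    and closure: "\<And>\<phi>. fm_below \<phi> 4 \<Longrightarrow> sat (map_fm \<iota> \<phi>) (entries b) \<Longrightarrow>
      \<exists>g\<in>SL2. sat (map_fm \<iota> \<phi>) (entries (emb g ** a0))"
  shows "generic_rows b"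
  unfolding generic_rows_def Let_def
proof (intro conjI allI impI b)
  fix \<alpha> \<beta> :: real assume nz: "(\<alpha>, \<beta>) \<noteq> (0, 0)"
  define k l where "k = \<iota> \<alpha> * b$1$1 + \<iota> \<beta> * b$2$1" and "l = \<iota> \<alpha> * b$1$2 + \<iota> \<beta> * b$2$2"
  have "generic k l \<or> generic (- k) (- l)"
  proof (rule ccontr)
    assume "\<not> ?thesis"
    then obtain \<phi> \<psi> where \<phi>: "fm_below \<phi> 2" "ev2 (\<lambda>b c. sat \<phi> [b, c])" "\<not> sat (map_fm \<iota> \<phi>) [k, l]"
      and \<psi>: "fm_below \<psi> 2" "ev2 (\<lambda>b c. sat \<psi> [b, c])" "\<not> sat (map_fm \<iota> \<psi>) [- k, - l]"
      using genericI[of k l] genericI[of "- k" "- l"] by meson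
    define \<theta> where "\<theta> = Conj (Neg (row_fm \<alpha> \<beta> \<phi>)) (Neg (row_fm (- \<alpha>) (- \<beta>) \<psi>))"
    have \<theta>4: "fm_below \<theta> 4" by (simp add: \<theta>_def)
    have row: "map_fm \<iota> (row_fm \<alpha> \<beta> \<phi>) = row_fm (\<iota> \<alpha>) (\<iota> \<beta>) (map_fm \<iota> \<phi>)" for \<alpha> \<beta> \<phi>
      by (simp add: row_fm_def)
    have "sat (map_fm \<iota> \<theta>) (entries b)"
      using \<phi>(1,3) \<psi>(1,3) by (simp add: \<theta>_def row sat_row_fm k_def l_def)
    then obtain g where g: "g \<in> SL2" "sat (map_fm \<iota> \<theta>) (entries (emb g ** a0))"
      using closure[OF \<theta>4] by blast
    have "sat (map_fm \<iota> (left_mult_fm g \<theta>)) (entries a0)"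
    proof -
      have "map_fm \<iota> (left_mult_fm g \<theta>) = left_mult_fm (emb g) (map_fm \<iota> \<theta>)"
        by (simp add: left_mult_fm_def)
      then show ?thesis using g(2) \<theta>4 by (simp add: sat_left_mult_fm)
    qed
    then have ev: "ev_lower (left_mult_fm g \<theta>)" using r0_sat[OF a0] by simp
    define \<alpha>' \<beta>' where "\<alpha>' = \<alpha> * g$1$1 + \<beta> * g$2$1" and "\<beta>' = \<alpha> * g$1$2 + \<beta> * g$2$2"
    \<comment> \<open>The new coefficients are the row vector \<open>(\<alpha>, \<beta>)\<close>
      times \<open>g\<close>, and multiplying by the adjugate of \<open>g\<close> recovers the old
      ones.\<close>
    have nz': "\<alpha>' \<noteq> 0 \<or> \<beta>' \<noteq> 0"
    proof -
      have "\<alpha>' * g$2$2 - \<beta>' * g$2$1 = \<alpha> * (g$1$1 * g$2$2 - g$1$2 * g$2$1)"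
        "\<beta>' * g$1$1 - \<alpha>' * g$1$2 = \<beta> * (g$1$1 * g$2$2 - g$1$2 * g$2$1)"
        by (simp_all add: \<alpha>'_def \<beta>'_def algebra_simps)
      then have "\<alpha>' * g$2$2 - \<beta>' * g$2$1 = \<alpha>" "\<beta>' * g$1$1 - \<alpha>' * g$1$2 = \<beta>"
        using g(1) by (simp_all add: SL2_iff)
      then show ?thesis using nz by auto
    qed
    \<comment> \<open>At most one slope \<open>m\<close> makes the factor \<open>e\<close> vanish,
      and the limit at 0+ avoids it.\<close>
    have "\<forall>\<^sub>F m in at_right 0. \<alpha>' + \<beta>' * m \<noteq> 0"
    proof (cases "\<beta>' = 0")
      case True
      then show ?thesis using nz' by simp
    next
      case False
      have "\<forall>\<^sub>F m in at_right 0. m \<noteq> - \<alpha>' / \<beta>'" by (rule eventually_neq_at_within)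
      then show ?thesis by (rule eventually_mono) (use False in \<open>simp add: field_simps add_eq_0_iff\<close>)
    qed
    then have "\<forall>\<^sub>F m in at_right 0. \<alpha>' + \<beta>' * m \<noteq> 0 \<and> ev2 (\<lambda>b c. sat (left_mult_fm g \<theta>) (lower m b c))"
      using ev[unfolded ev_lower_def] by (rule eventually_conj)
    then obtain m where m: "\<alpha>' + \<beta>' * m \<noteq> 0" "ev2 (\<lambda>b c. sat (left_mult_fm g \<theta>) (lower m b c))"
      using eventually_happens'[OF trivial_limit_at_right_real] by blast
    define e where "e = \<alpha>' + \<beta>' * m"
    have sat: "sat (left_mult_fm g \<theta>) (lower m b c) \<longleftrightarrow>
      \<not> sat \<phi> [e * b, e * c + \<beta>' / b] \<and> \<not> sat \<psi> [(- e) * b, (- e) * c + (- \<beta>') / b]" for b c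
    proof -
      define M where "M = g ** mat22 b c (m * b) (m * c + inverse b)"
      have "\<alpha> * M$1$1 + \<beta> * M$2$1 = e * b" "\<alpha> * M$1$2 + \<beta> * M$2$2 = e * c + \<beta>' / b"
        "- \<alpha> * M$1$1 + - \<beta> * M$2$1 = (- e) * b" "- \<alpha> * M$1$2 + - \<beta> * M$2$2 = (- e) * c + (- \<beta>') / b"
        by (simp_all add: M_def matrix_matrix_mult_def UNIV_2 e_def \<alpha>'_def \<beta>'_def algebra_simps divide_inverse)
      then show ?thesis
        unfolding lower_entries sat_left_mult_fm[OF \<theta>4] M_def[symmetric]
        unfolding \<theta>_def sat.simps sat_row_fm[OF \<phi>(1)] sat_row_fm[OF \<psi>(1)] by metis
    qed
    consider "0 < e" | "0 < - e" using m(1) by (fold e_def) linarith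
    then show False
    proof cases
      case 1
      have "ev2 (\<lambda>b c. sat \<phi> [e * b, e * c + \<beta>' / b] \<and> sat (left_mult_fm g \<theta>) (lower m b c))"
        unfolding ev2_conj using ev2_affine[OF \<phi>(2) 1, of \<beta>'] m(2) by blast
      then have "ev2 (\<lambda>b c. False)" unfolding sat by (rule ev2_mono) blast
      then show False using not_ev2_False by blast
    next
      case 2
      have "ev2 (\<lambda>b c. sat \<psi> [(- e) * b, (- e) * c + (- \<beta>') / b] \<and> sat (left_mult_fm g \<theta>) (lower m b c))"
        unfolding ev2_conj using ev2_affine[OF \<psi>(2) 2, of "- \<beta>'"] m(2) by blast
      then have "ev2 (\<lambda>b c. False)" unfolding sat by (rule ev2_mono) blast
      then show False using not_ev2_False by blast
    qed
  qed
  then show "generic (\<iota> \<alpha> * b$1$1 + \<iota> \<beta> * b$2$1) (\<iota> \<alpha> * b$1$2 + \<iota> \<beta> * b$2$2) \<or>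
    generic (- (\<iota> \<alpha> * b$1$1 + \<iota> \<beta> * b$2$1)) (- (\<iota> \<alpha> * b$1$2 + \<iota> \<beta> * b$2$2))"
    by (simp add: k_def l_def)
qed

definition signed :: "bool \<Rightarrow> 'k^2^2 \<Rightarrow> 'k^2^2" where
  "signed s g = (if s then g else - g)"

lemma mult_uminus:
  fixes a b :: "'k^2^2"
  shows "a ** (- b) = - (a ** b)" "(- a) ** b = - (a ** b)"
  by (simp_all add: vec_eq_iff matrix_matrix_mult_def sum_negf)

lemma signed_mult: "a ** signed s b = signed s (a ** b)"
  by (simp add: signed_def mult_uminus)

lemma generic_rows_uminus:
  assumes "generic_rows b"
  shows "generic_rows (- b)"
  unfolding generic_rows_def Let_def
proof (intro conjI allI impI)
  show "- b \<in> SL2" using assms by (simp add: generic_rows_def SL2_uminus)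
  fix \<alpha> \<beta> :: real assume nz: "(\<alpha>, \<beta>) \<noteq> (0, 0)"
  define k l where "k = \<iota> \<alpha> * b$1$1 + \<iota> \<beta> * b$2$1" and "l = \<iota> \<alpha> * b$1$2 + \<iota> \<beta> * b$2$2"
  have "generic k l \<or> generic (- k) (- l)"
    using assms nz unfolding generic_rows_def Let_def k_def l_def by blast
  moreover have "\<iota> \<alpha> * (- b)$1$1 + \<iota> \<beta> * (- b)$2$1 = - k" "\<iota> \<alpha> * (- b)$1$2 + \<iota> \<beta> * (- b)$2$2 = - l"
    by (simp_all add: k_def l_def)
  ultimately show "generic (\<iota> \<alpha> * (- b)$1$1 + \<iota> \<beta> * (- b)$2$1) (\<iota> \<alpha> * (- b)$1$2 + \<iota> \<beta> * (- b)$2$2) \<or>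
    generic (- (\<iota> \<alpha> * (- b)$1$1 + \<iota> \<beta> * (- b)$2$1)) (- (\<iota> \<alpha> * (- b)$1$2 + \<iota> \<beta> * (- b)$2$2))"
    by (simp only: minus_minus) blast
qed

lemma generic_rows_signed: "generic_rows b \<Longrightarrow> generic_rows (signed s b)"
  by (simp add: signed_def generic_rows_uminus)

text \<open>The entries may be infinite, so standard parts are taken after division by a common
  positive \<rho>.\<close>

definition near_direction :: "'k^2^2 \<Rightarrow> real \<Rightarrow> real \<Rightarrow> bool" where
  "near_direction c \<omega>1 \<omega>2 \<longleftrightarrow> (\<exists>\<rho>>0. near (c$1$1 / \<rho>) \<omega>1 \<and> near (c$2$1 / \<rho>) \<omega>2)"

lemma near_direction_mult:
  assumes "near (c$1$1 / \<rho>) \<omega>1" "near (c$2$1 / \<rho>) \<omega>2"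
  shows "near ((emb g ** c)$i$1 / \<rho>) (\<omega>1 * g$i$1 + \<omega>2 * g$i$2)"
proof -
  have "near (\<iota> (g$i$1) * (c$1$1 / \<rho>) + \<iota> (g$i$2) * (c$2$1 / \<rho>)) (g$i$1 * \<omega>1 + g$i$2 * \<omega>2)"
    by (intro near_add near_scale assms)
  then show ?thesis
    by (simp add: matrix_matrix_mult_def UNIV_2 add_divide_distrib mult.commute)
qed

lemma near_direction_pos:
  assumes "near_direction c \<omega>1 \<omega>2" "sat (direction_fm \<omega>1 \<omega>2 \<epsilon>) (entries g)"
  shows "0 < (emb g ** c)$1$1"
proof -
  obtain \<rho> where \<rho>: "\<rho> > 0" "near (c$1$1 / \<rho>) \<omega>1" "near (c$2$1 / \<rho>) \<omega>2"
    using assms(1) by (auto simp: near_direction_def)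
  have "\<iota> 0 < (emb g ** c)$1$1 / \<rho>"
    by (rule near_gt[OF near_direction_mult[OF \<rho>(2,3)]]) (use assms(2) in \<open>simp add: sat_direction_fm\<close>)
  then show ?thesis using \<rho>(1) by (simp add: zero_less_divide_iff)
qed

text \<open>Divided by the sum of their absolute values, the two entries are bounded and their
  absolute values add up to 1, so their standard parts are not both 0. The sign \<open>s\<close>
  selects the positive one of the two opposite directions.\<close>

lemma direction_exists:
  assumes "generic_rows b"
  obtains s \<omega>1 \<omega>2 where "positive_direction \<omega>1 \<omega>2" "near_direction (signed s b) \<omega>1 \<omega>2"
proof -
  define u v \<rho> where "u = b$1$1" and "v = b$2$1" and "\<rho> = \<bar>u\<bar> + \<bar>v\<bar>"
  have "generic u (b$1$2) \<or> generic (- u) (- (b$1$2))"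
    using assms[unfolded generic_rows_def, THEN conjunct2, rule_format, of 1 0] by (simp add: u_def Let_def)
  then have "u \<noteq> 0" using generic_pos[of u] generic_pos[of "- u"] by auto
  then have \<rho>: "\<rho> > 0" by (simp add: \<rho>_def add_pos_nonneg)
  have le: "\<bar>u / \<rho>\<bar> \<le> \<iota> 1" "\<bar>v / \<rho>\<bar> \<le> \<iota> 1"
    using \<rho> by (simp_all add: abs_divide) (simp_all add: \<rho>_def)
  obtain w1 where w1: "near (u / \<rho>) w1" using near_exists[OF le(1)] .
  obtain w2 where w2: "near (v / \<rho>) w2" using near_exists[OF le(2)] .
  have neg: "near (- x) (- r)" if "near x r" for x r
    using near_scale[OF that, of "-1"] by simp
  have "w1 \<noteq> 0 \<or> w2 \<noteq> 0"
  proof (rule ccontr)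
    assume "\<not> ?thesis"
    then have z: "near (u / \<rho>) 0" "near (v / \<rho>) 0" using w1 w2 by auto
    have "\<bar>u / \<rho>\<bar> < \<iota> (1/2)" "\<bar>v / \<rho>\<bar> < \<iota> (1/2)" using z unfolding near_def by (simp_all del: \<iota>_divide)
    then have "\<bar>u / \<rho>\<bar> + \<bar>v / \<rho>\<bar> < \<iota> (1/2 + 1/2)" unfolding \<iota>_add by (rule add_strict_mono)
    moreover have "\<bar>u / \<rho>\<bar> + \<bar>v / \<rho>\<bar> = 1"
    proof -
      have "\<bar>u / \<rho>\<bar> + \<bar>v / \<rho>\<bar> = \<rho> / \<rho>" using \<rho> by (simp add: abs_divide add_divide_distrib[symmetric]) (simp add: \<rho>_def)
      then show ?thesis using \<rho> by simp
    qed
    ultimately show False by (simp del: \<iota>_add \<iota>_divide)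
  qed
  then consider "positive_direction w1 w2" | "positive_direction (- w1) (- w2)"
    unfolding positive_direction_def by linarith
  then show ?thesis
  proof cases
    case 1
    then show ?thesis using w1 w2 \<rho> by (intro that[of w1 w2 True]) (auto simp: near_direction_def signed_def u_def v_def)
  next
    case 2
    then show ?thesis using neg[OF w1] neg[OF w2] \<rho>
      by (intro that[of "- w1" "- w2" False]) (auto simp: near_direction_def signed_def u_def v_def)
  qed
qed

text \<open>The real \<open>g\<close> sends the standard direction to (W1, W2) with
  \<open>0 < W2 < \<epsilon> * W1\<close>. With \<open>c = signed s b\<close>, the matrix
  \<open>emb g ** c\<close> then has a generic first row and a slope infinitely near
  \<open>W2 / W1\<close>, so \<open>ev_lower_near\<close> contradicts the choice of
  \<open>g\<close>.\<close>

lemma coheir_product_sat: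
  assumes b: "generic_rows b"
    and a: "is_coheir R (R \<union> set (entries b)) (r0 R) (mtp (R \<union> set (entries b)) a)"
    and \<omega>: "positive_direction \<omega>1 \<omega>2" "near_direction (signed s b) \<omega>1 \<omega>2"
    and \<phi>: "fm_below \<phi> 4" "ev_lower \<phi>"
  shows "sat (map_fm \<iota> \<phi>) (entries (signed s (a ** b)))"
proof (rule ccontr)
  let ?B = "R \<union> set (entries b)"
  assume neg: "\<not> ?thesis"
  obtain a0 where a0: "mtp R a0 = r0 R" using r0_realized by blast
  have eq: "mtp R a = r0 R"
    and fs: "\<And>\<psi>. \<psi> \<in> formulas ?B 4 \<Longrightarrow> sat \<psi> (entries a) \<Longrightarrow> \<exists>g. sat \<psi> (entries (emb g))"
    using a unfolding a0[symmetric] by (simp_all add: is_coheir_mtp)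
  obtain \<epsilon> where \<epsilon>: "\<epsilon> > 0" "\<And>r k l m. 0 < r \<Longrightarrow> r < \<epsilon> \<Longrightarrow> generic k l \<Longrightarrow> near m r \<Longrightarrow>
      sat (map_fm \<iota> \<phi>) (lower m k l)"
    using ev_lower_near[OF \<phi>] unfolding eventually_at_right_field by blast
  define \<tau> where "\<tau> = direction_fm \<omega>1 \<omega>2 \<epsilon>"
  have \<tau>4: "fm_below \<tau> 4" by (simp add: \<tau>_def)
  have \<tau>a: "sat (map_fm \<iota> \<tau>) (entries a)"
    using r0_sat[OF eq \<tau>4] ev_lower_direction[OF \<omega>(1) \<epsilon>(1)] by (simp add: \<tau>_def)
  \<comment> \<open>Finite satisfiability speaks about \<open>a ** b\<close>, so the sign is moved
    into the formula.\<close>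
  define \<psi> where "\<psi> = (if s then map_fm \<iota> \<phi> else uminus_fm (map_fm \<iota> \<phi>))"
  have \<psi>4: "fm_below \<psi> 4" using \<phi>(1) by (simp add: \<psi>_def)
  have \<psi>: "sat \<psi> (entries g) = sat (map_fm \<iota> \<phi>) (entries (signed s g))" for g
    using \<phi>(1) by (simp add: \<psi>_def signed_def sat_uminus_fm)
  have "- 1 \<in> R" by (rule range_eqI[of _ _ "-1"]) simp
  then have \<psi>R: "fm_params \<psi> \<subseteq> R"
    using fm_params_uminus_fm[of "map_fm \<iota> \<phi>"] by (auto simp: \<psi>_def fm.set_map)
  have "sat (Conj (Neg (right_mult_fm b \<psi>)) (map_fm \<iota> \<tau>)) (entries a)"
    using neg \<tau>a \<psi>4 by (simp add: sat_right_mult_fm \<psi>)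
  moreover have "Conj (Neg (right_mult_fm b \<psi>)) (map_fm \<iota> \<tau>) \<in> formulas ?B 4"
    using fm_params_right_mult_fm[of b \<psi>] \<psi>R \<tau>4 by (auto simp: formulas_def fm.set_map)
  ultimately obtain g where "sat (Conj (Neg (right_mult_fm b \<psi>)) (map_fm \<iota> \<tau>)) (entries (emb g))"
    using fs by blast
  then have ng: "\<not> sat (map_fm \<iota> \<phi>) (entries (emb g ** signed s b))" and \<tau>g: "sat \<tau> (entries g)"
    using \<psi>4 \<tau>4 by (simp_all add: sat_right_mult_fm \<psi> transfer_entries signed_mult)
  define c W1 W2 where "c = signed s b" and "W1 = \<omega>1 * g$1$1 + \<omega>2 * g$1$2" and "W2 = \<omega>1 * g$2$1 + \<omega>2 * g$2$2"
  have W: "g \<in> SL2" "0 < W1" "0 < W2" "W2 < \<epsilon> * W1"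
    using \<tau>g by (simp_all add: \<tau>_def sat_direction_fm W1_def W2_def)
  have c: "generic_rows c" using b by (simp add: c_def generic_rows_signed)
  define k l V X where "k = (emb g ** c)$1$1" and "l = (emb g ** c)$1$2"
    and "V = (emb g ** c)$2$1" and "X = (emb g ** c)$2$2"
  have k: "0 < k" unfolding k_def c_def by (rule near_direction_pos[OF \<omega>(2) \<tau>g[unfolded \<tau>_def]])
  have "(g$1$1, g$1$2) \<noteq> (0, 0)" using W(2) by (auto simp: W1_def)
  then have "generic k l \<or> generic (- k) (- l)"
    using c unfolding generic_rows_def Let_def k_def l_def
    by (simp add: matrix_matrix_mult_def UNIV_2)
  then have gen: "generic k l" using generic_pos[of "- k" "- l"] k by auto
  obtain \<rho> where \<rho>: "\<rho> > 0" "near (c$1$1 / \<rho>) \<omega>1" "near (c$2$1 / \<rho>) \<omega>2"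
    using \<omega>(2) by (auto simp: near_direction_def c_def)
  have nk: "near (k / \<rho>) W1" and nV: "near (V / \<rho>) W2"
    using near_direction_mult[OF \<rho>(2,3), of g 1] near_direction_mult[OF \<rho>(2,3), of g 2]
    by (simp_all add: k_def V_def W1_def W2_def)
  have "near (V / k) (W2 / W1)"
    unfolding near_def
  proof (intro allI impI)
    fix d :: real assume d: "d > 0"
    \<comment> \<open>The combination \<open>q\<close> is infinitesimal while
      \<open>k / \<rho>\<close> stays above the real number \<open>W1 / 2\<close>, so their quotient
      is infinitesimal.\<close>
    define q where "q = V / \<rho> + \<iota> (- (W2 / W1)) * (k / \<rho>)"
    have "near q (W2 + - (W2 / W1) * W1)" unfolding q_def by (intro near_add near_scale nk nV)
    then have "near q 0" using W(2) by simp
    then have "\<bar>q\<bar> < \<iota> (d * (W1 / 2))" using d W(2) by (simp add: near_def del: \<iota>_mult \<iota>_divide)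
    also have "\<dots> = \<iota> d * \<iota> (W1 / 2)" by (rule \<iota>_mult)
    also have "\<dots> < \<iota> d * (k / \<rho>)"
      using near_gt[OF nk, of "W1 / 2"] W(2) d by (intro mult_strict_left_mono) simp_all
    finally have q: "\<bar>q\<bar> < \<iota> d * (k / \<rho>)" .
    have "V / k - \<iota> (W2 / W1) = q / (k / \<rho>)"
      using k \<rho>(1) W(2) by (simp add: q_def field_simps)
    then have "\<bar>V / k - \<iota> (W2 / W1)\<bar> = \<bar>q\<bar> / (k / \<rho>)" using k \<rho>(1) by (simp add: abs_divide abs_mult)
    also have "\<dots> < \<iota> d" using q k \<rho>(1) by (subst pos_divide_less_eq) simp_all
    finally show "\<bar>V / k - \<iota> (W2 / W1)\<bar> < \<iota> d" .
  qed
  moreover have "0 < W2 / W1" "W2 / W1 < \<epsilon>" using W by (simp_all add: divide_less_eq)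
  ultimately have "sat (map_fm \<iota> \<phi>) (lower (V / k) k l)" using \<epsilon>(2) gen by blast
  moreover have "entries (emb g ** c) = lower (V / k) k l"
  proof -
    \<comment> \<open>Determinant 1 fixes the fourth entry, so first row and slope determine the
      matrix.\<close>
    have "emb g ** c \<in> SL2" using W(1) c by (intro SL2_mult) (simp_all add: emb_SL2 generic_rows_def)
    then have "k * X = 1 + l * V" by (simp add: SL2_iff k_def l_def V_def X_def)
    then have "X = V / k * l + inverse k" using k by (simp add: field_simps)
    moreover have "entries (emb g ** c) = [k, l, V, X]" by (simp add: entries_def k_def l_def V_def X_def)
    ultimately show ?thesis using k by (simp add: lower_def)
  qed
  ultimately show False using ng by (simp add: c_def)
qed

lemma coheir_product_type:
  assumes "generic_rows b"
    and "is_coheir R (R \<union> set (entries b)) (r0 R) (mtp (R \<union> set (entries b)) a)"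
    and "positive_direction \<omega>1 \<omega>2" "near_direction (signed s b) \<omega>1 \<omega>2"
  shows "mtp R (signed s (a ** b)) = r0 R"
  unfolding r0_eq mtp_eq_image_iff
proof (intro allI impI)
  fix \<phi> :: "real fm" assume \<phi>: "fm_below \<phi> 4"
  show "sat (map_fm \<iota> \<phi>) (entries (signed s (a ** b))) = ev_lower \<phi>"
  proof (cases "ev_lower \<phi>")
    case True
    then show ?thesis using coheir_product_sat[OF assms \<phi>] by blast
  next
    case False
    then have "ev_lower (Neg \<phi>)" using ev_lower_Neg[OF \<phi>] by blast
    then show ?thesis using coheir_product_sat[OF assms, of "Neg \<phi>"] False \<phi> by simp
  qed
qed

section \<open>The orbit closure\<close>

lemma Conj_in_S_G:
  assumes "p \<in> S_G R" "\<phi> \<in> formulas R 4" "\<psi> \<in> formulas R 4"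
  shows "Conj \<phi> \<psi> \<in> p \<longleftrightarrow> \<phi> \<in> p \<and> \<psi> \<in> p"
proof -
  obtain a where "mtp R a = p" using realize_S_G[OF assms(1)] by blast
  then show ?thesis using assms(2,3) by (auto simp: tp_def formulas_def)
qed

text \<open>The generating sets are closed under intersection by \<open>Conj\<close>, so they form a
  basis and not only a subbasis.\<close>

lemma openin_stone_basis:
  assumes "openin (stone R) V" "q \<in> V"
  shows "q \<in> S_G R \<and> (\<exists>\<phi>\<in>formulas R 4. \<phi> \<in> q \<and> (\<forall>p\<in>S_G R. \<phi> \<in> p \<longrightarrow> p \<in> V))"
proof -
  define basic where "basic V q \<longleftrightarrow> q \<in> S_G R \<and>
    (\<exists>\<phi>\<in>formulas R 4. \<phi> \<in> q \<and> (\<forall>p\<in>S_G R. \<phi> \<in> p \<longrightarrow> p \<in> V))" for V q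
  have "generate_topology_on {{p \<in> S_G R. \<phi> \<in> p} |\<phi>. \<phi> \<in> formulas R 4} V"
    using assms(1) by (simp add: stone_def openin_topology_generated_by_iff)
  then have "\<forall>q\<in>V. basic V q"
  proof induction
    case Empty
    show ?case by simp
  next
    case (Int V W)
    show ?case
    proof
      fix q assume q: "q \<in> V \<inter> W"
      then have S: "q \<in> S_G R" using Int.IH(1) by (simp add: basic_def)
      obtain \<phi> where \<phi>: "\<phi> \<in> formulas R 4" "\<phi> \<in> q" "\<forall>p\<in>S_G R. \<phi> \<in> p \<longrightarrow> p \<in> V"
        using Int.IH(1) q by (auto simp: basic_def)
      obtain \<psi> where \<psi>: "\<psi> \<in> formulas R 4" "\<psi> \<in> q" "\<forall>p\<in>S_G R. \<psi> \<in> p \<longrightarrow> p \<in> W"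
        using Int.IH(2) q by (auto simp: basic_def)
      have "Conj \<phi> \<psi> \<in> formulas R 4" using \<phi>(1) \<psi>(1) by (simp add: formulas_def)
      then show "basic (V \<inter> W) q"
        unfolding basic_def using S \<phi> \<psi> Conj_in_S_G[OF _ \<phi>(1) \<psi>(1)] by (intro conjI bexI[of _ "Conj \<phi> \<psi>"]) auto
    qed
  next
    case (UN K)
    show ?case
    proof
      fix q assume "q \<in> \<Union> K"
      then obtain V where V: "V \<in> K" "q \<in> V" by blast
      then have "basic V q" using UN.IH by blast
      then show "basic (\<Union> K) q" using V(1) unfolding basic_def by blast
    qed
  next
    case (Basis U)
    then show ?case unfolding basic_def by blast
  qed
  then show ?thesis using assms(2) by (simp add: basic_def)
qed

lemma topspace_stone: "topspace (stone R) = S_G R"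
proof -
  have "SL2_fm \<in> formulas R 4" by (simp add: formulas_def)
  then show ?thesis by (auto simp: stone_def S_G_def)
qed

lemma in_closure_stone:
  assumes "J \<subseteq> S_G R"
  shows "p \<in> stone R closure_of J \<longleftrightarrow> p \<in> S_G R \<and> (\<forall>\<phi>\<in>p. \<exists>q\<in>J. \<phi> \<in> q)"
  unfolding in_closure_of topspace_stone
proof (intro conj_cong refl iffI allI ballI impI)
  fix \<phi> assume p: "p \<in> S_G R" "\<phi> \<in> p"
    and *: "\<forall>T. p \<in> T \<and> openin (stone R) T \<longrightarrow> (\<exists>y. y \<in> J \<and> y \<in> T)"
  let ?U = "{q \<in> S_G R. \<phi> \<in> q}"
  have "\<phi> \<in> formulas R 4" using p by (auto simp: S_G_def complete_type_def)
  then have "openin (stone R) ?U"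
    unfolding stone_def by (intro topology_generated_by_Basis) blast
  moreover have "p \<in> ?U" using p by simp
  ultimately obtain y where "y \<in> J" "y \<in> ?U" using *[rule_format, of ?U] by meson
  then show "\<exists>q\<in>J. \<phi> \<in> q" by auto
next
  fix T assume *: "\<forall>\<phi>\<in>p. \<exists>q\<in>J. \<phi> \<in> q" "p \<in> T \<and> openin (stone R) T"
  then obtain \<phi> where \<phi>: "\<phi> \<in> p" "\<And>q. q \<in> S_G R \<Longrightarrow> \<phi> \<in> q \<Longrightarrow> q \<in> T"
    using openin_stone_basis[of T p] by meson
  then obtain q where "q \<in> J" "\<phi> \<in> q" using *(1) by meson
  then show "\<exists>y. y \<in> J \<and> y \<in> T" using \<phi>(2)[of q] assms by auto
qed

section \<open>Change of sign and the set of coheir products\<close>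

text \<open>Defined as the action of a real group element, so closed invariant sets are stable under
  it.\<close>

definition flip :: "'k fm set \<Rightarrow> 'k fm set" where
  "flip p = act R (emb (- mat 1)) p"

lemma emb_neg1_mult: "emb (- mat 1) ** a = - a"
  by (simp add: vec_eq_iff forall_2 matrix_matrix_mult_def UNIV_2 mat_def)

lemma flip_mtp: "a \<in> SL2 \<Longrightarrow> flip (mtp R a) = mtp R (- a)"
  unfolding flip_def by (subst act_mtp) (simp_all add: emb_neg1_mult)

lemma neg_one_SL2: "- mat 1 \<in> (SL2 :: (real^2^2) set)"
  by (simp add: SL2_iff mat_def)

lemma mtp_SL2: "mtp R a = mtp R b \<Longrightarrow> a \<in> SL2 \<Longrightarrow> b \<in> SL2"
  by (metis SL2_fm_in_mtp)

text \<open>The candidates among which the definite description in \<open>star\<close> chooses;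
  \<open>star\<close> is well defined where this is a singleton.\<close>

definition prods :: "'k fm set \<Rightarrow> 'k fm set \<Rightarrow> 'k fm set set" where
  "prods p q = {r. \<exists>a\<in>SL2. \<exists>b\<in>SL2. mtp R b = q \<and>
     (let B = R \<union> set (entries b) in is_coheir R B p (mtp B a)) \<and>
     r = mtp R (a ** b)}"

lemma prodsE:
  assumes "r \<in> prods p q"
  obtains a b where "a \<in> SL2" "b \<in> SL2" "mtp R b = q"
    "is_coheir R (R \<union> set (entries b)) p (mtp (R \<union> set (entries b)) a)"
    "r = mtp R (a ** b)"
  using assms unfolding prods_def Let_def mem_Collect_eq by (elim bexE conjE) (rule that)

lemma prodsI:
  assumes "a \<in> SL2" "b \<in> SL2"
    "is_coheir R (R \<union> set (entries b)) p (mtp (R \<union> set (entries b)) a)"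
  shows "mtp R (a ** b) \<in> prods p (mtp R b)"
  unfolding prods_def Let_def mem_Collect_eq by (intro bexI[OF _ assms(1)] bexI[OF _ assms(2)] conjI refl assms(3))

lemma star_prods: "prods p q = {r} \<Longrightarrow> star R p q = r"
  unfolding star_def prods_def by (rule the_equality) blast+

text \<open>This places the product of \<open>p\<close> and \<open>q\<close> in the closure of the
  orbit of \<open>q\<close>: a formula true at \<open>a ** b\<close> is a formula about
  \<open>a\<close> over \<open>b\<close>, hence true at a real matrix, and \<open>SL2_fm\<close>
  keeps that matrix in the group.\<close>

lemma coheir_product_approximated:
  assumes p: "p \<in> S_G R" and q: "q \<in> S_G R" and r: "prods p q = {r}" and \<phi>: "\<phi> \<in> r"
  shows "\<exists>g\<in>SL2. \<phi> \<in> act R (emb g) q"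
proof -
  obtain a b where ab: "a \<in> SL2" "b \<in> SL2" "mtp R b = q"
    "is_coheir R (R \<union> set (entries b)) p (mtp (R \<union> set (entries b)) a)"
    "r = mtp R (a ** b)"
    using r by (blast elim: prodsE)
  obtain a' where a': "mtp R a' = p" using realize_S_G[OF p] by blast
  have fs: "\<And>\<psi>. \<psi> \<in> formulas (R \<union> set (entries b)) 4 \<Longrightarrow> sat \<psi> (entries a) \<Longrightarrow> \<exists>g. sat \<psi> (entries (emb g))"
    using ab(4) unfolding a'[symmetric] by (simp add: is_coheir_mtp)
  have \<phi>4: "\<phi> \<in> formulas R 4" "sat \<phi> (entries (a ** b))"
    using \<phi> ab(5) by (simp_all add: tp_def)
  then have below: "fm_below \<phi> 4" by (simp add: formulas_def)
  have "Conj (right_mult_fm b \<phi>) SL2_fm \<in> formulas (R \<union> set (entries b)) 4"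
    using fm_params_right_mult_fm[of b \<phi>] \<phi>4(1) by (auto simp: formulas_def)
  moreover have "sat (Conj (right_mult_fm b \<phi>) SL2_fm) (entries a)"
    using \<phi>4(2) below ab(1) by (simp add: sat_right_mult_fm)
  ultimately obtain g where "sat (Conj (right_mult_fm b \<phi>) SL2_fm) (entries (emb g))" using fs by blast
  then have g: "g \<in> SL2" "sat \<phi> (entries (emb g ** b))"
    using below by (simp_all add: sat_right_mult_fm emb_SL2)
  then have "\<phi> \<in> act R (emb g) q"
    unfolding ab(3)[symmetric] act_mtp[OF ab(2)] using \<phi>4(1) by (simp add: tp_def)
  then show ?thesis using g(1) by blast
qed

lemma r0_first_entry:
  assumes "mtp R a = r0 R"
  shows "0 < a$1$1"
proof -
  have "ev_lower (Less Zero (Var 0))"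
    unfolding ev_lower_def lower_def using ev2_gt(1)[of 0] by (simp add: not_le)
  then have "sat (map_fm \<iota> (Less Zero (Var 0))) (entries a)"
    using r0_sat[OF assms, of "Less Zero (Var 0)"] by simp
  then show ?thesis by (simp add: entries_def not_le)
qed

lemma r0_in_S_G: "r0 R \<in> S_G R"
  using r0_realized mtp_in_S_G by metis

lemma flip_in_S_G: "p \<in> S_G R \<Longrightarrow> flip p \<in> S_G R"
  using realize_S_G[of p] flip_mtp mtp_in_S_G SL2_uminus by metis

lemma flip_flip: "p \<in> S_G R \<Longrightarrow> flip (flip p) = p"
  using realize_S_G[of p] flip_mtp SL2_uminus by (metis minus_minus)

lemma flip_r0_neq: "flip (r0 R) \<noteq> r0 R"
proof
  assume *: "flip (r0 R) = r0 R"
  obtain a where a: "a \<in> SL2" "mtp R a = r0 R" using r0_realized by blast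
  then have "mtp R (- a) = r0 R" using * flip_mtp[OF a(1)] by simp
  then show False using r0_first_entry[of "- a"] r0_first_entry[OF a(2)] by simp
qed

definition generic_type :: "'k fm set \<Rightarrow> bool" where
  "generic_type p \<longleftrightarrow> p \<in> S_G R \<and> (\<forall>b. mtp R b = p \<longrightarrow> generic_rows b)"

lemma prods_nonempty:
  assumes "p \<in> S_G R" "b \<in> SL2"
  obtains a where "a \<in> SL2"
    "is_coheir R (R \<union> set (entries b)) p (mtp (R \<union> set (entries b)) a)"
    "mtp R (a ** b) \<in> prods p (mtp R b)"
proof -
  obtain a0 where a0: "a0 \<in> SL2" "mtp R a0 = p" using realize_S_G[OF assms(1)] .
  obtain a where a: "is_coheir R (R \<union> set (entries b)) p (mtp (R \<union> set (entries b)) a)"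
    using coheir_exists[of "set (entries b)" a0] a0(2) by auto
  then have "mtp R a0 = mtp R a" unfolding a0(2)[symmetric] by (simp add: is_coheir_mtp)
  then have "a \<in> SL2" using mtp_SL2 a0(1) by blast
  then show ?thesis using that a prodsI[OF _ assms(2) a] by blast
qed

text \<open>
  If two coheir products with realizations \<open>b\<close>, \<open>b'\<close> of the same type had different signs, some real
  matrix would act on the first columns of \<open>b\<close> and \<open>b'\<close> with different signs.
\<close>

lemma prods_r0:
  assumes "generic_type p"
  shows "prods (r0 R) p = {r0 R} \<or> prods (r0 R) p = {flip (r0 R)}"
proof -
  let ?r0 = "r0 R"
  have pS: "p \<in> S_G R" using assms by (simp add: generic_type_def)
  obtain a0 where a0: "mtp R a0 = ?r0" using r0_realized by blast
  have signs: "mtp R (a ** b) = (if s then ?r0 else flip ?r0)"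
    if b: "b \<in> SL2" "mtp R b = p" and a: "a \<in> SL2"
      "is_coheir R (R \<union> set (entries b)) ?r0 (mtp (R \<union> set (entries b)) a)"
      and \<omega>: "positive_direction \<omega>1 \<omega>2" "near_direction (signed s b) \<omega>1 \<omega>2" for a b s \<omega>1 \<omega>2
  proof -
    have gb: "generic_rows b" using assms b(2) by (simp add: generic_type_def)
    have t: "mtp R (signed s (a ** b)) = ?r0" by (rule coheir_product_type[OF gb a(2) \<omega>])
    have ab: "a ** b \<in> SL2" by (rule SL2_mult[OF a(1) b(1)])
    show ?thesis
    proof (cases s)
      case False
      then have "flip ?r0 = flip (mtp R (- (a ** b)))" using t by (simp add: signed_def)
      also have "\<dots> = mtp R (a ** b)" using ab by (subst flip_mtp) (simp_all add: SL2_uminus)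
      finally show ?thesis using False by simp
    qed (use t in \<open>simp add: signed_def\<close>)
  qed
  have sub: "prods ?r0 p \<subseteq> {?r0, flip ?r0}"
  proof
    fix r assume "r \<in> prods ?r0 p"
    then obtain a b where ab: "a \<in> SL2" "b \<in> SL2" "mtp R b = p"
      "is_coheir R (R \<union> set (entries b)) ?r0 (mtp (R \<union> set (entries b)) a)"
      "r = mtp R (a ** b)" by (rule prodsE)
    have b: "generic_rows b" using assms ab(3) by (simp add: generic_type_def)
    obtain s \<omega>1 \<omega>2 where "positive_direction \<omega>1 \<omega>2" "near_direction (signed s b) \<omega>1 \<omega>2"
      by (rule direction_exists[OF b])
    then show "r \<in> {?r0, flip ?r0}" using signs[OF ab(2,3,1,4)] ab(5) by auto
  qed
  have "\<not> (?r0 \<in> prods ?r0 p \<and> flip ?r0 \<in> prods ?r0 p)"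
  proof
    assume both: "?r0 \<in> prods ?r0 p \<and> flip ?r0 \<in> prods ?r0 p"
    obtain a b where ab: "a \<in> SL2" "b \<in> SL2" "mtp R b = p"
      "is_coheir R (R \<union> set (entries b)) ?r0 (mtp (R \<union> set (entries b)) a)"
      "?r0 = mtp R (a ** b)" by (rule prodsE[OF both[THEN conjunct1]])
    obtain a' b' where ab': "a' \<in> SL2" "b' \<in> SL2" "mtp R b' = p"
      "is_coheir R (R \<union> set (entries b')) ?r0 (mtp (R \<union> set (entries b')) a')"
      "flip ?r0 = mtp R (a' ** b')" by (rule prodsE[OF both[THEN conjunct2]])
    have b': "generic_rows b'" using assms ab'(3) by (simp add: generic_type_def)
    obtain s \<omega>1 \<omega>2 where \<omega>: "positive_direction \<omega>1 \<omega>2" "near_direction (signed s b') \<omega>1 \<omega>2"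
      by (rule direction_exists[OF b'])
    have "\<not> s" using signs[OF ab'(2,3,1,4) \<omega>] ab'(5) flip_r0_neq by auto
    \<comment> \<open>Only the sign of the first entry matters here, so the slope bound is simply
      1.\<close>
    define \<tau> where "\<tau> = direction_fm \<omega>1 \<omega>2 1"
    have eq: "mtp R a = ?r0"
      and fs: "\<And>\<psi>. \<psi> \<in> formulas (R \<union> set (entries b)) 4 \<Longrightarrow> sat \<psi> (entries a) \<Longrightarrow> \<exists>g. sat \<psi> (entries (emb g))"
      using ab(4) unfolding a0[symmetric] by (simp_all add: is_coheir_mtp)
    have \<tau>4: "fm_below \<tau> 4" by (simp add: \<tau>_def)
    have "sat (map_fm \<iota> \<tau>) (entries a)"
      using r0_sat[OF eq \<tau>4] ev_lower_direction[OF \<omega>(1)] by (simp add: \<tau>_def)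
    moreover have "0 < (a ** b)$1$1" by (rule r0_first_entry) (use ab(5) in simp)
    ultimately have "sat (Conj (right_mult_fm b (Less Zero (Var 0))) (map_fm \<iota> \<tau>)) (entries a)"
      unfolding sat.simps by (subst sat_right_mult_fm) (simp_all add: not_le, simp add: entries_def)
    moreover have "Conj (right_mult_fm b (Less Zero (Var 0))) (map_fm \<iota> \<tau>) \<in> formulas (R \<union> set (entries b)) 4"
      using fm_params_right_mult_fm[of b "Less Zero (Var 0)"] \<tau>4 by (auto simp: formulas_def fm.set_map)
    ultimately obtain g where "sat (Conj (right_mult_fm b (Less Zero (Var 0))) (map_fm \<iota> \<tau>)) (entries (emb g))"
      using fs by blast
    then have g: "sat (Less Zero (Var 0)) (entries (emb g ** b))" "sat \<tau> (entries g)"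
      using \<tau>4 by (simp_all add: sat_right_mult_fm transfer_entries del: sat_connectives(4))
    \<comment> \<open>A real translate depends only on the type of \<open>b\<close>, so positivity
      of the first entry passes to \<open>b'\<close>.\<close>
    have "mtp R (emb g ** b) = mtp R (emb g ** b')"
      using ab(3) ab'(3) by (intro mtp_left_mult) simp
    then have "sat (map_fm \<iota> (Less Zero (Var 0))) (entries (emb g ** b'))"
      using g(1) mtp_eq_iff[of "emb g ** b" "emb g ** b'"] by (auto dest!: spec[of _ "Less Zero (Var 0)"])
    then have "0 < (emb g ** b')$1$1" by (simp add: entries_def not_le)
    moreover have "0 < (emb g ** signed s b')$1$1"
      by (rule near_direction_pos[OF \<omega>(2) g(2)[unfolded \<tau>_def]])
    ultimately show False using \<open>\<not> s\<close> by (simp add: signed_def mult_uminus)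
  qed
  moreover have "prods ?r0 p \<noteq> {}"
  proof -
    obtain b where "b \<in> SL2" "mtp R b = p" using realize_S_G[OF pS] .
    then show ?thesis using prods_nonempty[OF r0_in_S_G, of b] by blast
  qed
  ultimately show ?thesis using sub by blast
qed

text \<open>Negation is definable over \<open>R\<close> and maps real matrices to real matrices, so
  it preserves finite satisfiability.\<close>

lemma coheir_uminus:
  assumes "R \<subseteq> B" "a0 \<in> SL2" "is_coheir R B (mtp R a0) (mtp B a)"
  shows "is_coheir R B (mtp R (- a0)) (mtp B (- a))"
  unfolding is_coheir_mtp[OF assms(1)]
proof (intro conjI ballI impI)
  have *: "mtp R a0 = mtp R a"
    "\<And>\<phi>. \<phi> \<in> formulas B 4 \<Longrightarrow> sat \<phi> (entries a) \<Longrightarrow> \<exists>g. sat \<phi> (entries (emb g))"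
    using assms(3) unfolding is_coheir_mtp[OF assms(1)] by blast+
  show "mtp R (- a0) = mtp R (- a)"
    using flip_mtp[OF assms(2)] flip_mtp[OF mtp_SL2[OF *(1) assms(2)]] *(1) by simp
  fix \<phi> assume \<phi>: "\<phi> \<in> formulas B 4" "sat \<phi> (entries (- a))"
  have "- 1 \<in> R" by (rule range_eqI[of _ _ "-1"]) simp
  then have "uminus_fm \<phi> \<in> formulas B 4"
    using fm_params_uminus_fm[of \<phi>] \<phi>(1) assms(1) by (auto simp: formulas_def)
  moreover have below: "fm_below \<phi> 4" using \<phi>(1) by (simp add: formulas_def)
  then have "sat (uminus_fm \<phi>) (entries a)" using \<phi>(2) by (simp add: sat_uminus_fm)
  ultimately obtain g where "sat (uminus_fm \<phi>) (entries (emb g))" using *(2) by blast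
  then have "sat \<phi> (entries (emb (- g)))" using below by (simp add: sat_uminus_fm emb_uminus)
  then show "\<exists>g. sat \<phi> (entries (emb g))" ..
qed

lemma prods_flip_subset:
  assumes p: "p \<in> S_G R" and r: "r \<in> prods p q"
  shows "flip r \<in> prods (flip p) q"
proof -
  obtain a b where ab: "a \<in> SL2" "b \<in> SL2" "mtp R b = q"
    "is_coheir R (R \<union> set (entries b)) p (mtp (R \<union> set (entries b)) a)"
    "r = mtp R (a ** b)" by (rule prodsE[OF r])
  obtain a0 where a0: "a0 \<in> SL2" "mtp R a0 = p" using realize_S_G[OF p] .
  have "is_coheir R (R \<union> set (entries b)) (flip p) (mtp (R \<union> set (entries b)) (- a))"
    using coheir_uminus[OF _ a0(1), of "R \<union> set (entries b)" a] ab(4) a0 flip_mtp[OF a0(1)] by simp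
  then have "mtp R (- a ** b) \<in> prods (flip p) (mtp R b)"
    using ab(1,2) by (intro prodsI) (simp_all add: SL2_uminus)
  moreover have "flip r = mtp R (- a ** b)"
    unfolding ab(5) mult_uminus by (rule flip_mtp[OF SL2_mult[OF ab(1,2)]])
  ultimately show ?thesis using ab(3) by simp
qed

text \<open>The inclusion just proved is applied to \<open>p\<close> and to \<open>flip p\<close>,
  since \<open>flip\<close> is an involution on the type space.\<close>

lemma prods_flip:
  assumes p: "p \<in> S_G R" and r: "prods p q = {r}"
  shows "prods (flip p) q = {flip r}"
proof -
  have "r' = flip r" if r': "r' \<in> prods (flip p) q" for r'
  proof -
    have "flip r' \<in> prods (flip (flip p)) q" by (rule prods_flip_subset[OF flip_in_S_G[OF p] r'])
    then have eq: "flip r' = r" using r flip_flip[OF p] by simp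
    have "r' \<in> S_G R"
      by (rule prodsE[OF r']) (use mtp_in_S_G SL2_mult in metis)
    then show ?thesis using flip_flip[of r'] eq by simp
  qed
  moreover have "flip r \<in> prods (flip p) q" using prods_flip_subset[OF p, of r q] r by simp
  ultimately show ?thesis by blast
qed

section \<open>Minimality of the orbit closure and the ideal group\<close>

lemma orbit_r0:
  assumes "a0 \<in> SL2" "mtp R a0 = r0 R"
  shows "orbit R (r0 R) = (\<lambda>g. mtp R (emb g ** a0)) ` SL2"
  unfolding orbit_def SL2_over_range image_image assms(2)[symmetric] act_mtp[OF assms(1)] ..

abbreviation orbit_closure :: "'k fm set set" where
  "orbit_closure \<equiv> stone R closure_of orbit R (r0 R)"

text \<open>With a realization \<open>a0\<close> fixed, membership becomes a statement about
  matrices: every formula of \<open>b\<close> holds at a real translate of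
  \<open>a0\<close>.\<close>

lemma mem_orbit_closure:
  assumes a0: "a0 \<in> SL2" "mtp R a0 = r0 R"
  shows "mtp R b \<in> orbit_closure \<longleftrightarrow> b \<in> SL2 \<and>
    (\<forall>\<phi>. fm_below \<phi> 4 \<longrightarrow> sat (map_fm \<iota> \<phi>) (entries b) \<longrightarrow> (\<exists>g\<in>SL2. sat (map_fm \<iota> \<phi>) (entries (emb g ** a0))))"
proof -
  have sub: "orbit R (r0 R) \<subseteq> S_G R"
    unfolding orbit_r0[OF a0] using a0(1) by (auto intro!: mtp_in_S_G SL2_mult simp: emb_SL2)
  have mem: "mtp R b \<in> S_G R \<longleftrightarrow> b \<in> SL2"
    using SL2_fm_in_mtp[of b] mtp_in_S_G[of b] by (auto simp: S_G_def)
  have in_mtp: "map_fm \<iota> \<phi> \<in> mtp R x \<longleftrightarrow> fm_below \<phi> 4 \<and> sat (map_fm \<iota> \<phi>) (entries x)" for \<phi> x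
    unfolding mtp_eq map_fm_mem by simp
  have "(\<forall>\<phi>\<in>mtp R b. P \<phi>) \<longleftrightarrow>
      (\<forall>\<phi>. fm_below \<phi> 4 \<longrightarrow> sat (map_fm \<iota> \<phi>) (entries b) \<longrightarrow> P (map_fm \<iota> \<phi>))" for P
    unfolding mtp_eq by blast
  then show ?thesis
    unfolding in_closure_stone[OF sub] mem unfolding orbit_r0[OF a0] by (simp add: in_mtp)
qed

lemma orbit_closure_generic:
  assumes "p \<in> orbit_closure"
  shows "generic_type p"
proof -
  obtain a0 where a0: "a0 \<in> SL2" "mtp R a0 = r0 R" using r0_realized by blast
  have S: "p \<in> S_G R" using assms unfolding in_closure_of topspace_stone by (rule conjunct1)
  have "generic_rows b" if b: "mtp R b = p" for b
  proof -
    have *: "b \<in> SL2 \<and> (\<forall>\<phi>. fm_below \<phi> 4 \<longrightarrow> sat (map_fm \<iota> \<phi>) (entries b) \<longrightarrow>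
      (\<exists>g\<in>SL2. sat (map_fm \<iota> \<phi>) (entries (emb g ** a0))))"
      using assms unfolding b[symmetric] mem_orbit_closure[OF a0] .
    show ?thesis by (rule generic_rows_closure[OF *[THEN conjunct1] a0(2) *[THEN conjunct2, rule_format]])
  qed
  then show ?thesis using S by (simp add: generic_type_def)
qed

lemma orbit_subset_closure: "orbit R (r0 R) \<subseteq> orbit_closure"
proof (rule closure_of_subset)
  obtain a0 where a0: "a0 \<in> SL2" "mtp R a0 = r0 R" using r0_realized by blast
  show "orbit R (r0 R) \<subseteq> topspace (stone R)"
    unfolding orbit_r0[OF a0] topspace_stone using a0(1) by (auto intro!: mtp_in_S_G SL2_mult simp: emb_SL2)
qed

lemma r0_in_closure: "r0 R \<in> orbit_closure" "flip (r0 R) \<in> orbit_closure"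
proof -
  obtain a0 where a0: "a0 \<in> SL2" "mtp R a0 = r0 R" using r0_realized by blast
  have "mtp R (emb (mat 1) ** a0) \<in> orbit R (r0 R)"
    "mtp R (emb (- mat 1) ** a0) \<in> orbit R (r0 R)"
    unfolding orbit_r0[OF a0] using neg_one_SL2 by (auto intro!: imageI simp: SL2_def)
  then show "r0 R \<in> orbit_closure" "flip (r0 R) \<in> orbit_closure"
    using orbit_subset_closure flip_mtp[OF a0(1)] a0(2) by (auto simp: emb_mat1 emb_neg1_mult)
qed

lemma act_flip: "act R (emb (- mat 1)) p = flip p"
  by (simp add: flip_def)

lemma closed_invariant_orbit_closure: "closed_invariant R orbit_closure"
  unfolding closed_invariant_def
proof (intro conjI ballI closedin_closure_of)
  fix g p assume "g \<in> SL2_over R" and p: "p \<in> orbit_closure"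
  then obtain g' where g': "g' \<in> SL2" "g = emb g'" unfolding SL2_over_range by blast
  obtain a0 where a0: "a0 \<in> SL2" "mtp R a0 = r0 R" using r0_realized by blast
  have "p \<in> S_G R" using orbit_closure_generic[OF p] by (simp add: generic_type_def)
  then obtain b where b: "b \<in> SL2" "mtp R b = p" by (rule realize_S_G)
  have "mtp R (emb g' ** b) \<in> orbit_closure"
    unfolding mem_orbit_closure[OF a0]
  proof (intro conjI allI impI)
    show "emb g' ** b \<in> SL2" using g'(1) b(1) by (intro SL2_mult) (simp_all add: emb_SL2)
    fix \<phi> :: "real fm" assume \<phi>: "fm_below \<phi> 4" "sat (map_fm \<iota> \<phi>) (entries (emb g' ** b))"
    have left: "sat (map_fm \<iota> (left_mult_fm g' \<phi>)) (entries x) = sat (map_fm \<iota> \<phi>) (entries (emb g' ** x))" for x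
    proof -
      have "map_fm \<iota> (left_mult_fm g' \<phi>) = left_mult_fm (emb g') (map_fm \<iota> \<phi>)" by (simp add: left_mult_fm_def)
      then show ?thesis using \<phi>(1) by (simp add: sat_left_mult_fm)
    qed
    obtain h where h: "h \<in> SL2" "sat (map_fm \<iota> (left_mult_fm g' \<phi>)) (entries (emb h ** a0))"
      using p[folded b(2), unfolded mem_orbit_closure[OF a0], THEN conjunct2, rule_format, of "left_mult_fm g' \<phi>"]
        \<phi>(2) by (auto simp: left)
    then show "\<exists>g\<in>SL2. sat (map_fm \<iota> \<phi>) (entries (emb g ** a0))"
      using g'(1) by (intro bexI[of _ "g' ** h"]) (simp_all add: left emb_mult matrix_mul_assoc SL2_mult)
  qed
  then show "act R g p \<in> orbit_closure" using act_mtp[OF b(1)] b(2) g'(2) by simp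
qed

text \<open>The product of \<open>r0\<close> with \<open>p\<close> lies in \<open>J\<close>, which
  is closed and invariant. If it is the flip of \<open>r0\<close>, acting by minus the identity
  leads back to \<open>r0\<close>.\<close>

lemma r0_mem_closed_invariant:
  assumes J: "closed_invariant R J" "J \<subseteq> orbit_closure" and p: "p \<in> J"
  shows "r0 R \<in> J"
proof -
  let ?r0 = "r0 R"
  have gen: "generic_type p" using orbit_closure_generic J(2) p by blast
  then have pS: "p \<in> S_G R" by (simp add: generic_type_def)
  have act: "act R (emb g) q \<in> J" if "g \<in> SL2" "q \<in> J" for g q
    using J(1) that unfolding closed_invariant_def SL2_over_range by blast
  obtain r where r: "prods ?r0 p = {r}" "r = ?r0 \<or> r = flip ?r0" using prods_r0[OF gen] by blast
  have JS: "J \<subseteq> S_G R" using J(1) closedin_subset topspace_stone unfolding closed_invariant_def by blast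
  have "r \<in> stone R closure_of J"
    unfolding in_closure_stone[OF JS]
  proof (intro conjI ballI)
    show "r \<in> S_G R" using r(2) r0_in_S_G flip_in_S_G by blast
    fix \<phi> assume "\<phi> \<in> r"
    then obtain g where "g \<in> SL2" "\<phi> \<in> act R (emb g) p"
      using coheir_product_approximated[OF r0_in_S_G pS r(1)] by blast
    then show "\<exists>q\<in>J. \<phi> \<in> q" using act[OF _ p] by blast
  qed
  then have "r \<in> J" using J(1) by (simp add: closed_invariant_def closure_of_closedin)
  then show ?thesis
    using r(2) act[OF neg_one_SL2, of r] flip_flip[OF r0_in_S_G] by (auto simp: act_flip)
qed

lemma minimal_orbit_closure: "minimal_closed_invariant R orbit_closure"
  unfolding minimal_closed_invariant_def
proof (intro conjI allI impI closed_invariant_orbit_closure)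
  show "orbit_closure \<noteq> {}" using r0_in_closure by blast
  fix J assume J: "J \<noteq> {} \<and> closed_invariant R J \<and> J \<subseteq> orbit_closure"
  then obtain p where "p \<in> J" by blast
  then have "r0 R \<in> J" using r0_mem_closed_invariant J by blast
  then have "orbit R (r0 R) \<subseteq> J"
    using J by (auto simp: orbit_def closed_invariant_def)
  then have "orbit_closure \<subseteq> J"
    using J by (intro closure_of_minimal) (auto simp: closed_invariant_def)
  then show "J = orbit_closure" using J by blast
qed

text \<open>The slope of a realization of \<open>r0\<close> is infinitesimal, so its first column
  points along the positive first axis. This decides the sign of the products below.\<close>

lemma r0_near_direction:
  assumes "mtp R b = r0 R"
  shows "near_direction b 1 0"
proof -
  have b: "0 < b$1$1" by (rule r0_first_entry[OF assms])
  have "near (b$2$1 / b$1$1) 0"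
    unfolding near_def
  proof (intro allI impI)
    fix d :: real assume d: "d > 0"
    let ?\<phi> = "Conj (Less Zero (Var 2)) (Less (Var 2) (Times (Param d) (Var 0)))"
    have "ev2 (\<lambda>b c. sat ?\<phi> (lower m b c))" if "0 < m" "m < d" for m
      using ev2_gt(1)[of 0] by (rule ev2_mono) (use that in \<open>simp add: lower_def not_le\<close>)
    then have "ev_lower ?\<phi>"
      unfolding ev_lower_def by (intro eventually_mono[OF eventually_at_right_real[OF d]]) auto
    then have "sat (map_fm \<iota> ?\<phi>) (entries b)" using r0_sat[OF assms, of ?\<phi>] by simp
    then have "0 < b$2$1" "b$2$1 < \<iota> d * b$1$1" by (simp_all add: entries_def not_le)
    then show "\<bar>b$2$1 / b$1$1 - \<iota> 0\<bar> < \<iota> d" using b by (simp add: abs_divide divide_less_eq)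
  qed
  moreover have "near (b$1$1 / b$1$1) 1" using b by (simp add: near_def)
  ultimately show ?thesis unfolding near_direction_def using b by blast
qed

text \<open>\<open>prods_r0\<close> leaves one sign open, and a single product determines it. A
  realization of \<open>r0\<close> has the direction (1, 0); its negative realizes the flip and
  points the opposite way.\<close>

lemma prods_r0_r0: "prods (r0 R) (r0 R) = {r0 R}"
  and prods_r0_flip: "prods (r0 R) (flip (r0 R)) = {flip (r0 R)}"
proof -
  let ?r0 = "r0 R"
  have pos: "positive_direction 1 0" by (simp add: positive_direction_def)
  have gen: "generic_type ?r0" "generic_type (flip ?r0)" using orbit_closure_generic r0_in_closure by blast+
  obtain b where b: "b \<in> SL2" "mtp R b = ?r0" using r0_realized by blast
  obtain a where a: "a \<in> SL2"
    "is_coheir R (R \<union> set (entries b)) ?r0 (mtp (R \<union> set (entries b)) a)"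
    "mtp R (a ** b) \<in> prods ?r0 (mtp R b)"
    using prods_nonempty[OF r0_in_S_G b(1)] .
  have "generic_rows b" using gen(1) b(2) by (simp add: generic_type_def)
  then have "mtp R (signed True (a ** b)) = ?r0"
    by (rule coheir_product_type[OF _ a(2) pos]) (simp add: signed_def r0_near_direction b(2))
  then have "?r0 \<in> prods ?r0 ?r0" using a(3) b(2) by (simp add: signed_def)
  then show "prods ?r0 ?r0 = {?r0}" using prods_r0[OF gen(1)] flip_r0_neq by auto
  define b' where "b' = - b"
  have b': "b' \<in> SL2" "mtp R b' = flip ?r0"
    using b flip_mtp[OF b(1)] by (simp_all add: b'_def SL2_uminus)
  obtain a' where a': "a' \<in> SL2"
    "is_coheir R (R \<union> set (entries b')) ?r0 (mtp (R \<union> set (entries b')) a')"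
    "mtp R (a' ** b') \<in> prods ?r0 (mtp R b')"
    using prods_nonempty[OF r0_in_S_G b'(1)] .
  have "generic_rows b'" using gen(2) b'(2) by (simp add: generic_type_def)
  then have "mtp R (signed False (a' ** b')) = ?r0"
    by (rule coheir_product_type[OF _ a'(2) pos]) (simp add: signed_def b'_def r0_near_direction b(2))
  then have "flip (mtp R (a' ** b')) = ?r0"
    using flip_mtp[OF SL2_mult[OF a'(1) b'(1)]] by (simp add: signed_def)
  then have "mtp R (a' ** b') \<noteq> ?r0" using flip_r0_neq by auto
  then show "prods ?r0 (flip ?r0) = {flip ?r0}" using a'(3) b'(2) prods_r0[OF gen(2)] by auto
qed

text \<open>The carrier consists of \<open>r0\<close> and its flip. Products with the flip on the
  left follow from \<open>prods_flip\<close>, which gives the multiplication table of the group of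
  order two.\<close>

theorem ideal_group:
  shows "star R (r0 R) (r0 R) = r0 R"
    and "group \<lparr>carrier = star R (r0 R) ` orbit_closure, monoid.mult = star R, one = r0 R\<rparr>"
    and "card (star R (r0 R) ` orbit_closure) = 2"
proof -
  let ?e = "r0 R" and ?f = "flip (r0 R)" and ?s = "star R"
  have ee: "?s ?e ?e = ?e" by (rule star_prods[OF prods_r0_r0])
  have ef: "?s ?e ?f = ?f" by (rule star_prods[OF prods_r0_flip])
  have fe: "?s ?f ?e = ?f" by (rule star_prods[OF prods_flip[OF r0_in_S_G prods_r0_r0]])
  have ff: "?s ?f ?f = ?e"
    using star_prods[OF prods_flip[OF r0_in_S_G prods_r0_flip]] flip_flip[OF r0_in_S_G] by simp
  have "?s ?e p \<in> {?e, ?f}" if "p \<in> orbit_closure" for p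
    using prods_r0[OF orbit_closure_generic[OF that]] star_prods[of ?e p] by blast
  moreover have "?e \<in> ?s ?e ` orbit_closure" "?f \<in> ?s ?e ` orbit_closure"
    using ee ef r0_in_closure by (metis imageI)+
  ultimately have carrier: "?s ?e ` orbit_closure = {?e, ?f}" by blast
  show "?s ?e ?e = ?e" by (rule ee)
  show "card (?s ?e ` orbit_closure) = 2" using flip_r0_neq by (simp add: carrier card_insert_if eq_commute)
  show "group \<lparr>carrier = ?s ?e ` orbit_closure, monoid.mult = ?s, one = ?e\<rparr>"
    unfolding carrier by (rule groupI) (auto simp: ee ef fe ff)
qed

end

theorem theorem3p17:
  fixes \<iota> :: "real \<Rightarrow> 'k::linordered_field"
    and \<kappa> :: "'c rel"
    and R :: "'k set"
    and I :: "'k fm set set"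
  assumes "real_closed TYPE('k)"
    and "elementary_embedding \<iota>"
    and "Card_order \<kappa>"
    and "|UNIV :: real set| <o \<kappa>"
    and "saturated \<kappa> TYPE('k)"
    and "R = range \<iota>"
    and "I = stone R closure_of orbit R (r0 R)"
  shows "minimal_closed_invariant R I
    \<and> r0 R \<in> S_G R \<and> star R (r0 R) (r0 R) = r0 R
    \<and> group \<lparr>carrier = star R (r0 R) ` I, monoid.mult = star R, one = r0 R\<rparr>
    \<and> card (star R (r0 R) ` I) = 2"
proof -
  interpret saturated_extension \<iota> \<kappa>
    using assms(1-5) by unfold_locales
  show ?thesis
    unfolding assms(7) unfolding assms(6)
    using minimal_orbit_closure r0_in_S_G ideal_group by blast
qed

end
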